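(* Let $\beta$ be an ordinal with $\omega^\omega\le\beta\le\varepsilon_0$. Then $\beta$ satisfies a monadic second order limit law: for every monadic second order sentence $\varphi$ in the language of linear orders, the limit $$\lim_{n\to\infty}\frac{\#\{\alpha<\beta:\ \alpha\models\varphi,\ N(\alpha)=n\}}{\#\{\alpha<\beta:\ N(\alpha)=n\}}$$ exists. Moreover, if $\beta<\varepsilon_0$, this limit is always a rational number.
   Context: Let $\varepsilon_0$ be the least ordinal $\xi$ with $\xi=\omega^\xi$. Every $\alpha<\varepsilon_0$ has a unique Cantor normal form $\alpha=\omega^{\alpha_1}+\cdots+\omega^{\alpha_n}$ with $\alpha_1\ge\cdots\ge\alpha_n$ (with $n=0$ for $\alpha=0$). The norm $N:\varepsilon_0\to\mathbb N$ is defined recursively by $N(0)=0$ and $N(\alpha)=n+N(\alpha_1)+\cdots+N(\alpha_n)$. For each infinite $\beta\le\varepsilon_0$ and each $n$, the set $\{\alpha<\beta:N(\alpha)=n\}$ is finite and non-empty. The monadic second order language of linear orders has a single relation symbol $<$ (no constants, no function symbols); $\alpha\models\varphi$ means that the structure $\langle\alpha,<\rangle$, where $\alpha$ is identified with the set of smaller ordinals, satisfies $\varphi$, set variables ranging over all subsets of $\alpha$. *)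

theory Defs
  imports Complex_Main "HOL-Library.Countable_Set_Type"
begin

section \<open>Countable ordinals\<close>

text \<open>
  The type \<open>ordinal\<close> is a well-order of type \<open>\<omega>\<^sub>1\<close>: its elements are the countable ordinals,
  \<open>\<alpha>\<close> being identified with the set \<open>{..<\<alpha>}\<close> of smaller ones.
  All ordinals up to and including \<open>\<epsilon>\<^sub>0\<close> are countable.
\<close>

typedef ordinal = "Field (cardSuc natLeq)"
proof -
  have "Field (cardSuc natLeq) \<noteq> {}"
    using Field_cardSuc_not_empty natLeq_Card_order by blast
  then show ?thesis by blast
qed

instantiation ordinal :: wellorder
begin

definition less_eq_ordinal :: "ordinal \<Rightarrow> ordinal \<Rightarrow> bool" where
  "\<alpha> \<le> \<beta> \<longleftrightarrow> (Rep_ordinal \<alpha>, Rep_ordinal \<beta>) \<in> cardSuc natLeq"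

definition less_ordinal :: "ordinal \<Rightarrow> ordinal \<Rightarrow> bool" where
  "\<alpha> < \<beta> \<longleftrightarrow> \<alpha> \<le> \<beta> \<and> \<not> \<beta> \<le> (\<alpha> :: ordinal)"

instance
proof -
  let ?r = "cardSuc natLeq"
  have wo: "Well_order ?r"
    using cardSuc_Card_order[OF natLeq_Card_order] by (simp add: card_order_on_def)
  then have rfl: "Refl ?r" and tr: "trans ?r" and anti: "antisym ?r" and tot: "Total ?r"
    and wf: "wf (?r - Id)"
    by (auto simp: order_on_defs)
  have R: "Rep_ordinal \<alpha> \<in> Field ?r" for \<alpha>
    by (rule Rep_ordinal)
  have le_total: "\<alpha> \<le> \<beta> \<or> \<beta> \<le> \<alpha>" for \<alpha> \<beta> :: ordinal
    using rfl tot R[of \<alpha>] R[of \<beta>] unfolding less_eq_ordinal_def refl_on_def total_on_def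
    by (cases "Rep_ordinal \<alpha> = Rep_ordinal \<beta>") auto
  show "OFCLASS(ordinal, wellorder_class)"
  proof
    fix P :: "ordinal \<Rightarrow> bool" and \<alpha> :: ordinal
    assume step: "\<And>\<alpha>. (\<And>\<beta>. \<beta> < \<alpha> \<Longrightarrow> P \<beta>) \<Longrightarrow> P \<alpha>"
    have eq: "{(\<beta>, \<alpha>). \<beta> < \<alpha>} = inv_image (?r - Id) Rep_ordinal"
      using anti rfl R
      by (auto simp: less_ordinal_def less_eq_ordinal_def inv_image_def Rep_ordinal_inject
          refl_on_def dest: antisymD)
    have "wf {(\<beta>, \<alpha> :: ordinal). \<beta> < \<alpha>}"
      unfolding eq using wf by (rule wf_inv_image)
    then show "P \<alpha>"
      by (induction rule: wf_induct_rule) (use step in auto)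
  next
    fix \<alpha> \<beta> \<gamma> :: ordinal
    show "\<alpha> \<le> \<alpha>"
      using rfl R by (auto simp: less_eq_ordinal_def refl_on_def)
    show "\<alpha> \<le> \<gamma>" if "\<alpha> \<le> \<beta>" "\<beta> \<le> \<gamma>"
      using that tr by (auto simp: less_eq_ordinal_def dest: transD)
    show "\<alpha> = \<beta>" if "\<alpha> \<le> \<beta>" "\<beta> \<le> \<alpha>"
      using that anti by (auto simp: less_eq_ordinal_def Rep_ordinal_inject dest: antisymD)
    show "\<alpha> \<le> \<beta> \<or> \<beta> \<le> \<alpha>"
      by (rule le_total)
    show "\<alpha> < \<beta> \<longleftrightarrow> \<alpha> \<le> \<beta> \<and> \<not> \<beta> \<le> \<alpha>"
      by (rule less_ordinal_def)
  qed
qed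

end

lemma countable_lessThan_ordinal:
  includes cardinal_syntax
  shows "countable {..<\<alpha> :: ordinal}"
proof -
  let ?r = "cardSuc natLeq"
  have co: "Card_order ?r"
    by (rule cardSuc_Card_order[OF natLeq_Card_order])
  have "|underS ?r (Rep_ordinal \<alpha>)| <o ?r"
    by (rule card_of_underS[OF co Rep_ordinal])
  then have "|underS ?r (Rep_ordinal \<alpha>)| \<le>o natLeq"
    using cardSuc_ordLeq_ordLess[OF natLeq_Card_order card_of_Card_order] by blast
  then have "countable (underS ?r (Rep_ordinal \<alpha>))"
    by (simp add: countable_card_le_natLeq)
  moreover have "Rep_ordinal ` {..<\<alpha>} \<subseteq> underS ?r (Rep_ordinal \<alpha>)"
    by (auto simp: underS_def less_le less_eq_ordinal_def Rep_ordinal_inject)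
  ultimately have "countable (Rep_ordinal ` {..<\<alpha>})"
    by (rule countable_subset[rotated])
  then show ?thesis
    by (rule countable_image_inj_on) (auto simp: inj_on_def Rep_ordinal_inject)
qed

lemma uncountable_ordinal:
  includes cardinal_syntax
  shows "uncountable (UNIV :: ordinal set)"
proof
  let ?r = "cardSuc natLeq"
  assume "countable (UNIV :: ordinal set)"
  then have "countable (range Rep_ordinal)" by simp
  then have "countable (Field ?r)"
    by (simp add: type_definition.Rep_range[OF type_definition_ordinal])
  then have "|Field ?r| \<le>o natLeq"
    by (simp add: countable_card_le_natLeq)
  then have "?r \<le>o natLeq"
    using card_of_Field_ordIso[OF cardSuc_Card_order[OF natLeq_Card_order]]
      ordIso_ordLeq_trans ordIso_symmetric by blast
  then show False
    using cardSuc_greater[OF natLeq_Card_order] not_ordLess_ordLeq by blast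
qed

lemma ex_strict_upper_bound:
  assumes "countable (A :: ordinal set)"
  shows "\<exists>\<beta>. \<forall>\<alpha>\<in>A. \<alpha> < \<beta>"
proof (rule ccontr)
  assume "\<not> ?thesis"
  then have "UNIV \<subseteq> (\<Union>\<alpha>\<in>A. insert \<alpha> {..<\<alpha>})"
    by (fastforce simp: not_less le_less)
  moreover have "countable (\<Union>\<alpha>\<in>A. insert \<alpha> {..<\<alpha>})"
    using assms countable_lessThan_ordinal by blast
  ultimately show False
    using uncountable_ordinal countable_subset by blast
qed


section \<open>Ordinal arithmetic by transfinite recursion\<close>

instantiation ordinal :: zero
begin
definition zero_ordinal :: ordinal where "0 = (LEAST \<alpha> :: ordinal. True)"
instance ..
end

lemma ordinal_zero_le [simp]: "0 \<le> (\<alpha> :: ordinal)"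
  by (simp add: zero_ordinal_def Least_le)

lemma ordinal_not_less_zero [simp]: "\<not> \<alpha> < (0 :: ordinal)"
  by (simp add: not_less)

lemma ordinal_le_zero [simp]: "\<alpha> \<le> (0 :: ordinal) \<longleftrightarrow> \<alpha> = 0"
  by (simp add: antisym_conv)

lemma ordinal_zero_less_iff: "0 < (\<alpha> :: ordinal) \<longleftrightarrow> \<alpha> \<noteq> 0"
  by (simp add: less_le)

definition osuc :: "ordinal \<Rightarrow> ordinal" where
  "osuc \<alpha> = (LEAST \<beta>. \<alpha> < \<beta>)"

text \<open>Countable sets of ordinals have a supremum; \<open>osup\<close> is only used for these.\<close>

definition osup :: "ordinal set \<Rightarrow> ordinal" where
  "osup A = (LEAST \<beta>. \<forall>\<alpha>\<in>A. \<alpha> \<le> \<beta>)"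

lemma less_osuc [simp]: "\<alpha> < osuc \<alpha>"
  unfolding osuc_def
  using ex_strict_upper_bound[of "{\<alpha>}"] by (auto intro: LeastI)

lemma osuc_le_iff: "osuc \<alpha> \<le> \<beta> \<longleftrightarrow> \<alpha> < \<beta>"
  by (metis Least_le less_osuc order_less_le_trans osuc_def)

lemma less_osuc_iff: "\<alpha> < osuc \<beta> \<longleftrightarrow> \<alpha> \<le> \<beta>"
  by (meson not_less osuc_le_iff)

lemma osuc_inject [simp]: "osuc \<alpha> = osuc \<beta> \<longleftrightarrow> \<alpha> = \<beta>"
  by (metis less_osuc less_osuc_iff order_antisym)

lemma osuc_neq_zero [simp]: "osuc \<alpha> \<noteq> 0"
  by (metis less_osuc ordinal_not_less_zero)

lemma osup_upper: "countable A \<Longrightarrow> \<alpha> \<in> A \<Longrightarrow> \<alpha> \<le> osup A"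
  unfolding osup_def
  by (rule LeastI2_ex) (use ex_strict_upper_bound[of A] in \<open>auto intro: less_imp_le\<close>)

lemma osup_least: "(\<And>\<alpha>. \<alpha> \<in> A \<Longrightarrow> \<alpha> \<le> \<beta>) \<Longrightarrow> osup A \<le> \<beta>"
  unfolding osup_def by (rule Least_le) auto

lemma less_osupE:
  assumes "\<beta> < osup A"
  obtains \<alpha> where "\<alpha> \<in> A" "\<beta> < \<alpha>"
  using osup_least[of A \<beta>] assms by (meson not_le)

function orec :: "ordinal \<Rightarrow> (ordinal \<Rightarrow> ordinal) \<Rightarrow> ordinal \<Rightarrow> ordinal" where
  "orec z s \<alpha> =
    (if \<alpha> = 0 then z
     else if \<exists>\<beta>. \<alpha> = osuc \<beta> then s (orec z s (THE \<beta>. \<alpha> = osuc \<beta>))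
     else osup (orec z s ` {..<\<alpha>}))"
  by auto
termination
  by (relation "inv_image {(\<alpha>, \<beta>). \<alpha> < \<beta>} (\<lambda>(z, s, \<alpha>). \<alpha>)") (auto intro: wf)

declare orec.simps [simp del]

definition olimit :: "ordinal \<Rightarrow> bool" where
  "olimit \<alpha> \<longleftrightarrow> \<alpha> \<noteq> 0 \<and> (\<forall>\<beta><\<alpha>. osuc \<beta> < \<alpha>)"

lemma olimit_iff: "olimit \<alpha> \<longleftrightarrow> \<alpha> \<noteq> 0 \<and> (\<nexists>\<beta>. \<alpha> = osuc \<beta>)"
  unfolding olimit_def using osuc_le_iff[of _ \<alpha>] by (auto simp: le_less)

lemma orec_0: "orec z s 0 = z"
  by (simp add: orec.simps)

lemma orec_osuc: "orec z s (osuc \<alpha>) = s (orec z s \<alpha>)"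
  by (subst orec.simps) simp

lemma orec_limit: "olimit \<alpha> \<Longrightarrow> orec z s \<alpha> = osup (orec z s ` {..<\<alpha>})"
  by (subst orec.simps) (simp add: olimit_iff)

instantiation ordinal :: "{one, plus, times}"
begin
definition one_ordinal :: ordinal where "1 = osuc 0"
definition plus_ordinal :: "ordinal \<Rightarrow> ordinal \<Rightarrow> ordinal" where
  "\<alpha> + \<beta> = orec \<alpha> osuc \<beta>"
definition times_ordinal :: "ordinal \<Rightarrow> ordinal \<Rightarrow> ordinal" where
  "\<alpha> * \<beta> = orec 0 (\<lambda>\<gamma>. \<gamma> + \<alpha>) \<beta>"
instance ..
end

definition omega :: ordinal (\<open>\<omega>\<close>) where
  "\<omega> = (LEAST \<alpha>. olimit \<alpha>)"

definition omega_pow :: "ordinal \<Rightarrow> ordinal" where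
  "omega_pow \<alpha> = orec 1 (\<lambda>\<gamma>. \<gamma> * \<omega>) \<alpha>"

definition epsilon_0 :: ordinal (\<open>\<epsilon>\<^sub>0\<close>) where
  "\<epsilon>\<^sub>0 = (LEAST \<xi>. \<xi> = omega_pow \<xi>)"



subsection \<open>Monotonicity and division\<close>

lemma osup_upper_lessThan: "\<beta> < \<alpha> \<Longrightarrow> f \<beta> \<le> osup (f ` {..<\<alpha> :: ordinal})"
  using countable_lessThan_ordinal by (intro osup_upper) auto

lemma ordinal_cases [case_names zero suc limit]:
  obtains "\<alpha> = 0" | \<beta> where "\<alpha> = osuc \<beta>" | "olimit \<alpha>"
  using olimit_iff by blast

lemma ordinal_induct [case_names zero suc limit]:
  assumes "P 0" "\<And>\<alpha>. P \<alpha> \<Longrightarrow> P (osuc \<alpha>)"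
    and "\<And>\<alpha>. olimit \<alpha> \<Longrightarrow> (\<And>\<beta>. \<beta> < \<alpha> \<Longrightarrow> P \<beta>) \<Longrightarrow> P \<alpha>"
  shows "P \<alpha>"
proof (induction \<alpha> rule: less_induct)
  case (less \<alpha>)
  show ?case
    by (cases \<alpha> rule: ordinal_cases) (use assms less in auto)
qed

context
  fixes z :: ordinal and s :: "ordinal \<Rightarrow> ordinal"
  assumes s: "\<And>x. z \<le> x \<Longrightarrow> x < s x"
begin

lemma orec_ge: "z \<le> orec z s \<alpha>"
proof (induction \<alpha> rule: ordinal_induct)
  case zero
  then show ?case by (simp add: orec_0)
next
  case (suc \<alpha>)
  then show ?case using s[OF suc] by (simp add: orec_osuc)
next
  case (limit \<alpha>)
  then have "orec z s 0 \<le> osup (orec z s ` {..<\<alpha>})"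
    by (intro osup_upper_lessThan) (simp add: olimit_def ordinal_zero_less_iff)
  with limit show ?case by (simp add: orec_limit orec_0)
qed

lemma orec_less: "\<alpha> < \<beta> \<Longrightarrow> orec z s \<alpha> < orec z s \<beta>"
proof (induction \<beta> rule: ordinal_induct)
  case zero
  then show ?case by simp
next
  case (suc \<beta>)
  have "orec z s \<alpha> \<le> orec z s \<beta>"
    using suc by (auto simp: less_osuc_iff le_less)
  also have "\<dots> < orec z s (osuc \<beta>)"
    using s[OF orec_ge] by (simp add: orec_osuc)
  finally show ?case .
next
  case (limit \<beta>)
  have "orec z s \<alpha> < orec z s (osuc \<alpha>)"
    using s[OF orec_ge] by (simp add: orec_osuc)
  also have "\<dots> \<le> orec z s \<beta>"
    using limit by (simp add: orec_limit olimit_def osup_upper_lessThan)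
  finally show ?case .
qed

lemma orec_less_iff: "orec z s \<alpha> < orec z s \<beta> \<longleftrightarrow> \<alpha> < \<beta>"
  using orec_less[of \<alpha> \<beta>] orec_less[of \<beta> \<alpha>] by (cases \<alpha> \<beta> rule: linorder_cases) auto

lemma orec_le_iff: "orec z s \<alpha> \<le> orec z s \<beta> \<longleftrightarrow> \<alpha> \<le> \<beta>"
  using orec_less_iff[of \<beta> \<alpha>] by (simp add: not_less[symmetric])

lemma orec_eq_iff: "orec z s \<alpha> = orec z s \<beta> \<longleftrightarrow> \<alpha> = \<beta>"
  using orec_less[of \<alpha> \<beta>] orec_less[of \<beta> \<alpha>] by (cases \<alpha> \<beta> rule: linorder_cases) auto

lemma orec_self_le: "\<alpha> \<le> orec z s \<alpha>"
proof (induction \<alpha> rule: less_induct)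
  case (less \<alpha>)
  show ?case
  proof (rule ccontr)
    assume "\<not> ?thesis"
    then have lt: "orec z s \<alpha> < \<alpha>" by simp
    from less.IH[OF lt] orec_less[OF lt] show False by simp
  qed
qed

lemma orec_division:
  assumes "z \<le> \<beta>"
  obtains \<alpha> where "orec z s \<alpha> \<le> \<beta>" "\<beta> < orec z s (osuc \<alpha>)"
proof -
  define \<gamma> where "\<gamma> = (LEAST \<gamma>. \<beta> < orec z s \<gamma>)"
  have "\<beta> < orec z s (osuc \<beta>)"
    using orec_self_le[of "osuc \<beta>"] less_osuc by (rule order_less_le_trans[rotated])
  then have \<gamma>: "\<beta> < orec z s \<gamma>"
    unfolding \<gamma>_def by (rule LeastI)
  have below: "orec z s \<delta> \<le> \<beta>" if "\<delta> < \<gamma>" for \<delta>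
    using not_less_Least[of \<delta> "\<lambda>\<gamma>. \<beta> < orec z s \<gamma>"] that by (simp add: \<gamma>_def)
  show thesis
  proof (cases \<gamma> rule: ordinal_cases)
    case zero
    then show ?thesis using \<gamma> assms by (simp add: orec_0)
  next
    case (suc \<delta>)
    then show ?thesis using \<gamma> below[of \<delta>] that[of \<delta>] by simp
  next
    case limit
    then have "orec z s \<gamma> \<le> \<beta>"
      using below by (auto simp: orec_limit intro: osup_least)
    then show ?thesis using \<gamma> by simp
  qed
qed

end

lemma add_0_right_ordinal [simp]: "\<alpha> + 0 = (\<alpha> :: ordinal)"
  by (simp add: plus_ordinal_def orec_0)

lemma add_osuc: "\<alpha> + osuc \<beta> = osuc (\<alpha> + \<beta>)"
  by (simp add: plus_ordinal_def orec_osuc)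

lemma add_limit: "olimit \<beta> \<Longrightarrow> \<alpha> + \<beta> = osup ((+) \<alpha> ` {..<\<beta>})"
  unfolding plus_ordinal_def by (rule orec_limit)

lemma add_less_iff_ordinal [simp]: "\<alpha> + \<beta> < \<alpha> + \<gamma> \<longleftrightarrow> \<beta> < (\<gamma> :: ordinal)"
  unfolding plus_ordinal_def by (rule orec_less_iff) simp

lemma add_le_iff_ordinal [simp]: "\<alpha> + \<beta> \<le> \<alpha> + \<gamma> \<longleftrightarrow> \<beta> \<le> (\<gamma> :: ordinal)"
  unfolding plus_ordinal_def by (rule orec_le_iff) simp

lemma add_left_cancel_ordinal [simp]: "\<alpha> + \<beta> = \<alpha> + \<gamma> \<longleftrightarrow> \<beta> = (\<gamma> :: ordinal)"
  unfolding plus_ordinal_def by (rule orec_eq_iff) simp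

lemma le_add1_ordinal: "\<alpha> \<le> \<alpha> + (\<beta> :: ordinal)"
  unfolding plus_ordinal_def by (rule orec_ge) simp

lemma le_add2_ordinal: "\<beta> \<le> \<alpha> + (\<beta> :: ordinal)"
  unfolding plus_ordinal_def by (rule orec_self_le) simp

lemma less_add_ordinal: "0 < \<beta> \<Longrightarrow> \<alpha> < \<alpha> + (\<beta> :: ordinal)"
  using add_less_iff_ordinal[of \<alpha> 0 \<beta>] by simp

lemma le_imp_add_ordinal:
  assumes "\<alpha> \<le> (\<beta> :: ordinal)"
  obtains \<gamma> where "\<beta> = \<alpha> + \<gamma>"
proof -
  obtain \<gamma> where "\<alpha> + \<gamma> \<le> \<beta>" "\<beta> < \<alpha> + osuc \<gamma>"
    using orec_division[of \<alpha> osuc \<beta>] assms unfolding plus_ordinal_def by auto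
  then show thesis
    using that[of \<gamma>] by (simp add: add_osuc less_osuc_iff)
qed

lemma add_0_left_ordinal [simp]: "0 + \<alpha> = (\<alpha> :: ordinal)"
proof (induction \<alpha> rule: ordinal_induct)
  case (limit \<alpha>)
  have "0 + \<alpha> \<le> \<alpha>"
    unfolding add_limit[OF limit(1)] by (rule osup_least) (use limit in auto)
  then show ?case using le_add2_ordinal[of \<alpha> 0] by simp
qed (simp_all add: add_osuc)

lemma add_mono_left_ordinal:
  assumes "\<alpha> \<le> (\<beta> :: ordinal)"
  shows "\<alpha> + \<gamma> \<le> \<beta> + \<gamma>"
proof (induction \<gamma> rule: ordinal_induct)
  case (limit \<gamma>)
  show ?case
    unfolding add_limit[OF limit(1)]
  proof (rule osup_least, safe)
    fix \<delta> assume "\<delta> < \<gamma>"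
    then show "\<alpha> + \<delta> \<le> osup ((+) \<beta> ` {..<\<gamma>})"
      using limit(2)[of \<delta>] osup_upper_lessThan[of \<delta> \<gamma> "(+) \<beta>"] by simp
  qed
qed (use assms in \<open>simp_all add: add_osuc osuc_le_iff less_osuc_iff\<close>)

lemma olimit_add:
  assumes "olimit \<beta>"
  shows "olimit (\<alpha> + \<beta>)"
  unfolding olimit_def
proof safe
  assume "\<alpha> + \<beta> = 0"
  then show False using assms le_add2_ordinal[of \<beta> \<alpha>] by (simp add: olimit_def)
next
  fix \<delta> assume lt: "\<delta> < \<alpha> + \<beta>"
  have "\<exists>\<gamma><\<beta>. \<delta> < \<alpha> + \<gamma>"
  proof (rule ccontr)
    assume "\<not> ?thesis"
    then have "\<alpha> + \<beta> \<le> \<delta>"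
      unfolding add_limit[OF assms] by (intro osup_least) (force simp: not_less)
    then show False using lt by simp
  qed
  then obtain \<gamma> where "\<gamma> < \<beta>" "\<delta> < \<alpha> + \<gamma>" by blast
  then have "osuc \<delta> < osuc (\<alpha> + \<gamma>)" by (simp add: less_osuc_iff osuc_le_iff)
  also have "\<dots> = \<alpha> + osuc \<gamma>" by (simp add: add_osuc)
  also have "\<dots> < \<alpha> + \<beta>" using \<open>\<gamma> < \<beta>\<close> assms by (simp add: olimit_def)
  finally show "osuc \<delta> < \<alpha> + \<beta>" .
qed

lemma add_assoc_ordinal: "(\<alpha> + \<beta>) + \<gamma> = \<alpha> + (\<beta> + (\<gamma> :: ordinal))"
proof (induction \<gamma> rule: ordinal_induct)
  case (limit \<gamma>)
  show ?case
  proof (rule antisym)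
    show "(\<alpha> + \<beta>) + \<gamma> \<le> \<alpha> + (\<beta> + \<gamma>)"
      unfolding add_limit[OF limit(1), of "\<alpha> + \<beta>"] by (rule osup_least) (use limit in auto)
    show "\<alpha> + (\<beta> + \<gamma>) \<le> (\<alpha> + \<beta>) + \<gamma>"
      unfolding add_limit[OF olimit_add[OF limit(1)]]
    proof (rule osup_least, safe)
      fix \<delta> assume \<delta>: "\<delta> < \<beta> + \<gamma>"
      show "\<alpha> + \<delta> \<le> (\<alpha> + \<beta>) + \<gamma>"
      proof (cases "\<beta> \<le> \<delta>")
        case True
        then obtain \<eta> where \<eta>: "\<delta> = \<beta> + \<eta>" by (rule le_imp_add_ordinal)
        with \<delta> have "\<eta> < \<gamma>" by simp
        then have "(\<alpha> + \<beta>) + \<eta> \<le> (\<alpha> + \<beta>) + \<gamma>" by simp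
        then show ?thesis by (simp only: \<eta> limit(2)[OF \<open>\<eta> < \<gamma>\<close>])
      next
        case False
        then have "\<alpha> + \<delta> \<le> \<alpha> + \<beta>" by simp
        also have "\<dots> \<le> (\<alpha> + \<beta>) + \<gamma>" by (rule le_add1_ordinal)
        finally show ?thesis .
      qed
    qed
  qed
qed (simp_all add: add_osuc)

lemma mult_0_right_ordinal [simp]: "\<alpha> * 0 = (0 :: ordinal)"
  by (simp add: times_ordinal_def orec_0)

lemma mult_osuc: "\<alpha> * osuc \<beta> = \<alpha> * \<beta> + \<alpha>"
  by (simp add: times_ordinal_def orec_osuc)

lemma mult_limit: "olimit \<beta> \<Longrightarrow> \<alpha> * \<beta> = osup ((*) \<alpha> ` {..<\<beta>})"
  unfolding times_ordinal_def by (rule orec_limit)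

lemma mult_less_iff_ordinal: "0 < \<alpha> \<Longrightarrow> \<alpha> * \<beta> < \<alpha> * \<gamma> \<longleftrightarrow> \<beta> < (\<gamma> :: ordinal)"
  unfolding times_ordinal_def by (rule orec_less_iff) (rule less_add_ordinal)

lemma ex_olimit: "\<exists>\<alpha>. olimit \<alpha>"
proof -
  define A where "A = range (\<lambda>n. (osuc ^^ n) 0)"
  have *: "countable A" by (simp add: A_def)
  have mem: "osuc ((osuc ^^ n) 0) \<in> A" for n
    unfolding A_def by (rule range_eqI[of _ _ "Suc n"]) simp
  have up: "(osuc ^^ n) 0 < osup A" for n
    using osup_upper[OF * mem, of n] by (simp add: osuc_le_iff)
  have "osuc \<beta> < osup A" if "\<beta> < osup A" for \<beta>
  proof -
    obtain n where "\<beta> < (osuc ^^ n) 0"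
      using \<open>\<beta> < osup A\<close> by (auto simp: A_def elim: less_osupE)
    then have "osuc \<beta> \<le> (osuc ^^ n) 0" by (simp add: osuc_le_iff)
    also have "\<dots> < osup A" by (rule up)
    finally show ?thesis .
  qed
  moreover have "osup A \<noteq> 0" using up[of 0] by auto
  ultimately show ?thesis by (auto simp: olimit_def)
qed

lemma olimit_omega: "olimit \<omega>"
  unfolding omega_def using ex_olimit by (rule LeastI_ex)

lemma funpow_osuc_less_omega: "(osuc ^^ n) 0 < \<omega>"
  using olimit_omega by (induction n) (auto simp: olimit_def ordinal_zero_less_iff)

lemma less_omegaE:
  assumes "\<alpha> < \<omega>"
  obtains n where "\<alpha> = (osuc ^^ n) 0"
proof -
  have "\<exists>n. \<alpha> = (osuc ^^ n) 0"
    using assms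
  proof (induction \<alpha> rule: ordinal_induct)
    case zero
    show ?case by (rule exI[of _ 0]) simp
  next
    case (suc \<alpha>)
    then obtain n where "\<alpha> = (osuc ^^ n) 0"
      using less_osuc order_less_trans by blast
    then show ?case by (intro exI[of _ "Suc n"]) simp
  next
    case (limit \<alpha>)
    then show ?case using not_less_Least[of \<alpha> olimit] by (simp add: omega_def)
  qed
  then show thesis using that by blast
qed

lemma omega_pow_0 [simp]: "omega_pow 0 = 1"
  by (simp add: omega_pow_def orec_0)

lemma omega_pow_osuc: "omega_pow (osuc \<alpha>) = omega_pow \<alpha> * \<omega>"
  by (simp add: omega_pow_def orec_osuc)

lemma omega_pow_limit: "olimit \<alpha> \<Longrightarrow> omega_pow \<alpha> = osup (omega_pow ` {..<\<alpha>})"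
  unfolding omega_pow_def by (rule orec_limit)

lemma ordinal_one_le_iff: "1 \<le> (\<alpha> :: ordinal) \<longleftrightarrow> \<alpha> \<noteq> 0"
  by (simp add: one_ordinal_def osuc_le_iff ordinal_zero_less_iff)

lemma less_mult_omega:
  assumes "1 \<le> (\<alpha> :: ordinal)"
  shows "\<alpha> < \<alpha> * \<omega>"
proof -
  have "0 < \<alpha>" using assms by (simp add: ordinal_one_le_iff ordinal_zero_less_iff)
  moreover have "osuc 0 < \<omega>" using funpow_osuc_less_omega[of 1] by simp
  ultimately have "\<alpha> * osuc 0 < \<alpha> * \<omega>" by (simp add: mult_less_iff_ordinal)
  then show ?thesis by (simp add: mult_osuc)
qed

lemma omega_pow_ge_1: "1 \<le> omega_pow \<alpha>"
  unfolding omega_pow_def by (rule orec_ge) (rule less_mult_omega)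

lemma omega_pow_pos: "0 < omega_pow \<alpha>"
  using omega_pow_ge_1[of \<alpha>] by (simp add: ordinal_one_le_iff ordinal_zero_less_iff)

lemma omega_pow_less_iff: "omega_pow \<alpha> < omega_pow \<beta> \<longleftrightarrow> \<alpha> < \<beta>"
  unfolding omega_pow_def by (rule orec_less_iff) (rule less_mult_omega)

lemma omega_pow_le_iff: "omega_pow \<alpha> \<le> omega_pow \<beta> \<longleftrightarrow> \<alpha> \<le> \<beta>"
  using omega_pow_less_iff[of \<beta> \<alpha>] by (simp add: not_less[symmetric])

lemma le_omega_pow: "\<alpha> \<le> omega_pow \<alpha>"
  unfolding omega_pow_def by (rule orec_self_le) (rule less_mult_omega)

lemma omega_pow_division:
  assumes "\<beta> \<noteq> 0"
  obtains \<alpha> where "omega_pow \<alpha> \<le> \<beta>" "\<beta> < omega_pow (osuc \<alpha>)"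
  using orec_division[of 1 "\<lambda>\<gamma>. \<gamma> * \<omega>" \<beta>] assms less_mult_omega
  by (auto simp: omega_pow_def ordinal_one_le_iff)

lemma ex_epsilon: "\<exists>\<xi>. \<xi> = omega_pow \<xi>"
proof -
  define A where "A = range (\<lambda>n. (omega_pow ^^ n) 0)"
  define \<xi> where "\<xi> = osup A"
  have up: "omega_pow ((omega_pow ^^ n) 0) \<le> \<xi>" for n
    unfolding \<xi>_def A_def
    by (rule osup_upper) (auto intro: range_eqI[of _ _ "Suc n"])
  have low: "\<exists>n. \<beta> < (omega_pow ^^ n) 0" if "\<beta> < \<xi>" for \<beta>
    using that[unfolded \<xi>_def] by (auto simp: A_def elim: less_osupE)
  have pow: "omega_pow \<beta> \<le> \<xi>" if \<beta>: "\<beta> < \<xi>" for \<beta>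
  proof -
    obtain n where "\<beta> < (omega_pow ^^ n) 0" using low[OF \<beta>] by blast
    then have "omega_pow \<beta> \<le> omega_pow ((omega_pow ^^ n) 0)" by (simp add: omega_pow_le_iff)
    also have "\<dots> \<le> \<xi>" by (rule up)
    finally show ?thesis .
  qed
  have "omega_pow \<xi> \<le> \<xi>"
  proof (cases \<xi> rule: ordinal_cases)
    case zero
    then show ?thesis using up[of 0] by simp
  next
    case (suc \<beta>)
    then obtain n where "\<beta> < (omega_pow ^^ n) 0" using low[of \<beta>] by auto
    then have "\<xi> \<le> (omega_pow ^^ n) 0" by (simp add: suc osuc_le_iff)
    then have "omega_pow \<xi> \<le> omega_pow ((omega_pow ^^ n) 0)" by (simp add: omega_pow_le_iff)
    also have "\<dots> \<le> \<xi>" by (rule up)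
    finally show ?thesis .
  next
    case limit
    then show ?thesis using pow by (auto simp: omega_pow_limit intro: osup_least)
  qed
  then show ?thesis using le_omega_pow[of \<xi>] by (intro exI[of _ \<xi>]) simp
qed

lemma epsilon_0_fixpoint: "omega_pow \<epsilon>\<^sub>0 = \<epsilon>\<^sub>0"
  unfolding epsilon_0_def using LeastI_ex[OF ex_epsilon] by simp

lemma less_omega_pow: "\<alpha> < \<epsilon>\<^sub>0 \<Longrightarrow> \<alpha> < omega_pow \<alpha>"
  using le_omega_pow[of \<alpha>] not_less_Least[of \<alpha> "\<lambda>\<xi>. \<xi> = omega_pow \<xi>"]
  by (auto simp: epsilon_0_def le_less)


section \<open>Cantor normal form and the norm\<close>

text \<open>\<open>is_cnf \<alpha> [\<alpha>\<^sub>1, \<dots>, \<alpha>\<^sub>n]\<close> says that \<open>\<alpha> = \<omega>\<^bsup>\<alpha>\<^sub>1\<^esup> + \<dots> + \<omega>\<^bsup>\<alpha>\<^sub>n\<^esup>\<close> with \<open>\<alpha>\<^sub>1 \<ge> \<dots> \<ge> \<alpha>\<^sub>n\<close>.\<close>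

definition is_cnf :: "ordinal \<Rightarrow> ordinal list \<Rightarrow> bool" where
  "is_cnf \<alpha> as \<longleftrightarrow> sorted_wrt (\<ge>) as \<and> \<alpha> = foldr (+) (map omega_pow as) 0"

lemma cnf_exists: "\<exists>as. is_cnf \<alpha> as"
proof (induction \<alpha> rule: less_induct)
  case (less \<alpha>)
  show ?case
  proof (cases "\<alpha> = 0")
    case True
    then show ?thesis by (intro exI[of _ "[]"]) (simp add: is_cnf_def)
  next
    case False
    then obtain a where a: "omega_pow a \<le> \<alpha>" "\<alpha> < omega_pow (osuc a)"
      by (rule omega_pow_division)
    then obtain \<gamma> where \<gamma>: "\<alpha> = omega_pow a + \<gamma>"
      using le_imp_add_ordinal by blast
    have "\<gamma> \<noteq> \<alpha>"
    proof
      assume eq: "\<gamma> = \<alpha>"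
      have "omega_pow a + \<alpha> = \<alpha>"
        using \<gamma> unfolding eq by (rule sym)
      then have "omega_pow a * (osuc ^^ n) 0 + \<alpha> = \<alpha>" for n
        by (induction n) (simp_all add: mult_osuc add_assoc_ordinal)
      then have "omega_pow a * (osuc ^^ n) 0 \<le> \<alpha>" for n
        using le_add1_ordinal[of "omega_pow a * (osuc ^^ n) 0" \<alpha>] by simp
      then have "omega_pow a * \<omega> \<le> \<alpha>"
        unfolding mult_limit[OF olimit_omega] by (intro osup_least) (auto elim: less_omegaE)
      with a(2) show False by (simp add: omega_pow_osuc)
    qed
    moreover have "\<gamma> \<le> \<alpha>" using le_add2_ordinal \<gamma> by blast
    ultimately have "\<gamma> < \<alpha>" by simp
    then obtain bs where bs: "is_cnf \<gamma> bs" using less by blast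
    have "\<forall>b\<in>set bs. b \<le> a"
    proof (cases bs)
      case (Cons b cs)
      have "omega_pow b \<le> \<gamma>"
        using bs le_add1_ordinal by (auto simp: is_cnf_def Cons)
      also have "\<gamma> < omega_pow (osuc a)" using \<open>\<gamma> < \<alpha>\<close> a(2) by simp
      finally have "b \<le> a" by (simp add: omega_pow_less_iff less_osuc_iff)
      then show ?thesis using bs by (auto simp: is_cnf_def Cons)
    qed simp
    then have "is_cnf \<alpha> (a # bs)"
      using bs \<gamma> by (simp add: is_cnf_def)
    then show ?thesis by blast
  qed
qed

lemma foldr_omega_pow_bound:
  assumes "\<And>a. a \<in> set as \<Longrightarrow> a \<le> c"
  shows "foldr (+) (map omega_pow as) 0 < omega_pow (osuc c)"
proof -
  let ?x = "omega_pow c"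
  have comm: "?x + ?x * (osuc ^^ n) 0 = ?x * osuc ((osuc ^^ n) 0)" for n
    by (induction n) (simp_all add: mult_osuc flip: add_assoc_ordinal)
  have "foldr (+) (map omega_pow as) 0 \<le> ?x * (osuc ^^ length as) 0"
    using assms
  proof (induction as)
    case Nil
    then show ?case by simp
  next
    case (Cons a as)
    have "omega_pow a + foldr (+) (map omega_pow as) 0 \<le> omega_pow a + ?x * (osuc ^^ length as) 0"
      using Cons by simp
    also have "\<dots> \<le> ?x + ?x * (osuc ^^ length as) 0"
      using Cons.prems by (intro add_mono_left_ordinal) (simp add: omega_pow_le_iff)
    finally show ?case by (simp add: comm)
  qed
  also have "\<dots> < ?x * \<omega>"
    by (simp add: mult_less_iff_ordinal omega_pow_pos funpow_osuc_less_omega)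
  finally show ?thesis by (simp add: omega_pow_osuc)
qed

lemma cnf_unique: "is_cnf \<alpha> as \<Longrightarrow> is_cnf \<alpha> bs \<Longrightarrow> as = bs"
proof (induction as arbitrary: \<alpha> bs)
  case Nil
  then show ?case
    using omega_pow_pos order_less_le_trans[OF omega_pow_pos le_add1_ordinal]
    by (cases bs) (auto simp: is_cnf_def ordinal_zero_less_iff)
next
  case (Cons a as)
  let ?S = "\<lambda>as. foldr (+) (map omega_pow as) 0"
  have \<alpha>: "\<alpha> = omega_pow a + ?S as" using Cons.prems by (simp add: is_cnf_def)
  have "\<alpha> \<noteq> 0"
    using omega_pow_pos[of a] le_add1_ordinal[of "omega_pow a" "?S as"] \<alpha> by auto
  then obtain b cs where bs: "bs = b # cs"
    using Cons.prems by (cases bs) (auto simp: is_cnf_def)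
  have \<alpha>': "\<alpha> = omega_pow b + ?S cs" using Cons.prems by (simp add: is_cnf_def bs)
  have "\<alpha> < omega_pow (osuc a)" "\<alpha> < omega_pow (osuc b)"
    using foldr_omega_pow_bound[of "a # as" a] foldr_omega_pow_bound[of bs b] Cons.prems
    by (auto simp: is_cnf_def bs)
  moreover have "omega_pow a \<le> \<alpha>" "omega_pow b \<le> \<alpha>"
    by (simp add: \<alpha> le_add1_ordinal, simp add: \<alpha>' le_add1_ordinal)
  ultimately have "omega_pow a < omega_pow (osuc b)" "omega_pow b < omega_pow (osuc a)"
    by auto
  then have "a = b" by (simp add: omega_pow_less_iff less_osuc_iff)
  moreover have "as = cs"
    using Cons.prems \<alpha> \<alpha>' \<open>a = b\<close> by (intro Cons.IH[of "?S as"]) (auto simp: is_cnf_def bs)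
  ultimately show ?case by (simp add: bs)
qed

definition cnf :: "ordinal \<Rightarrow> ordinal list" where
  "cnf \<alpha> = (THE as. is_cnf \<alpha> as)"

lemma is_cnf_cnf: "is_cnf \<alpha> (cnf \<alpha>)"
  unfolding cnf_def by (rule theI') (use cnf_exists cnf_unique in blast)

lemma cnf_eqI: "is_cnf \<alpha> as \<Longrightarrow> cnf \<alpha> = as"
  using is_cnf_cnf cnf_unique by blast

lemma cnf_exponent_less:
  assumes "\<alpha> < \<epsilon>\<^sub>0" "a \<in> set (cnf \<alpha>)"
  shows "a < \<alpha>"
proof -
  have mem: "omega_pow a \<le> foldr (+) (map omega_pow as) 0" if "a \<in> set as" for as
    using that
  proof (induction as)
    case (Cons b as)
    then show ?case
      using le_add1_ordinal[of "omega_pow b"] order_trans[OF Cons.IH le_add2_ordinal] by auto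
  qed simp
  have le: "omega_pow a \<le> \<alpha>"
    using mem[OF assms(2)] is_cnf_cnf[of \<alpha>] by (simp add: is_cnf_def)
  then have "a \<le> \<alpha>" using le_omega_pow order_trans by blast
  then have "a < \<epsilon>\<^sub>0" using assms(1) by simp
  then show ?thesis using less_omega_pow le by (meson order_less_le_trans)
qed

text \<open>\<open>cnf_norm\<close> is the norm \<open>N\<close>; it is only meaningful below \<open>\<epsilon>\<^sub>0\<close>, where exponents decrease.\<close>

function cnf_norm :: "ordinal \<Rightarrow> nat" where
  "cnf_norm \<alpha> = (if \<alpha> < \<epsilon>\<^sub>0 then length (cnf \<alpha>) + (\<Sum>a\<leftarrow>cnf \<alpha>. cnf_norm a) else 0)"
  by auto
termination
  by (relation "{(\<alpha>, \<beta>). \<alpha> < \<beta>}") (auto intro: wf cnf_exponent_less)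

declare cnf_norm.simps [simp del]

lemma cnf_norm_is_cnf:
  assumes "\<alpha> < \<epsilon>\<^sub>0" "is_cnf \<alpha> as"
  shows "cnf_norm \<alpha> = length as + (\<Sum>a\<leftarrow>as. cnf_norm a)"
  using assms by (subst cnf_norm.simps) (simp add: cnf_eqI)


section \<open>Monadic second order logic of linear orders\<close>

text \<open>
  Element variables and set variables are two separate families, each indexed by \<open>nat\<close>.
  The language has equality; the other connectives and quantifiers are definable.
\<close>

datatype mso =
    Less nat nat
  | Equal nat nat
  | Mem nat nat \<comment> \<open>element variable, set variable\<close>
  | Neg mso
  | Conj mso mso
  | Ex_elem nat mso
  | Ex_set nat mso

primrec free_elem :: "mso \<Rightarrow> nat set" where
  "free_elem (Less x y) = {x, y}"
| "free_elem (Equal x y) = {x, y}"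
| "free_elem (Mem x X) = {x}"
| "free_elem (Neg \<phi>) = free_elem \<phi>"
| "free_elem (Conj \<phi> \<psi>) = free_elem \<phi> \<union> free_elem \<psi>"
| "free_elem (Ex_elem x \<phi>) = free_elem \<phi> - {x}"
| "free_elem (Ex_set X \<phi>) = free_elem \<phi>"

primrec free_set :: "mso \<Rightarrow> nat set" where
  "free_set (Less x y) = {}"
| "free_set (Equal x y) = {}"
| "free_set (Mem x X) = {X}"
| "free_set (Neg \<phi>) = free_set \<phi>"
| "free_set (Conj \<phi> \<psi>) = free_set \<phi> \<union> free_set \<psi>"
| "free_set (Ex_elem x \<phi>) = free_set \<phi>"
| "free_set (Ex_set X \<phi>) = free_set \<phi> - {X}"

definition sentence :: "mso \<Rightarrow> bool" where
  "sentence \<phi> \<longleftrightarrow> free_elem \<phi> = {} \<and> free_set \<phi> = {}"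

primrec sat :: "'a set \<Rightarrow> ('a \<Rightarrow> 'a \<Rightarrow> bool) \<Rightarrow> (nat \<Rightarrow> 'a) \<Rightarrow> (nat \<Rightarrow> 'a set) \<Rightarrow> mso \<Rightarrow> bool" where
  "sat D R e E (Less x y) \<longleftrightarrow> R (e x) (e y)"
| "sat D R e E (Equal x y) \<longleftrightarrow> e x = e y"
| "sat D R e E (Mem x X) \<longleftrightarrow> e x \<in> E X"
| "sat D R e E (Neg \<phi>) \<longleftrightarrow> \<not> sat D R e E \<phi>"
| "sat D R e E (Conj \<phi> \<psi>) \<longleftrightarrow> sat D R e E \<phi> \<and> sat D R e E \<psi>"
| "sat D R e E (Ex_elem x \<phi>) \<longleftrightarrow> (\<exists>d\<in>D. sat D R (e(x := d)) E \<phi>)"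
| "sat D R e E (Ex_set X \<phi>) \<longleftrightarrow> (\<exists>A\<subseteq>D. sat D R e (E(X := A)) \<phi>)"

lemma sat_cong:
  assumes "\<And>x. x \<in> free_elem \<phi> \<Longrightarrow> e x = e' x" "\<And>X. X \<in> free_set \<phi> \<Longrightarrow> E X = E' X"
  shows "sat D R e E \<phi> \<longleftrightarrow> sat D R e' E' \<phi>"
  using assms
proof (induction \<phi> arbitrary: e e' E E')
  case (Ex_elem x \<phi>)
  have "sat D R (e(x := d)) E \<phi> \<longleftrightarrow> sat D R (e'(x := d)) E' \<phi>" for d
    using Ex_elem.prems by (intro Ex_elem.IH) auto
  then show ?case by simp
next
  case (Ex_set X \<phi>)
  have "sat D R e (E(X := A)) \<phi> \<longleftrightarrow> sat D R e' (E'(X := A)) \<phi>" for A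
    using Ex_set.prems by (intro Ex_set.IH) auto
  then show ?case by simp
next
  case (Neg \<phi>)
  from Neg.IH[of e e' E E'] Neg.prems show ?case by simp
next
  case (Conj \<phi> \<psi>)
  from Conj.IH(1)[of e e' E E'] Conj.IH(2)[of e e' E E'] Conj.prems show ?case by simp
qed simp_all

text \<open>
  By \<open>sat_cong\<close>, the assignment is irrelevant for sentences. It is an arbitrary one, not
  required to take its values in \<open>{..<\<alpha>}\<close>, because \<open>\<alpha>\<close> may be \<open>0\<close>.
\<close>

definition models :: "ordinal \<Rightarrow> mso \<Rightarrow> bool" (infix \<open>\<Turnstile>\<close> 50) where
  "\<alpha> \<Turnstile> \<phi> \<longleftrightarrow> sat {..<\<alpha>} (<) (\<lambda>_. undefined) (\<lambda>_. {}) \<phi>"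

definition mso_fraction :: "ordinal \<Rightarrow> mso \<Rightarrow> nat \<Rightarrow> real" where
  "mso_fraction \<beta> \<phi> n =
    real (card {\<alpha>. \<alpha> < \<beta> \<and> \<alpha> \<Turnstile> \<phi> \<and> cnf_norm \<alpha> = n}) / real (card {\<alpha>. \<alpha> < \<beta> \<and> cnf_norm \<alpha> = n})"

end

theory Submission
  imports Defs "HOL-Analysis.FPS_Convergence" "HOL-Library.Multiset"
begin

text \<open>
  By a back-and-forth argument the \<open>k\<close>-types of ordinals form a finite monoid with an \<open>\<omega>\<close>-power. A
  pigeonhole argument shows that \<open>\<omega>\<^bsup>\<gamma>\<^esup>\<close> has the same type for all \<open>\<gamma>\<close> from some finite \<open>m\<close> on (Buechi),
  so the truth of a sentence at \<open>\<alpha> \<ge> \<omega>\<^bsup>m\<^esup>\<close> depends only on the coefficients of \<open>\<omega>\<^bsup>i\<^esup>\<close>, \<open>i < m\<close>, up to a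
  threshold and a period.

  The ordinals below \<open>\<omega>\<^bsup>\<gamma>\<^esup>\<close> of norm \<open>n\<close> are the multisets of weight \<open>n\<close> of exponents \<open>\<delta> < \<gamma>\<close>, where \<open>\<delta>\<close>
  weighs \<open>1 + N(\<delta>)\<close>. Below \<open>\<epsilon>\<^sub>0\<close> the number \<open>a(n)\<close> of these satisfies \<open>a(n - 1) / a(n) \<longlonglongrightarrow> 1\<close>. This is
  proved by comparing the recursion \<open>n a(n) = \<Sum>\<^sub>k \<sigma>(k) a(n - k)\<close>, where \<open>\<sigma>(k)\<close> is the sum of the weights
  of the parts whose weight divides \<open>k\<close>, with the one for multisets avoiding one part. Hence
  bounded coefficients are negligible and residue classes are equidistributed.

  At \<open>\<epsilon>\<^sub>0\<close> the count is that of rooted trees. Its generating function is \<open>T = F(W)\<close>, where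
  \<open>F = z exp(F)\<close> and \<open>W = T exp(-T)\<close> has nonnegative coefficients and a larger radius of convergence than
  \<open>T\<close>. In almost all terms of this expansion the numbers of factors of \<open>W\<close> of degrees 3 and 4 are close
  to a fixed ratio; exchanging one factor of degree 3 for one of degree 4 then gives the ratio
  limit, and Tannery's theorem gives the limit law.
\<close>

text \<open>Two regimes shape the proof. Below \<open>\<epsilon>\<^sub>0\<close> the counts grow
  subexponentially: a fixed coefficient is almost always beyond the threshold, only its residue
  matters, and the limit is a quotient of two numbers of residue vectors, hence rational. At
  \<open>\<epsilon>\<^sub>0\<close> the ratio of consecutive counts tends to some \<rho> < 1, a
  fixed pattern of low coefficients can keep a positive share, and the limit is the sum of an
  infinite series. The obstacle is regularity. Whether a(n - 1) / a(n) tends to 1 for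
  \<omega>^\<gamma> depends on the distribution of the weights of its parts, and these are given by
  the norms of the ordinals below \<gamma>. So the ratio limits for \<gamma> and \<omega>^\<gamma>
  are proved together by induction on \<gamma>. At \<open>\<epsilon>\<^sub>0\<close>, a fixed point
  of \<omega>^\<gamma>, this becomes circular: parts and multisets are counted by the same sequence.
  Full asymptotics would require the singularity of T. The mere ratio limit follows from comparing
  real power series with nonnegative coefficients, where the gap between the radii of W and T makes
  the bad terms exponentially small.\<close>

section \<open>Monadic types of ordinals\<close>

text \<open>A back-and-forth game with set moves only, for structures whose elements are coded as
  singletons; the atoms are emptiness, inclusion and existence of a pair x < y. A move overwrites
  one of the variables in \<open>V\<close> instead of adding a new one, so that \<open>V\<close>
  stays fixed through all rounds and finiteness of the number of types can be proved by induction on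
  \<open>k\<close>.\<close>

fun mso_eqv :: "nat set \<Rightarrow> nat \<Rightarrow> ordinal set \<Rightarrow> (nat \<Rightarrow> ordinal set) \<Rightarrow>
    ordinal set \<Rightarrow> (nat \<Rightarrow> ordinal set) \<Rightarrow> bool" where
  "mso_eqv V 0 D A D' A' \<longleftrightarrow>
    (\<forall>a\<in>V. \<forall>b\<in>V. (A a = {} \<longleftrightarrow> A' a = {}) \<and> (A a \<subseteq> A b \<longleftrightarrow> A' a \<subseteq> A' b) \<and>
      ((\<exists>x\<in>A a. \<exists>y\<in>A b. x < y) \<longleftrightarrow> (\<exists>x\<in>A' a. \<exists>y\<in>A' b. x < y)))"
| "mso_eqv V (Suc k) D A D' A' \<longleftrightarrow> mso_eqv V k D A D' A' \<and>
    (\<forall>v\<in>V. (\<forall>B\<subseteq>D. \<exists>B'\<subseteq>D'. mso_eqv V k D (A(v := B)) D' (A'(v := B'))) \<and>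
      (\<forall>B'\<subseteq>D'. \<exists>B\<subseteq>D. mso_eqv V k D (A(v := B)) D' (A'(v := B'))))"

declare mso_eqv.simps [simp del]

lemma mso_eqv_0D:
  assumes "mso_eqv V 0 D A D' A'" "a \<in> V" "b \<in> V"
  shows "A a = {} \<longleftrightarrow> A' a = {}" "A a \<subseteq> A b \<longleftrightarrow> A' a \<subseteq> A' b"
    "(\<exists>x\<in>A a. \<exists>y\<in>A b. x < y) \<longleftrightarrow> (\<exists>x\<in>A' a. \<exists>y\<in>A' b. x < y)"
proof -
  note * = assms(1)[unfolded mso_eqv.simps, THEN bspec, OF assms(2), THEN bspec, OF assms(3)]
  show "A a = {} \<longleftrightarrow> A' a = {}" by (rule *[THEN conjunct1])
  show "A a \<subseteq> A b \<longleftrightarrow> A' a \<subseteq> A' b" by (rule *[THEN conjunct2, THEN conjunct1])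
  show "(\<exists>x\<in>A a. \<exists>y\<in>A b. x < y) \<longleftrightarrow> (\<exists>x\<in>A' a. \<exists>y\<in>A' b. x < y)"
    by (rule *[THEN conjunct2, THEN conjunct2])
qed

lemma mso_eqv_SucD:
  assumes "mso_eqv V (Suc k) D A D' A'"
  shows "mso_eqv V k D A D' A'"
    "v \<in> V \<Longrightarrow> B \<subseteq> D \<Longrightarrow> \<exists>B'\<subseteq>D'. mso_eqv V k D (A(v := B)) D' (A'(v := B'))"
    "v \<in> V \<Longrightarrow> B' \<subseteq> D' \<Longrightarrow> \<exists>B\<subseteq>D. mso_eqv V k D (A(v := B)) D' (A'(v := B'))"
  using assms unfolding mso_eqv.simps(2) by metis+

lemma mso_eqv_SucI:
  assumes "mso_eqv V k D A D' A'"
    "\<And>v B. v \<in> V \<Longrightarrow> B \<subseteq> D \<Longrightarrow> \<exists>B'\<subseteq>D'. mso_eqv V k D (A(v := B)) D' (A'(v := B'))"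
    "\<And>v B'. v \<in> V \<Longrightarrow> B' \<subseteq> D' \<Longrightarrow> \<exists>B\<subseteq>D. mso_eqv V k D (A(v := B)) D' (A'(v := B'))"
  shows "mso_eqv V (Suc k) D A D' A'"
  unfolding mso_eqv.simps(2) by (intro conjI ballI allI impI assms)

lemma mso_eqv_sym: "mso_eqv V k D A D' A' \<Longrightarrow> mso_eqv V k D' A' D A"
proof (induction k arbitrary: A A')
  case 0
  then show ?case unfolding mso_eqv.simps by simp
next
  case (Suc k)
  show ?case
  proof (rule mso_eqv_SucI)
    show "mso_eqv V k D' A' D A" by (rule Suc.IH[OF mso_eqv_SucD(1)[OF Suc.prems]])
  next
    fix v B assume "v \<in> V" "B \<subseteq> D'"
    then obtain B' where "B' \<subseteq> D" "mso_eqv V k D (A(v := B')) D' (A'(v := B))"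
      using mso_eqv_SucD(3)[OF Suc.prems] by metis
    then show "\<exists>B'\<subseteq>D. mso_eqv V k D' (A'(v := B)) D (A(v := B'))"
      using Suc.IH[of "A(v := B')" "A'(v := B)"] by metis
  next
    fix v B assume "v \<in> V" "B \<subseteq> D"
    then obtain B' where "B' \<subseteq> D'" "mso_eqv V k D (A(v := B)) D' (A'(v := B'))"
      using mso_eqv_SucD(2)[OF Suc.prems] by metis
    then show "\<exists>B'\<subseteq>D'. mso_eqv V k D' (A'(v := B')) D (A(v := B))"
      using Suc.IH[of "A(v := B)" "A'(v := B')"] by metis
  qed
qed

lemma mso_eqv_trans:
  "mso_eqv V k D A D' A' \<Longrightarrow> mso_eqv V k D' A' D'' A'' \<Longrightarrow> mso_eqv V k D A D'' A''"
proof (induction k arbitrary: A A' A'')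
  case 0
  then show ?case unfolding mso_eqv.simps by simp
next
  case (Suc k)
  have fwd: "\<exists>B''\<subseteq>D''. mso_eqv V k D (A(v := B)) D'' (A''(v := B''))" if vB: "v \<in> V" "B \<subseteq> D" for v B
  proof -
    obtain B' where B': "B' \<subseteq> D'" "mso_eqv V k D (A(v := B)) D' (A'(v := B'))"
      using mso_eqv_SucD(2)[OF Suc.prems(1) vB] by metis
    obtain B'' where B'': "B'' \<subseteq> D''" "mso_eqv V k D' (A'(v := B')) D'' (A''(v := B''))"
      using mso_eqv_SucD(2)[OF Suc.prems(2) vB(1) B'(1)] by metis
    then show ?thesis using Suc.IH[OF B'(2) B''(2)] by metis
  qed
  have bwd: "\<exists>B\<subseteq>D. mso_eqv V k D (A(v := B)) D'' (A''(v := B''))" if vB: "v \<in> V" "B'' \<subseteq> D''" for v B''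
  proof -
    obtain B' where B': "B' \<subseteq> D'" "mso_eqv V k D' (A'(v := B')) D'' (A''(v := B''))"
      using mso_eqv_SucD(3)[OF Suc.prems(2) vB] by metis
    obtain B where B: "B \<subseteq> D" "mso_eqv V k D (A(v := B)) D' (A'(v := B'))"
      using mso_eqv_SucD(3)[OF Suc.prems(1) vB(1) B'(1)] by metis
    then show ?thesis using Suc.IH[OF B(2) B'(2)] B(1) by metis
  qed
  have low: "mso_eqv V k D A D'' A''"
    using Suc.IH mso_eqv_SucD(1)[OF Suc.prems(1)] mso_eqv_SucD(1)[OF Suc.prems(2)] by blast
  show ?case by (rule mso_eqv_SucI[OF low fwd bwd])
qed

lemma mso_eqv_refl: "mso_eqv V k D A D A"
proof (induction k arbitrary: A)
  case (Suc k)
  show ?case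
  proof (rule mso_eqv_SucI)
    show "\<exists>B'\<subseteq>D. mso_eqv V k D (A(v := B)) D (A(v := B'))" if "B \<subseteq> D" for v B
      using Suc.IH[of "A(v := B)"] that by metis
    show "\<exists>B\<subseteq>D. mso_eqv V k D (A(v := B)) D (A(v := B'))" if "B' \<subseteq> D" for v B'
      using Suc.IH[of "A(v := B')"] that by metis
  qed (rule Suc.IH)
qed (simp add: mso_eqv.simps)

lemma mso_eqv_image:
  assumes f: "strict_mono_on D f" and A: "\<And>v. A v \<subseteq> D"
  shows "mso_eqv V k D A (f ` D) (\<lambda>v. f ` A v)"
  using A
proof (induction k arbitrary: A)
  case 0
  have inj: "inj_on f D" using f strict_mono_on_imp_inj_on by blast
  have "f ` A a \<subseteq> f ` A b \<longleftrightarrow> A a \<subseteq> A b" for a b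
  proof
    assume sub: "f ` A a \<subseteq> f ` A b"
    show "A a \<subseteq> A b"
    proof
      fix x assume x: "x \<in> A a"
      then obtain y where y: "y \<in> A b" "f x = f y" using sub by blast
      then have "x = y" using inj_onD[OF inj y(2)] x 0 by blast
      then show "x \<in> A b" using y by simp
    qed
  qed auto
  moreover have "f x < f y \<longleftrightarrow> x < y" if "x \<in> A a" "y \<in> A b" for x y a b
    using strict_mono_on_less[OF f, of x y] that 0 by blast
  ultimately show ?case unfolding mso_eqv.simps by simp
next
  case (Suc k)
  have upd: "(\<lambda>w. f ` A w)(v := f ` B) = (\<lambda>w. f ` (A(v := B)) w)" for v B
    by (simp add: fun_eq_iff)
  have upd_eqv: "mso_eqv V k D (A(v := B)) (f ` D) ((\<lambda>v. f ` A v)(v := f ` B))" if "B \<subseteq> D" for v B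
    unfolding upd using Suc that by (intro Suc.IH) auto
  show ?case
  proof (rule mso_eqv_SucI)
    show "mso_eqv V k D A (f ` D) (\<lambda>v. f ` A v)" by (rule Suc.IH) (rule Suc.prems)
  next
    fix v B assume "B \<subseteq> D"
    then show "\<exists>B'\<subseteq>f ` D. mso_eqv V k D (A(v := B)) (f ` D) ((\<lambda>v. f ` A v)(v := B'))"
      using upd_eqv[of B v] by (intro exI[of _ "f ` B"]) auto
  next
    fix v B' assume "B' \<subseteq> f ` D"
    then obtain B where "B \<subseteq> D" "B' = f ` B" by (auto simp: subset_image_iff)
    then show "\<exists>B\<subseteq>D. mso_eqv V k D (A(v := B)) (f ` D) ((\<lambda>v. f ` A v)(v := B'))"
      using upd_eqv[of B v] by auto
  qed
qed

text \<open>Composition theorem for ordered sums over the natural numbers: Duplicator answers in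
  each block separately and glues the answers. Blocks may be empty, so finite sums are covered
  too.\<close>

lemma mso_eqv_sum:
  fixes D D' :: "nat \<Rightarrow> ordinal set"
  assumes ord: "\<And>i j x y. i < j \<Longrightarrow> x \<in> D i \<Longrightarrow> y \<in> D j \<Longrightarrow> x < y"
    and ord': "\<And>i j x y. i < j \<Longrightarrow> x \<in> D' i \<Longrightarrow> y \<in> D' j \<Longrightarrow> x < y"
    and A: "\<And>v. A v \<subseteq> (\<Union>i. D i)" and A': "\<And>v. A' v \<subseteq> (\<Union>i. D' i)"
    and eqv: "\<And>i. mso_eqv V k (D i) (\<lambda>v. A v \<inter> D i) (D' i) (\<lambda>v. A' v \<inter> D' i)"
  shows "mso_eqv V k (\<Union>i. D i) A (\<Union>i. D' i) A'"
  using A A' eqv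
proof (induction k arbitrary: A A')
  case 0
  have emp: "A a \<inter> D i = {} \<longleftrightarrow> A' a \<inter> D' i = {}" if "a \<in> V" for a i
    using mso_eqv_0D[OF 0(3)[of i]] that by blast
  have sub: "A a \<inter> D i \<subseteq> A b \<inter> D i \<longleftrightarrow> A' a \<inter> D' i \<subseteq> A' b \<inter> D' i" if "a \<in> V" "b \<in> V" for a b i
    using mso_eqv_0D[OF 0(3)[of i]] that by blast
  have les: "(\<exists>x\<in>A a \<inter> D i. \<exists>y\<in>A b \<inter> D i. x < y) \<longleftrightarrow> (\<exists>x\<in>A' a \<inter> D' i. \<exists>y\<in>A' b \<inter> D' i. x < y)"
    if "a \<in> V" "b \<in> V" for a b i
    using mso_eqv_0D[OF 0(3)[of i]] that by blast
  have E: "A a = {} \<longleftrightarrow> (\<forall>i. A a \<inter> D i = {})" "A' a = {} \<longleftrightarrow> (\<forall>i. A' a \<inter> D' i = {})" for a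
    using 0 by blast+
  have S: "A a \<subseteq> A b \<longleftrightarrow> (\<forall>i. A a \<inter> D i \<subseteq> A b \<inter> D i)"
     "A' a \<subseteq> A' b \<longleftrightarrow> (\<forall>i. A' a \<inter> D' i \<subseteq> A' b \<inter> D' i)" for a b
    using 0 by blast+
  \<comment> \<open>A pair x < y lies in one block or in two blocks of increasing index. In the
    second case only nonemptiness of the traces matters, so the atoms of the sum are determined by
    the atoms of the blocks.\<close>
  have L: "(\<exists>x\<in>A a. \<exists>y\<in>A b. x < y) \<longleftrightarrow>
      (\<exists>i. \<exists>x\<in>A a \<inter> D i. \<exists>y\<in>A b \<inter> D i. x < y) \<or> (\<exists>i j. i < j \<and> A a \<inter> D i \<noteq> {} \<and> A b \<inter> D j \<noteq> {})"
    if A: "\<And>v. A v \<subseteq> (\<Union>i. D i)" and ord: "\<And>i j x y. i < j \<Longrightarrow> x \<in> D i \<Longrightarrow> y \<in> D j \<Longrightarrow> x < y"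
    for A :: "nat \<Rightarrow> ordinal set" and D :: "nat \<Rightarrow> ordinal set" and a b
  proof
    assume "\<exists>x\<in>A a. \<exists>y\<in>A b. x < y"
    then obtain x y where xy: "x \<in> A a" "y \<in> A b" "x < y" by blast
    then obtain i j where ij: "x \<in> D i" "y \<in> D j" using A by blast
    have "\<not> j < i" using ord[of j i y x] xy ij by auto
    then consider "i = j" | "i < j" by linarith
    then show "(\<exists>i. \<exists>x\<in>A a \<inter> D i. \<exists>y\<in>A b \<inter> D i. x < y) \<or>
        (\<exists>i j. i < j \<and> A a \<inter> D i \<noteq> {} \<and> A b \<inter> D j \<noteq> {})"
      by cases (use xy ij in blast)+
  qed (use ord in blast)
  show ?case
    unfolding mso_eqv.simps
  proof (intro ballI conjI)
    fix a b assume ab: "a \<in> V" "b \<in> V"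
    show "A a = {} \<longleftrightarrow> A' a = {}"
      unfolding E using emp[OF ab(1)] by simp
    show "A a \<subseteq> A b \<longleftrightarrow> A' a \<subseteq> A' b"
      unfolding S using sub[OF ab] by simp
    show "(\<exists>x\<in>A a. \<exists>y\<in>A b. x < y) \<longleftrightarrow> (\<exists>x\<in>A' a. \<exists>y\<in>A' b. x < y)"
    proof -
      have "(\<exists>x\<in>A a. \<exists>y\<in>A b. x < y) \<longleftrightarrow>
        (\<exists>i. \<exists>x\<in>A a \<inter> D i. \<exists>y\<in>A b \<inter> D i. x < y) \<or> (\<exists>i j. i < j \<and> A a \<inter> D i \<noteq> {} \<and> A b \<inter> D j \<noteq> {})"
        by (rule L) (fact 0(1), erule (2) ord)
      moreover have "(\<exists>x\<in>A' a. \<exists>y\<in>A' b. x < y) \<longleftrightarrow>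
        (\<exists>i. \<exists>x\<in>A' a \<inter> D' i. \<exists>y\<in>A' b \<inter> D' i. x < y) \<or> (\<exists>i j. i < j \<and> A' a \<inter> D' i \<noteq> {} \<and> A' b \<inter> D' j \<noteq> {})"
        by (rule L) (fact 0(2), erule (2) ord')
      ultimately show ?thesis
        unfolding les[OF ab] emp[OF ab(1)] emp[OF ab(2)] by (rule trans[OF _ sym])
    qed
  qed
next
  case (Suc k)
  \<comment> \<open>The local answers \<open>C i\<close> are united. The order makes the blocks
    disjoint, so cutting the union back to a block returns the local answer. The claim is made for
    arbitrary \<open>D\<close> and \<open>D'\<close> so as to serve both directions of the
    game.\<close>
  have step: "\<exists>B'\<subseteq>(\<Union>i. D' i). \<forall>i. mso_eqv V k (D i) (\<lambda>w. (A(v := B)) w \<inter> D i) (D' i) (\<lambda>w. (A'(v := B')) w \<inter> D' i)"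
    if v: "v \<in> V" and B: "B \<subseteq> (\<Union>i. D i)"
      and eqv: "\<And>i. mso_eqv V (Suc k) (D i) (\<lambda>v. A v \<inter> D i) (D' i) (\<lambda>v. A' v \<inter> D' i)"
      and ord': "\<And>i j x y. i < j \<Longrightarrow> x \<in> D' i \<Longrightarrow> y \<in> D' j \<Longrightarrow> x < y"
    for v B and D D' A A' :: "nat \<Rightarrow> ordinal set"
  proof -
    define R where "R i C \<longleftrightarrow> C \<subseteq> D' i \<and>
      mso_eqv V k (D i) ((\<lambda>v. A v \<inter> D i)(v := B \<inter> D i)) (D' i) ((\<lambda>v. A' v \<inter> D' i)(v := C))" for i C
    have "\<exists>C. R i C" for i
      using mso_eqv_SucD(2)[OF eqv[of i] v, of "B \<inter> D i"] unfolding R_def by blast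
    then obtain C where "\<And>i. R i (C i)" by metis
    then have C: "\<And>i. C i \<subseteq> D' i"
      "\<And>i. mso_eqv V k (D i) ((\<lambda>v. A v \<inter> D i)(v := B \<inter> D i)) (D' i) ((\<lambda>v. A' v \<inter> D' i)(v := C i))"
      unfolding R_def by simp_all
    have disj: "x \<notin> D' j" if "x \<in> D' i" "i \<noteq> j" for x i j
      using ord'[of i j x x] ord'[of j i x x] that by (cases i j rule: linorder_cases) auto
    have CD: "(\<Union>i. C i) \<inter> D' i = C i" for i
    proof
      show "C i \<subseteq> (\<Union>i. C i) \<inter> D' i" using C(1)[of i] by auto
      show "(\<Union>i. C i) \<inter> D' i \<subseteq> C i"
      proof
        fix x assume "x \<in> (\<Union>i. C i) \<inter> D' i"
        then obtain j where "x \<in> C j" "x \<in> D' i" by auto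
        then show "x \<in> C i" using C(1)[of j] disj[of x j i] by (cases "j = i") auto
      qed
    qed
    have "(\<lambda>v. A v \<inter> D i)(v := B \<inter> D i) = (\<lambda>w. (A(v := B)) w \<inter> D i)"
      "(\<lambda>v. A' v \<inter> D' i)(v := C i) = (\<lambda>w. (A'(v := (\<Union>i. C i))) w \<inter> D' i)" for i
      using CD[of i] by (simp_all add: fun_eq_iff)
    then have "mso_eqv V k (D i) (\<lambda>w. (A(v := B)) w \<inter> D i) (D' i) (\<lambda>w. (A'(v := (\<Union>i. C i))) w \<inter> D' i)" for i
      using C(2)[of i] by simp
    moreover have "(\<Union>i. C i) \<subseteq> (\<Union>i. D' i)" using C(1) by (rule UN_mono[OF subset_refl])
    ultimately show ?thesis by (intro exI conjI allI)
  qed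
  have 1: "\<exists>B'\<subseteq>(\<Union>i. D' i). mso_eqv V k (\<Union>i. D i) (A(v := B)) (\<Union>i. D' i) (A'(v := B'))"
    if vB: "v \<in> V" "B \<subseteq> (\<Union>i. D i)" for v B
  proof -
    have "\<exists>B'\<subseteq>(\<Union>i. D' i). \<forall>i. mso_eqv V k (D i) (\<lambda>w. (A(v := B)) w \<inter> D i) (D' i) (\<lambda>w. (A'(v := B')) w \<inter> D' i)"
      by (rule step[OF vB]) (rule Suc.prems(3), erule (2) ord')
    then obtain B' where B': "B' \<subseteq> (\<Union>i. D' i)"
      "\<forall>i. mso_eqv V k (D i) (\<lambda>w. (A(v := B)) w \<inter> D i) (D' i) (\<lambda>w. (A'(v := B')) w \<inter> D' i)"
      by (elim exE conjE) (rule that)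
    have "mso_eqv V k (\<Union>i. D i) (A(v := B)) (\<Union>i. D' i) (A'(v := B'))"
    proof (rule Suc.IH)
      show "(A(v := B)) w \<subseteq> (\<Union>i. D i)" for w using Suc.prems(1) vB by simp
      show "(A'(v := B')) w \<subseteq> (\<Union>i. D' i)" for w using Suc.prems(2) B'(1) by simp
    qed (rule B'(2)[THEN spec])
    with B'(1) show ?thesis by metis
  qed
  have 2: "\<exists>B\<subseteq>(\<Union>i. D i). mso_eqv V k (\<Union>i. D i) (A(v := B)) (\<Union>i. D' i) (A'(v := B'))"
    if vB: "v \<in> V" "B' \<subseteq> (\<Union>i. D' i)" for v B'
  proof -
    have "\<exists>B\<subseteq>(\<Union>i. D i). \<forall>i. mso_eqv V k (D' i) (\<lambda>w. (A'(v := B')) w \<inter> D' i) (D i) (\<lambda>w. (A(v := B)) w \<inter> D i)"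
      by (rule step[OF vB]) (rule mso_eqv_sym[OF Suc.prems(3)], erule (2) ord)
    then obtain B where B: "B \<subseteq> (\<Union>i. D i)"
      "\<forall>i. mso_eqv V k (D' i) (\<lambda>w. (A'(v := B')) w \<inter> D' i) (D i) (\<lambda>w. (A(v := B)) w \<inter> D i)"
      by (elim exE conjE) (rule that)
    have "mso_eqv V k (\<Union>i. D i) (A(v := B)) (\<Union>i. D' i) (A'(v := B'))"
    proof (rule Suc.IH)
      show "(A(v := B)) w \<subseteq> (\<Union>i. D i)" for w using Suc.prems(1) B(1) by simp
      show "(A'(v := B')) w \<subseteq> (\<Union>i. D' i)" for w using Suc.prems(2) vB by simp
    qed (rule mso_eqv_sym[OF B(2)[THEN spec]])
    with B(1) show ?thesis by metis
  qed
  have 3: "mso_eqv V k (\<Union>i. D i) A (\<Union>i. D' i) A'"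
    by (rule Suc.IH[OF Suc.prems(1,2) mso_eqv_SucD(1)[OF Suc.prems(3)]])
  show ?case by (rule mso_eqv_SucI[OF 3 1 2])
qed

text \<open>Rank \<open>k + 1\<close> is coded by the code of rank \<open>k\<close> together with
  the set of codes reachable by one move, that is, by a subset of a finite set. Coding into
  \<open>nat\<close> keeps the type of the classifying function the same at every level of the
  induction.\<close>

lemma mso_eqv_finite_index:
  assumes "finite V"
  shows "\<exists>f :: ordinal set \<Rightarrow> (nat \<Rightarrow> ordinal set) \<Rightarrow> nat. finite (range (case_prod f)) \<and>
    (\<forall>D A D' A'. f D A = f D' A' \<longrightarrow> mso_eqv V k D A D' A')"
proof (induction k)
  case 0
  define g where "g = (\<lambda>A :: nat \<Rightarrow> ordinal set.
    ({a\<in>V. A a = {}}, {(a, b). a \<in> V \<and> b \<in> V \<and> A a \<subseteq> A b},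
      {(a, b). a \<in> V \<and> b \<in> V \<and> (\<exists>x\<in>A a. \<exists>y\<in>A b. x < y)}))"
  have "range g \<subseteq> Pow V \<times> Pow (V \<times> V) \<times> Pow (V \<times> V)"
    unfolding g_def by auto
  then have fin: "finite (range g)"
    by (rule finite_subset) (use assms in auto)
  obtain h :: "_ \<Rightarrow> nat" where h: "inj_on h (range g)"
    using finite_imp_inj_to_nat_seg[OF fin] by blast
  have "finite (range (case_prod (\<lambda>(D :: ordinal set) A. h (g A))))"
    by (rule finite_subset[of _ "h ` range g"]) (use fin in auto)
  moreover have "mso_eqv V 0 D A D' A'" if "h (g A) = h (g A')" for D A D' A'
  proof -
    have "g A = g A'" using h that by (meson inj_onD rangeI)
    then have eq: "{a\<in>V. A a = {}} = {a\<in>V. A' a = {}} \<and>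
      {(a, b). a \<in> V \<and> b \<in> V \<and> A a \<subseteq> A b} = {(a, b). a \<in> V \<and> b \<in> V \<and> A' a \<subseteq> A' b} \<and>
      {(a, b). a \<in> V \<and> b \<in> V \<and> (\<exists>x\<in>A a. \<exists>y\<in>A b. x < y)} =
        {(a, b). a \<in> V \<and> b \<in> V \<and> (\<exists>x\<in>A' a. \<exists>y\<in>A' b. x < y)}"
      unfolding g_def by (simp only: prod.inject)
    show ?thesis
      unfolding mso_eqv.simps
    proof (intro ballI conjI)
      fix a b assume ab: "a \<in> V" "b \<in> V"
      show "A a = {} \<longleftrightarrow> A' a = {}"
        using arg_cong[OF eq[THEN conjunct1], of "\<lambda>S. a \<in> S"] ab by simp
      show "A a \<subseteq> A b \<longleftrightarrow> A' a \<subseteq> A' b"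
        using arg_cong[OF eq[THEN conjunct2, THEN conjunct1], of "\<lambda>S. (a, b) \<in> S"] ab by simp
      show "(\<exists>x\<in>A a. \<exists>y\<in>A b. x < y) \<longleftrightarrow> (\<exists>x\<in>A' a. \<exists>y\<in>A' b. x < y)"
        using arg_cong[OF eq[THEN conjunct2, THEN conjunct2], of "\<lambda>S. (a, b) \<in> S"] ab by simp
    qed
  qed
  ultimately show ?case by (intro exI[of _ "\<lambda>D A. h (g A)"] conjI allI impI)
next
  case (Suc k)
  then obtain f :: "ordinal set \<Rightarrow> (nat \<Rightarrow> ordinal set) \<Rightarrow> nat"
    where fin: "finite (range (case_prod f))"
      and f: "\<And>D A D' A'. f D A = f D' A' \<Longrightarrow> mso_eqv V k D A D' A'" by blast
  define g where "g = (\<lambda>D A. (f D A, {(v, f D (A(v := B))) | v B. v \<in> V \<and> B \<subseteq> D}))"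
  have in_ran: "f D A \<in> range (case_prod f)" for D A by (metis case_prod_conv rangeI)
  have "range (case_prod g) \<subseteq> range (case_prod f) \<times> Pow (V \<times> range (case_prod f))"
    unfolding g_def using in_ran by fastforce
  then have fing: "finite (range (case_prod g))"
    by (rule finite_subset) (use assms fin in auto)
  obtain h :: "_ \<Rightarrow> nat" where h: "inj_on h (range (case_prod g))"
    using finite_imp_inj_to_nat_seg[OF fing] by blast
  have "finite (range (case_prod (\<lambda>D A. h (g D A))))"
    by (rule finite_subset[of _ "h ` range (case_prod g)"]) (use fing in auto)
  moreover have "mso_eqv V (Suc k) D A D' A'" if "h (g D A) = h (g D' A')" for D A D' A'
  proof -
    have "g D A \<in> range (case_prod g)" "g D' A' \<in> range (case_prod g)"
      by (metis case_prod_conv rangeI)+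
    then have "g D A = g D' A'" using h that by (meson inj_onD)
    then have "f D A = f D' A' \<and>
      {(v, f D (A(v := B))) | v B. v \<in> V \<and> B \<subseteq> D} = {(v, f D' (A'(v := B))) | v B. v \<in> V \<and> B \<subseteq> D'}"
      unfolding g_def by (simp only: prod.inject)
    note eq = this[THEN conjunct1] this[THEN conjunct2]
    have "\<exists>B'\<subseteq>D'. mso_eqv V k D (A(v := B)) D' (A'(v := B'))" if "v \<in> V" "B \<subseteq> D" for v B
    proof -
      have "(v, f D (A(v := B))) \<in> {(v, f D' (A'(v := B))) | v B. v \<in> V \<and> B \<subseteq> D'}"
        unfolding eq(2)[symmetric] using that by blast
      then obtain B' where "B' \<subseteq> D'" "f D (A(v := B)) = f D' (A'(v := B'))" by auto
      then show ?thesis using f by metis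
    qed
    moreover have "\<exists>B\<subseteq>D. mso_eqv V k D (A(v := B)) D' (A'(v := B'))" if "v \<in> V" "B' \<subseteq> D'" for v B'
    proof -
      have "(v, f D' (A'(v := B'))) \<in> {(v, f D (A(v := B))) | v B. v \<in> V \<and> B \<subseteq> D}"
        unfolding eq(2) using that by blast
      then obtain B where "B \<subseteq> D" "f D' (A'(v := B')) = f D (A(v := B))" by auto
      then show ?thesis using f by metis
    qed
    ultimately show ?thesis using f[OF eq(1)] by (intro mso_eqv_SucI)
  qed
  ultimately show ?case by (intro exI[of _ "\<lambda>D A. h (g D A)"] conjI allI impI)
qed

text \<open>An element variable \<open>x\<close> is coded as the singleton set variable \<open>2 * x\<close>, and a set variable
  \<open>X\<close> as \<open>2 * X + 1\<close>.\<close>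

primrec mso_vars :: "mso \<Rightarrow> nat set" where
  "mso_vars (Less x y) = {2 * x, 2 * y}"
| "mso_vars (Equal x y) = {2 * x, 2 * y}"
| "mso_vars (Mem x X) = {2 * x, 2 * X + 1}"
| "mso_vars (Neg \<phi>) = mso_vars \<phi>"
| "mso_vars (Conj \<phi> \<psi>) = mso_vars \<phi> \<union> mso_vars \<psi>"
| "mso_vars (Ex_elem x \<phi>) = insert (2 * x) (mso_vars \<phi>)"
| "mso_vars (Ex_set X \<phi>) = insert (2 * X + 1) (mso_vars \<phi>)"

primrec mso_rank :: "mso \<Rightarrow> nat" where
  "mso_rank (Less x y) = 0"
| "mso_rank (Equal x y) = 0"
| "mso_rank (Mem x X) = 0"
| "mso_rank (Neg \<phi>) = mso_rank \<phi>"
| "mso_rank (Conj \<phi> \<psi>) = max (mso_rank \<phi>) (mso_rank \<psi>)"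
| "mso_rank (Ex_elem x \<phi>) = Suc (mso_rank \<phi>)"
| "mso_rank (Ex_set X \<phi>) = Suc (mso_rank \<phi>)"

lemma finite_mso_vars: "finite (mso_vars \<phi>)"
  by (induction \<phi>) auto

lemma mso_eqv_mono: "mso_eqv V k D A D' A' \<Longrightarrow> l \<le> k \<Longrightarrow> mso_eqv V l D A D' A'"
  by (induction k) (auto simp: le_Suc_eq dest: mso_eqv_SucD(1))

text \<open>In a linear order singletons are described by atoms: nonempty, and without a pair x < y.
  Hence an element move, played as a set move, is answered by an element.\<close>

lemma mso_eqv_singleton:
  assumes "mso_eqv V k D A D' A'" "v \<in> V" "A v = {d}"
  shows "\<exists>d'. A' v = {d'}"
proof -
  have 0: "mso_eqv V 0 D A D' A'" using assms(1) mso_eqv_mono by blast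
  then have ne: "A' v \<noteq> {}" and nl: "\<not> (\<exists>x\<in>A' v. \<exists>y\<in>A' v. x < y)"
    using mso_eqv_0D[OF 0 assms(2) assms(2)] assms(3) by auto
  from ne obtain d' where "d' \<in> A' v" by blast
  moreover have "x = d'" if "x \<in> A' v" for x
    using nl \<open>d' \<in> A' v\<close> that by (meson linorder_neqE)
  ultimately show ?thesis by blast
qed

text \<open>Only the free variables of \<phi> have to be represented in \<open>A\<close> and
  \<open>A'\<close>. A sentence can therefore be started from the empty assignment, although the
  slots of the element variables are no singletons there.\<close>

lemma sat_mso_eqv:
  assumes "mso_eqv V k D A D' A'" "mso_vars \<phi> \<subseteq> V" "mso_rank \<phi> \<le> k"
    and "\<And>x. x \<in> free_elem \<phi> \<Longrightarrow> A (2 * x) = {e x} \<and> A' (2 * x) = {e' x}"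
    and "\<And>X. X \<in> free_set \<phi> \<Longrightarrow> A (2 * X + 1) = E X \<and> A' (2 * X + 1) = E' X"
  shows "sat D (<) e E \<phi> \<longleftrightarrow> sat D' (<) e' E' \<phi>"
  using assms
proof (induction \<phi> arbitrary: k A A' e e' E E')
  case (Less x y)
  have "mso_eqv V 0 D A D' A'" using Less.prems(1) mso_eqv_mono by blast
  from mso_eqv_0D[OF this, of "2 * x" "2 * y"] show ?case
    using Less.prems(2,4) by simp
next
  case (Equal x y)
  have "mso_eqv V 0 D A D' A'" using Equal.prems(1) mso_eqv_mono by blast
  from mso_eqv_0D[OF this, of "2 * x" "2 * y"] show ?case
    using Equal.prems(2,4) by simp
next
  case (Mem x X)
  have "mso_eqv V 0 D A D' A'" using Mem.prems(1) mso_eqv_mono by blast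
  from mso_eqv_0D[OF this, of "2 * x" "2 * X + 1"] show ?case
    using Mem.prems(2,4,5) by simp
next
  case (Neg \<phi>)
  have "sat D (<) e E \<phi> \<longleftrightarrow> sat D' (<) e' E' \<phi>"
    by (rule Neg.IH[OF Neg.prems(1)]) (use Neg.prems in auto)
  then show ?case by simp
next
  case (Conj \<phi> \<psi>)
  have "sat D (<) e E \<phi> \<longleftrightarrow> sat D' (<) e' E' \<phi>"
    by (rule Conj.IH(1)[OF Conj.prems(1)]) (use Conj.prems in auto)
  moreover have "sat D (<) e E \<psi> \<longleftrightarrow> sat D' (<) e' E' \<psi>"
    by (rule Conj.IH(2)[OF Conj.prems(1)]) (use Conj.prems in auto)
  ultimately show ?case by simp
next
  case (Ex_elem x \<phi>)
  then obtain l where k: "k = Suc l" "mso_rank \<phi> \<le> l" by (cases k) auto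
  have v: "2 * x \<in> V" using Ex_elem.prems(2) by auto
  have IH: "sat D (<) (e(x := d)) E \<phi> \<longleftrightarrow> sat D' (<) (e'(x := d')) E' \<phi>"
    if "mso_eqv V l D (A(2 * x := {d})) D' (A'(2 * x := {d'}))" for d d'
  proof (rule Ex_elem.IH[OF that _ k(2)])
    show "mso_vars \<phi> \<subseteq> V" using Ex_elem.prems(2) by auto
  next
    fix X assume "X \<in> free_set \<phi>"
    moreover have "2 * X + 1 \<noteq> 2 * x" by presburger
    ultimately show "(A(2 * x := {d})) (2 * X + 1) = E X \<and> (A'(2 * x := {d'})) (2 * X + 1) = E' X"
      using Ex_elem.prems(5) by auto
  qed (use Ex_elem.prems(4) in auto)
  show ?case
  proof
    assume "sat D (<) e E (Ex_elem x \<phi>)"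
    then obtain d where d: "d \<in> D" "sat D (<) (e(x := d)) E \<phi>" by auto
    then obtain B' where B': "B' \<subseteq> D'" "mso_eqv V l D (A(2 * x := {d})) D' (A'(2 * x := B'))"
      using mso_eqv_SucD(2)[OF Ex_elem.prems(1)[unfolded k(1)] v, of "{d}"] by auto
    obtain d' where "B' = {d'}"
      using mso_eqv_singleton[OF B'(2) v, of d] by auto
    then show "sat D' (<) e' E' (Ex_elem x \<phi>)" using IH B' d by auto
  next
    assume "sat D' (<) e' E' (Ex_elem x \<phi>)"
    then obtain d' where d': "d' \<in> D'" "sat D' (<) (e'(x := d')) E' \<phi>" by auto
    then obtain B where B: "B \<subseteq> D" "mso_eqv V l D (A(2 * x := B)) D' (A'(2 * x := {d'}))"
      using mso_eqv_SucD(3)[OF Ex_elem.prems(1)[unfolded k(1)] v, of "{d'}"] by auto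
    obtain d where "B = {d}"
      using mso_eqv_singleton[OF mso_eqv_sym[OF B(2)] v, of d'] by auto
    then show "sat D (<) e E (Ex_elem x \<phi>)" using IH B d' by auto
  qed
next
  case (Ex_set X \<phi>)
  then obtain l where k: "k = Suc l" "mso_rank \<phi> \<le> l" by (cases k) auto
  have v: "2 * X + 1 \<in> V" using Ex_set.prems(2) by auto
  have IH: "sat D (<) e (E(X := B)) \<phi> \<longleftrightarrow> sat D' (<) e' (E'(X := B')) \<phi>"
    if "mso_eqv V l D (A(2 * X + 1 := B)) D' (A'(2 * X + 1 := B'))" for B B'
  proof (rule Ex_set.IH[OF that _ k(2)])
    show "mso_vars \<phi> \<subseteq> V" using Ex_set.prems(2) by auto
  next
    fix x assume "x \<in> free_elem \<phi>"
    moreover have "2 * x \<noteq> 2 * X + 1" by presburger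
    ultimately show "(A(2 * X + 1 := B)) (2 * x) = {e x} \<and> (A'(2 * X + 1 := B')) (2 * x) = {e' x}"
      using Ex_set.prems(4) by auto
  qed (use Ex_set.prems(5) in auto)
  show ?case
  proof
    assume "sat D (<) e E (Ex_set X \<phi>)"
    then obtain B where B: "B \<subseteq> D" "sat D (<) e (E(X := B)) \<phi>" by auto
    then obtain B' where B': "B' \<subseteq> D'" "mso_eqv V l D (A(2 * X + 1 := B)) D' (A'(2 * X + 1 := B'))"
      using mso_eqv_SucD(2)[OF Ex_set.prems(1)[unfolded k(1)] v B(1)] by metis
    then show "sat D' (<) e' E' (Ex_set X \<phi>)" using IH B by auto
  next
    assume "sat D' (<) e' E' (Ex_set X \<phi>)"
    then obtain B' where B': "B' \<subseteq> D'" "sat D' (<) e' (E'(X := B')) \<phi>" by auto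
    then obtain B where B: "B \<subseteq> D" "mso_eqv V l D (A(2 * X + 1 := B)) D' (A'(2 * X + 1 := B'))"
      using mso_eqv_SucD(3)[OF Ex_set.prems(1)[unfolded k(1)] v B'(1)] by metis
    then show "sat D (<) e E (Ex_set X \<phi>)" using IH B' by auto
  qed
qed

section \<open>Types of ordinals, of their sums and of powers of \<omega>\<close>

definition otype_eq :: "nat set \<Rightarrow> nat \<Rightarrow> ordinal \<Rightarrow> ordinal \<Rightarrow> bool" where
  "otype_eq V k \<alpha> \<beta> \<longleftrightarrow> mso_eqv V k {..<\<alpha>} (\<lambda>_. {}) {..<\<beta>} (\<lambda>_. {})"

lemma otype_eq_sym: "otype_eq V k \<alpha> \<beta> \<Longrightarrow> otype_eq V k \<beta> \<alpha>"
  unfolding otype_eq_def by (rule mso_eqv_sym)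

lemma otype_eq_trans [trans]: "otype_eq V k \<alpha> \<beta> \<Longrightarrow> otype_eq V k \<beta> \<gamma> \<Longrightarrow> otype_eq V k \<alpha> \<gamma>"
  unfolding otype_eq_def by (rule mso_eqv_trans)

lemma otype_eq_refl [simp]: "otype_eq V k \<alpha> \<alpha>"
  unfolding otype_eq_def by (rule mso_eqv_refl)

lemma otype_eq_models:
  assumes "sentence \<phi>" "otype_eq (mso_vars \<phi>) (mso_rank \<phi>) \<alpha> \<beta>"
  shows "\<alpha> \<Turnstile> \<phi> \<longleftrightarrow> \<beta> \<Turnstile> \<phi>"
  unfolding models_def
  by (rule sat_mso_eqv[OF assms(2)[unfolded otype_eq_def]]) (use assms(1) in \<open>auto simp: sentence_def\<close>)

primrec psum :: "(nat \<Rightarrow> ordinal) \<Rightarrow> nat \<Rightarrow> ordinal" where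
  "psum x 0 = 0"
| "psum x (Suc n) = psum x n + x n"

definition omega_sum :: "(nat \<Rightarrow> ordinal) \<Rightarrow> ordinal" where
  "omega_sum x = osup (range (psum x))"

lemma psum_le_omega_sum: "psum x n \<le> omega_sum x"
  unfolding omega_sum_def by (rule osup_upper) auto

lemma psum_mono: "m \<le> n \<Longrightarrow> psum x m \<le> psum x n"
  by (induction n) (auto simp: le_Suc_eq intro: order_trans[OF _ le_add1_ordinal])

lemma lessThan_omega_sum: "{..<omega_sum x} = (\<Union>n. {psum x n..<psum x (Suc n)})"
proof
  show "{..<omega_sum x} \<subseteq> (\<Union>n. {psum x n..<psum x (Suc n)})"
  proof
    fix y assume "y \<in> {..<omega_sum x}"
    then obtain n where "y < psum x n"
      unfolding omega_sum_def by (auto elim: less_osupE)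
    then show "y \<in> (\<Union>n. {psum x n..<psum x (Suc n)})"
    proof (induction n)
      case (Suc n)
      then show ?case by (cases "y < psum x n") (auto simp: not_less simp del: psum.simps)
    qed simp
  qed
  show "(\<Union>n. {psum x n..<psum x (Suc n)}) \<subseteq> {..<omega_sum x}"
    using psum_le_omega_sum[of x "Suc n" for n]
    by (auto simp del: psum.simps intro: order_less_le_trans)
qed

lemma image_add_lessThan_ordinal: "(+) \<alpha> ` {..<\<beta>} = {\<alpha>..<\<alpha> + (\<beta> :: ordinal)}"
proof
  show "{\<alpha>..<\<alpha> + \<beta>} \<subseteq> (+) \<alpha> ` {..<\<beta>}"
  proof
    fix x assume "x \<in> {\<alpha>..<\<alpha> + \<beta>}"
    then obtain \<gamma> where "x = \<alpha> + \<gamma>" using le_imp_add_ordinal[of \<alpha> x] by auto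
    then show "x \<in> (+) \<alpha> ` {..<\<beta>}" using \<open>x \<in> {\<alpha>..<\<alpha> + \<beta>}\<close> by auto
  qed
qed (auto simp: le_add1_ordinal)

lemma mso_eqv_translate:
  "mso_eqv V k {..<\<beta>} (\<lambda>_. {}) {\<alpha>..<\<alpha> + \<beta>} (\<lambda>_. {})"
  using mso_eqv_image[of "{..<\<beta>}" "(+) \<alpha>" "\<lambda>_. {}" V k]
  by (simp add: image_add_lessThan_ordinal strict_mono_on_def)

text \<open>The intervals between consecutive partial sums are translates of the summands, so the
  composition theorem applies blockwise.\<close>

lemma otype_eq_omega_sum:
  assumes "\<And>i. otype_eq V k (x i) (y i)"
  shows "otype_eq V k (omega_sum x) (omega_sum y)"
  unfolding otype_eq_def lessThan_omega_sum
proof (rule mso_eqv_sum)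
  have less: "u < v" if "i < j" "u \<in> {psum z i..<psum z (Suc i)}" "v \<in> {psum z j..<psum z (Suc j)}"
    for z i j u v
  proof -
    have "u < psum z (Suc i)" using that by simp
    also have "\<dots> \<le> psum z j" using that by (intro psum_mono) simp
    also have "\<dots> \<le> v" using that by simp
    finally show ?thesis .
  qed
  show "u < v" if "i < j" "u \<in> {psum x i..<psum x (Suc i)}" "v \<in> {psum x j..<psum x (Suc j)}"
    for i j u v using less that .
  show "u < v" if "i < j" "u \<in> {psum y i..<psum y (Suc i)}" "v \<in> {psum y j..<psum y (Suc j)}"
    for i j u v using less that .
  show "mso_eqv V k {psum x i..<psum x (Suc i)} (\<lambda>v. {} \<inter> {psum x i..<psum x (Suc i)})
     {psum y i..<psum y (Suc i)} (\<lambda>v. {} \<inter> {psum y i..<psum y (Suc i)})" for i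
    using mso_eqv_trans[OF mso_eqv_trans[OF mso_eqv_sym[OF mso_eqv_translate[of V k "x i" "psum x i"]]
        assms[of i, unfolded otype_eq_def]] mso_eqv_translate[of V k "y i" "psum y i"]]
    by simp
qed auto

text \<open>Padding with zeros makes a binary sum an \<omega>-sum. Thus the congruence rules for
  addition and for multiplication by \<omega> both come from the one composition theorem.\<close>

lemma add_eq_omega_sum:
  "\<alpha> + \<beta> = omega_sum (\<lambda>n. if n = 0 then \<alpha> else if n = 1 then \<beta> else 0)"
  (is "_ = omega_sum ?x")
proof -
  have 2: "psum ?x (Suc (Suc n)) = \<alpha> + \<beta>" for n
    by (induction n) auto
  have "psum ?x n \<le> \<alpha> + \<beta>" for n
    using psum_mono[of n "Suc (Suc n)" ?x] 2[of n] by (simp del: psum.simps)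
  then have "omega_sum ?x \<le> \<alpha> + \<beta>"
    unfolding omega_sum_def by (intro osup_least) auto
  moreover have "\<alpha> + \<beta> \<le> omega_sum ?x"
    using psum_le_omega_sum[of ?x "Suc (Suc 0)"] 2[of 0] by (simp del: psum.simps)
  ultimately show ?thesis by simp
qed

lemma otype_eq_add:
  assumes "otype_eq V k \<alpha> \<alpha>'" "otype_eq V k \<beta> \<beta>'"
  shows "otype_eq V k (\<alpha> + \<beta>) (\<alpha>' + \<beta>')"
  unfolding add_eq_omega_sum by (rule otype_eq_omega_sum) (use assms in auto)

abbreviation ofin :: "nat \<Rightarrow> ordinal" where
  "ofin n \<equiv> (osuc ^^ n) 0"

lemma psum_const: "psum (\<lambda>_. \<alpha>) n = \<alpha> * ofin n"
  by (induction n) (simp_all add: mult_osuc)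

lemma omega_sum_const: "omega_sum (\<lambda>_. \<alpha>) = \<alpha> * \<omega>"
proof -
  have "{..<\<omega>} = range ofin"
    using funpow_osuc_less_omega by (auto elim: less_omegaE)
  then show ?thesis
    by (simp add: omega_sum_def psum_const mult_limit[OF olimit_omega] image_image)
qed

lemma otype_eq_mult_omega: "otype_eq V k \<alpha> \<beta> \<Longrightarrow> otype_eq V k (\<alpha> * \<omega>) (\<beta> * \<omega>)"
  by (metis omega_sum_const otype_eq_omega_sum)

definition cnf_sum :: "ordinal list \<Rightarrow> ordinal" where
  "cnf_sum as = foldr (+) (map omega_pow as) 0"

lemma cnf_sum_simps [simp]: "cnf_sum [] = 0" "cnf_sum (a # as) = omega_pow a + cnf_sum as"
  by (simp_all add: cnf_sum_def)

lemma cnf_sum_append: "cnf_sum (as @ bs) = cnf_sum as + cnf_sum bs"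
  by (induction as) (simp_all add: add_assoc_ordinal)

lemma cnf_sum_cnf [simp]: "cnf_sum (cnf \<alpha>) = \<alpha>"
  using is_cnf_cnf[of \<alpha>] by (simp add: is_cnf_def cnf_sum_def)

lemma sorted_cnf: "sorted_wrt (\<ge>) (cnf \<alpha>)"
  using is_cnf_cnf[of \<alpha>] by (simp add: is_cnf_def)

lemma cnf_cnf_sum: "sorted_wrt (\<ge>) as \<Longrightarrow> cnf (cnf_sum as) = as"
  by (rule cnf_eqI) (simp add: is_cnf_def cnf_sum_def)

lemma omega_pow_le_cnf_sum: "a \<in> set as \<Longrightarrow> omega_pow a \<le> cnf_sum as"
  by (induction as) (auto intro: le_add1_ordinal order_trans[OF _ le_add2_ordinal])

lemma cnf_sum_less_omega_pow_iff: "cnf_sum as < omega_pow \<gamma> \<longleftrightarrow> (\<forall>a\<in>set as. a < \<gamma>)"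
proof
  assume "cnf_sum as < omega_pow \<gamma>"
  then show "\<forall>a\<in>set as. a < \<gamma>"
    using omega_pow_le_cnf_sum by (metis omega_pow_less_iff order_le_less_trans)
next
  assume lt: "\<forall>a\<in>set as. a < \<gamma>"
  show "cnf_sum as < omega_pow \<gamma>"
  proof (cases "as = []")
    case True
    then show ?thesis by (simp add: omega_pow_pos)
  next
    case False
    define c where "c = Max (set as)"
    have "c \<in> set as" using False by (simp add: c_def)
    have "cnf_sum as < omega_pow (osuc c)"
      unfolding cnf_sum_def by (rule foldr_omega_pow_bound) (simp add: c_def)
    also have "\<dots> \<le> omega_pow \<gamma>"
      using lt \<open>c \<in> set as\<close> by (simp add: omega_pow_le_iff osuc_le_iff)
    finally show ?thesis .
  qed
qed

lemma less_omega_pow_iff_cnf: "\<alpha> < omega_pow \<gamma> \<longleftrightarrow> (\<forall>a\<in>set (cnf \<alpha>). a < \<gamma>)"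
  using cnf_sum_less_omega_pow_iff[of "cnf \<alpha>" \<gamma>] by simp

lemma add_less_omega_pow:
  assumes "\<alpha> < omega_pow \<gamma>" "\<beta> < omega_pow \<gamma>"
  shows "\<alpha> + \<beta> < omega_pow \<gamma>"
  using assms cnf_sum_less_omega_pow_iff[of "cnf \<alpha> @ cnf \<beta>" \<gamma>]
  by (auto simp: less_omega_pow_iff_cnf[of \<alpha>] less_omega_pow_iff_cnf[of \<beta>] cnf_sum_append)

text \<open>Since ordinals below \<omega>^\<gamma> are closed under addition, the remainder of
  \<omega>^\<gamma> after \<alpha> cannot be smaller than \<omega>^\<gamma>.\<close>

lemma add_omega_pow_absorb:
  assumes "\<alpha> < omega_pow \<gamma>"
  shows "\<alpha> + omega_pow \<gamma> = omega_pow \<gamma>"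
proof (rule antisym)
  obtain \<delta> where \<delta>: "omega_pow \<gamma> = \<alpha> + \<delta>"
    by (rule le_imp_add_ordinal[OF less_imp_le[OF assms]])
  have "\<not> \<delta> < omega_pow \<gamma>"
    using add_less_omega_pow[OF assms, of \<delta>] \<delta> by auto
  then show "\<alpha> + omega_pow \<gamma> \<le> omega_pow \<gamma>"
    by (metis \<delta> add_le_iff_ordinal not_less)
qed (rule le_add2_ordinal)

lemma psum_less_omega_pow: "(\<And>i. x i < omega_pow \<gamma>) \<Longrightarrow> psum x n < omega_pow \<gamma>"
  by (induction n) (auto simp: omega_pow_pos add_less_omega_pow)

lemma omega_sum_eq_omega_pow:
  assumes "\<And>i. x i < omega_pow \<gamma>" "\<And>\<delta>. \<delta> < omega_pow \<gamma> \<Longrightarrow> \<exists>n. \<delta> < psum x n"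
  shows "omega_sum x = omega_pow \<gamma>"
proof (rule antisym)
  show "omega_sum x \<le> omega_pow \<gamma>"
    unfolding omega_sum_def
    by (rule osup_least) (use psum_less_omega_pow[of x, OF assms(1)] in \<open>auto intro: less_imp_le\<close>)
  show "omega_pow \<gamma> \<le> omega_sum x"
    using assms(2)[of "omega_sum x"] psum_le_omega_sum[of x] by (meson not_le)
qed

text \<open>The partial sums dominate those of the constant sequence \<omega>^b and still stay below
  \<omega>^(b+1), so the smaller terms vanish in the limit.\<close>

lemma add_mult_omega:
  assumes "a \<le> b"
  shows "(omega_pow b + omega_pow a) * \<omega> = omega_pow (osuc b)"
  unfolding omega_sum_const[symmetric]
proof (rule omega_sum_eq_omega_pow)
  let ?y = "omega_pow b + omega_pow a"
  show "?y < omega_pow (osuc b)"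
    by (rule add_less_omega_pow) (use assms in \<open>simp_all add: omega_pow_less_iff less_osuc_iff\<close>)
  fix \<delta> assume "\<delta> < omega_pow (osuc b)"
  then obtain n where n: "\<delta> < omega_pow b * ofin n"
    by (auto simp: omega_pow_osuc mult_limit[OF olimit_omega] elim!: less_osupE less_omegaE)
  have "psum (\<lambda>_. omega_pow b) n \<le> psum (\<lambda>_. ?y) n" for n
  proof (induction n)
    case (Suc n)
    have "psum (\<lambda>_. omega_pow b) n + omega_pow b \<le> psum (\<lambda>_. ?y) n + omega_pow b"
      using Suc by (rule add_mono_left_ordinal)
    also have "\<dots> \<le> psum (\<lambda>_. ?y) n + ?y" by (simp add: le_add1_ordinal)
    finally show ?case by simp
  qed simp
  then show "\<exists>n. \<delta> < psum (\<lambda>_. ?y) n"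
    using n by (metis psum_const order_less_le_trans)
qed

lemma otype_eq_pigeonhole:
  fixes x :: "nat \<Rightarrow> ordinal"
  assumes "finite V"
  obtains i j where "i < j" "otype_eq V k (x i) (x j)"
proof -
  obtain f :: "ordinal set \<Rightarrow> (nat \<Rightarrow> ordinal set) \<Rightarrow> nat"
    where fin: "finite (range (case_prod f))"
      and f: "\<And>D A D' A'. f D A = f D' A' \<Longrightarrow> mso_eqv V k D A D' A'"
    using mso_eqv_finite_index[OF assms] by blast
  define g where "g i = f {..<x i} (\<lambda>_. {})" for i
  have "range g \<subseteq> range (case_prod f)"
    unfolding g_def by (auto simp: image_iff)
  then have "finite (range g)" using fin finite_subset by blast
  then have "\<not> inj g" using finite_imageD by blast
  then obtain i j where "i \<noteq> j" "g i = g j" by (auto simp: inj_def)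
  then show thesis
    using f[of "{..<x i}" _ "{..<x j}"] f[of "{..<x j}" _ "{..<x i}"] that
    unfolding g_def otype_eq_def by (metis linorder_neqE_nat)
qed

lemma ofin_less_iff: "ofin i < ofin j \<longleftrightarrow> i < j"
proof -
  have "ofin i < ofin j" if "i < j" for i j
    using that by (induction j) (auto simp: less_Suc_eq intro: order_less_trans)
  then show ?thesis by (metis linorder_neqE_nat order_less_asym)
qed

text \<open>If \<open>\<omega>\<^bsup>i\<^esup>\<close> and \<open>\<omega>\<^bsup>j\<^esup>\<close> have the same type for some \<open>i + 1 < j\<close>, then so do \<open>\<omega>\<^bsup>i+1\<^esup> + \<omega>\<^bsup>i\<^esup>\<close> and
  \<open>\<omega>\<^bsup>i+1\<^esup> + \<omega>\<^bsup>j\<^esup> = \<omega>\<^bsup>j\<^esup>\<close>, hence \<open>\<omega>\<^bsup>i\<^esup>\<close>. Multiplying by \<open>\<omega>\<close> gives the type of \<open>\<omega>\<^bsup>i+2\<^esup>\<close> on one side and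
  that of \<open>\<omega>\<^bsup>i+1\<^esup>\<close> on the other.\<close>

lemma otype_eq_omega_pow_stable:
  assumes "finite V"
  obtains m where "otype_eq V k (omega_pow (ofin (Suc m))) (omega_pow (ofin m))"
proof -
  obtain i j where ij: "i < j" "otype_eq V k (omega_pow (ofin i)) (omega_pow (ofin j))"
    by (rule otype_eq_pigeonhole[OF assms, of k "\<lambda>i. omega_pow (ofin i)"])
  show thesis
  proof (cases "j = Suc i")
    case True
    then show ?thesis using ij that[of i] otype_eq_sym by blast
  next
    case False
    then have lt: "omega_pow (ofin (Suc i)) < omega_pow (ofin j)"
      using ij(1) unfolding omega_pow_less_iff ofin_less_iff by simp
    have "otype_eq V k (omega_pow (ofin (Suc i)) + omega_pow (ofin i))
        (omega_pow (ofin (Suc i)) + omega_pow (ofin j))"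
      by (intro otype_eq_add ij) simp
    also have "omega_pow (ofin (Suc i)) + omega_pow (ofin j) = omega_pow (ofin j)"
      by (rule add_omega_pow_absorb[OF lt])
    also have "otype_eq V k \<dots> (omega_pow (ofin i))"
      using ij(2) by (rule otype_eq_sym)
    finally have "otype_eq V k ((omega_pow (ofin (Suc i)) + omega_pow (ofin i)) * \<omega>) (omega_pow (ofin i) * \<omega>)"
      by (rule otype_eq_mult_omega)
    moreover have "(omega_pow (ofin (Suc i)) + omega_pow (ofin i)) * \<omega> = omega_pow (ofin (Suc (Suc i)))"
      using add_mult_omega[of "ofin i" "ofin (Suc i)"] by (simp add: less_imp_le)
    moreover have "omega_pow (ofin i) * \<omega> = omega_pow (ofin (Suc i))"
      by (simp add: omega_pow_osuc)
    ultimately have "otype_eq V k (omega_pow (ofin (Suc (Suc i)))) (omega_pow (ofin (Suc i)))"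
      by (simp only:)
    then show ?thesis by (rule that)
  qed
qed

text \<open>\<open>g\<close> enumerates all of \<open>{m..<\<gamma>}\<close> in no particular order.
  Every exponent occurs at some place, which makes the partial sums cofinal, and closure under
  addition keeps them below \<omega>^\<gamma>.\<close>

lemma omega_pow_limit_omega_sum:
  assumes "olimit \<gamma>" "m < \<gamma>"
  obtains g where "\<And>n. m \<le> g n" "\<And>n. g n < \<gamma>" "omega_pow \<gamma> = omega_sum (\<lambda>n. omega_pow (g n))"
proof -
  define g where "g = from_nat_into {m..<\<gamma>}"
  have "countable {m..<\<gamma>}"
    by (rule countable_subset[OF _ countable_lessThan_ordinal[of \<gamma>]]) auto
  moreover have "{m..<\<gamma>} \<noteq> {}" using assms by auto
  ultimately have g: "range g = {m..<\<gamma>}"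
    unfolding g_def by (simp add: range_from_nat_into)
  have "omega_sum (\<lambda>n. omega_pow (g n)) = omega_pow \<gamma>"
  proof (rule omega_sum_eq_omega_pow)
    show "omega_pow (g n) < omega_pow \<gamma>" for n
      using g by (auto simp: omega_pow_less_iff)
    fix \<delta> assume "\<delta> < omega_pow \<gamma>"
    then obtain \<eta> where \<eta>: "\<eta> < \<gamma>" "\<delta> < omega_pow \<eta>"
      by (auto simp: omega_pow_limit[OF assms(1)] elim: less_osupE)
    then have "max m \<eta> \<in> range g" unfolding g using assms by auto
    then obtain n where n: "g n = max m \<eta>" by auto
    have "\<delta> < omega_pow (max m \<eta>)"
      using \<eta>(2) by (rule order_less_le_trans) (simp add: omega_pow_le_iff)
    also have "\<dots> \<le> psum (\<lambda>n. omega_pow (g n)) (Suc n)"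
      by (simp add: n le_add2_ordinal)
    finally show "\<exists>n. \<delta> < psum (\<lambda>n. omega_pow (g n)) n" by blast
  qed
  moreover have "m \<le> g n" "g n < \<gamma>" for n using g by auto
  ultimately show thesis using that[of g] by simp
qed

text \<open>A successor step multiplies the type by \<omega>, and a limit step sums \<omega> many
  terms of the type of \<omega>^m. Both produce the type of \<omega>^(m+1), which is that of
  \<omega>^m by the choice of \<open>m\<close>.\<close>

lemma otype_eq_omega_pow_above:
  assumes m: "otype_eq V k (omega_pow (ofin (Suc m))) (omega_pow (ofin m))" and "ofin m \<le> \<gamma>"
  shows "otype_eq V k (omega_pow \<gamma>) (omega_pow (ofin m))"
  using assms(2)
proof (induction \<gamma> rule: less_induct)
  case (less \<gamma>)
  show ?case
  proof (cases "\<gamma> = ofin m")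
    case False
    then have gt: "ofin m < \<gamma>" using less.prems by simp
    show ?thesis
    proof (cases \<gamma> rule: ordinal_cases)
      case zero
      then show ?thesis using gt by simp
    next
      case (suc \<delta>)
      then have "otype_eq V k (omega_pow \<delta>) (omega_pow (ofin m))"
        using gt by (intro less.IH) (auto simp: less_osuc_iff)
      then have "otype_eq V k (omega_pow \<gamma>) (omega_pow (ofin (Suc m)))"
        unfolding suc omega_pow_osuc by (simp add: otype_eq_mult_omega omega_pow_osuc)
      then show ?thesis using m otype_eq_trans by blast
    next
      case limit
      then obtain g where g: "\<And>n. ofin m \<le> g n" "\<And>n. g n < \<gamma>"
        "omega_pow \<gamma> = omega_sum (\<lambda>n. omega_pow (g n))"
        using omega_pow_limit_omega_sum gt by metis
      have "otype_eq V k (omega_pow \<gamma>) (omega_sum (\<lambda>_. omega_pow (ofin m)))"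
        unfolding g(3) by (intro otype_eq_omega_sum less.IH g)
      also have "\<dots> = omega_pow (ofin (Suc m))"
        by (simp add: omega_sum_const omega_pow_osuc)
      finally show ?thesis using m otype_eq_trans by blast
    qed
  qed simp
qed

text \<open>The type of \<omega>^m is idempotent: the right summand of \<omega>^m + \<omega>^m may
  be replaced by \<omega>^(m+1), which absorbs the left one. So all exponents from \<open>m\<close>
  on together contribute one and the same type.\<close>

lemma otype_eq_cnf_sum_above:
  assumes m: "otype_eq V k (omega_pow (ofin (Suc m))) (omega_pow (ofin m))"
    and "as \<noteq> []" "\<And>a. a \<in> set as \<Longrightarrow> ofin m \<le> a"
  shows "otype_eq V k (cnf_sum as) (omega_pow (ofin m))"
  using assms(2,3)
proof (induction as rule: list_nonempty_induct)
  case (single a)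
  then show ?case using otype_eq_omega_pow_above[OF m] by simp
next
  case (cons a as)
  have "otype_eq V k (cnf_sum (a # as)) (omega_pow (ofin m) + omega_pow (ofin m))"
    using cons otype_eq_omega_pow_above[OF m, of a] by (auto intro!: otype_eq_add)
  also have "otype_eq V k \<dots> (omega_pow (ofin m) + omega_pow (ofin (Suc m)))"
    by (intro otype_eq_add otype_eq_sym[OF m]) simp
  also have "omega_pow (ofin m) + omega_pow (ofin (Suc m)) = omega_pow (ofin (Suc m))"
    by (rule add_omega_pow_absorb) (simp add: omega_pow_less_iff)
  also note m
  finally show ?case .
qed

lemma mult_ofin_add: "\<alpha> * ofin (i + j) = \<alpha> * ofin i + \<alpha> * ofin j"
  by (induction j) (simp_all add: mult_osuc add_assoc_ordinal)

text \<open>Powers in a finite monoid: one coincidence at i < j is propagated by adding further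
  copies, which gives the threshold \<open>i\<close> and the period \<open>j - i\<close>.\<close>

lemma otype_eq_mult_periodic:
  assumes "finite V"
  obtains t P where "P \<ge> 1"
    "\<And>a b. t \<le> a \<Longrightarrow> t \<le> b \<Longrightarrow> a mod P = b mod P \<Longrightarrow> otype_eq V k (\<alpha> * ofin a) (\<alpha> * ofin b)"
proof -
  obtain i j where ij: "i < j" "otype_eq V k (\<alpha> * ofin i) (\<alpha> * ofin j)"
    by (rule otype_eq_pigeonhole[OF assms, of k "\<lambda>i. \<alpha> * ofin i"])
  define P where "P = j - i"
  have 1: "otype_eq V k (\<alpha> * ofin a) (\<alpha> * ofin (a + P))" if "i \<le> a" for a
    using otype_eq_add[OF ij(2) otype_eq_refl[of V k "\<alpha> * ofin (a - i)"]] that ij(1)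
    by (simp add: mult_ofin_add[symmetric] P_def add.commute)
  have 2: "otype_eq V k (\<alpha> * ofin a) (\<alpha> * ofin (a + l * P))" if "i \<le> a" for a l
  proof (induction l)
    case (Suc l)
    also have "otype_eq V k (\<alpha> * ofin (a + l * P)) (\<alpha> * ofin (a + l * P + P))"
      using that by (intro 1) simp
    finally show ?case by (simp add: ac_simps)
  qed simp
  have 3: "otype_eq V k (\<alpha> * ofin a) (\<alpha> * ofin b)" if "i \<le> a" "a \<le> b" "a mod P = b mod P" for a b
  proof -
    have "P dvd b - a"
      using that(2,3) mod_eq_dvd_iff_nat[of a b P] by simp
    then obtain l where "b - a = P * l" by (rule dvdE)
    then have "b = a + l * P" using that(2) by (simp add: mult.commute)
    then show ?thesis using 2 that by simp
  qed
  show thesis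
  proof (rule that[of P i])
    show "P \<ge> 1" using ij(1) by (simp add: P_def)
    fix a b assume ab: "i \<le> a" "i \<le> b" "a mod P = b mod P"
    show "otype_eq V k (\<alpha> * ofin a) (\<alpha> * ofin b)"
    proof (cases "a \<le> b")
      case True
      show ?thesis by (rule 3[OF ab(1) True ab(3)])
    next
      case False
      then have "b \<le> a" by simp
      show ?thesis by (rule otype_eq_sym[OF 3[OF ab(2) \<open>b \<le> a\<close> ab(3)[symmetric]]])
    qed
  qed
qed

text \<open>The maximum of the thresholds and the product of the periods serve for all
  \<open>m\<close> multiplicands at once.\<close>

lemma otype_eq_mult_periodic_uniform:
  fixes m :: nat and x :: "nat \<Rightarrow> ordinal"
  assumes "finite V"
  shows "\<exists>t P. P \<ge> 1 \<and> (\<forall>i<m. \<forall>a b. t \<le> a \<longrightarrow> t \<le> b \<longrightarrow> a mod P = b mod P \<longrightarrow>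
    otype_eq V k (x i * ofin a) (x i * ofin b))"
proof (induction m)
  case 0
  then show ?case by auto
next
  case (Suc m)
  then obtain t P where tP: "P \<ge> 1" "\<And>i a b. i < m \<Longrightarrow> t \<le> a \<Longrightarrow> t \<le> b \<Longrightarrow> a mod P = b mod P \<Longrightarrow>
    otype_eq V k (x i * ofin a) (x i * ofin b)" by metis
  obtain u Q where uQ: "Q \<ge> 1" "\<And>a b. u \<le> a \<Longrightarrow> u \<le> b \<Longrightarrow> a mod Q = b mod Q \<Longrightarrow>
    otype_eq V k (x m * ofin a) (x m * ofin b)"
    by (rule otype_eq_mult_periodic[OF assms, of k "x m"]) blast
  have mods: "a mod P = b mod P" "a mod Q = b mod Q" if "a mod (P * Q) = b mod (P * Q)" for a b :: nat
    using that by (metis mod_mod_cancel dvd_triv_left dvd_triv_right)+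
  have "otype_eq V k (x i * ofin a) (x i * ofin b)"
    if "i < Suc m" "max t u \<le> a" "max t u \<le> b" "a mod (P * Q) = b mod (P * Q)" for i a b
    using that tP(2)[of i a b] uQ(2)[of a b] mods[of a b] by (cases "i = m") auto
  moreover have "P * Q \<ge> 1" using tP(1) uQ(1) by (metis mult_le_mono nat_mult_1)
  ultimately show ?case by blast
qed

lemma cnf_sum_replicate: "cnf_sum (replicate n a) = omega_pow a * ofin n"
proof (induction n)
  case (Suc n)
  have "replicate (Suc n) a = replicate n a @ [a]" by (simp add: replicate_append_same)
  then show ?case using Suc by (simp only: cnf_sum_append) (simp add: mult_osuc)
qed simp

lemma filter_ge_sorted:
  fixes c :: "'a :: linorder"
  assumes "sorted_wrt (\<ge>) as"
  shows "filter (\<lambda>a. c \<le> a) as = filter (\<lambda>a. c < a) as @ replicate (count (mset as) c) c"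
  using assms
proof (induction as)
  case (Cons a as)
  have "filter (\<lambda>b. c < b) as = []" if "a = c"
    using Cons.prems that by (auto simp: filter_empty_conv)
  moreover have "count (mset as) c = 0 \<and> filter (\<lambda>b. c < b) as = []" if "a < c"
    using Cons.prems that by (auto simp: filter_empty_conv count_eq_zero_iff)
  ultimately show ?case using Cons by (cases a c rule: linorder_cases) auto
qed simp

text \<open>The normal form is rebuilt from the top: the terms with exponents from \<open>m\<close>
  on have the type of \<omega>^m, and then the blocks \<omega>^i times their coefficient are
  appended on the right for i = m - 1, ..., 0. Of the two alternatives for a coefficient, equality
  is the one used at \<open>\<epsilon>\<^sub>0\<close>, threshold and period the one used
  below.\<close>

lemma models_digits:
  assumes "sentence \<phi>"
  shows "\<exists>m t P. P \<ge> 1 \<and>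
    (\<forall>\<alpha> \<beta>. (\<exists>a\<in>set (cnf \<alpha>). ofin m \<le> a) \<longrightarrow> (\<exists>a\<in>set (cnf \<beta>). ofin m \<le> a) \<longrightarrow>
      (\<forall>i<m. count (mset (cnf \<alpha>)) (ofin i) = count (mset (cnf \<beta>)) (ofin i) \<or>
        t \<le> count (mset (cnf \<alpha>)) (ofin i) \<and> t \<le> count (mset (cnf \<beta>)) (ofin i) \<and>
        count (mset (cnf \<alpha>)) (ofin i) mod P = count (mset (cnf \<beta>)) (ofin i) mod P) \<longrightarrow>
      (\<alpha> \<Turnstile> \<phi> \<longleftrightarrow> \<beta> \<Turnstile> \<phi>))"
proof -
  let ?V = "mso_vars \<phi>" and ?k = "mso_rank \<phi>"
  obtain m where m: "otype_eq ?V ?k (omega_pow (ofin (Suc m))) (omega_pow (ofin m))"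
    by (rule otype_eq_omega_pow_stable[OF finite_mso_vars])
  obtain t P where tP: "P \<ge> 1" "\<And>i a b. i < m \<Longrightarrow> t \<le> a \<Longrightarrow> t \<le> b \<Longrightarrow> a mod P = b mod P \<Longrightarrow>
    otype_eq ?V ?k (omega_pow (ofin i) * ofin a) (omega_pow (ofin i) * ofin b)"
    using otype_eq_mult_periodic_uniform[OF finite_mso_vars, where m = m and k = ?k and x = "\<lambda>i. omega_pow (ofin i)"] by metis
  define up where "up i \<alpha> = cnf_sum (filter (\<lambda>a. ofin i \<le> a) (cnf \<alpha>))" for i \<alpha>
  have up_Suc: "up i \<alpha> = up (Suc i) \<alpha> + omega_pow (ofin i) * ofin (count (mset (cnf \<alpha>)) (ofin i))" for i \<alpha>
  proof -
    have "(\<lambda>a. ofin (Suc i) \<le> a) = (\<lambda>a. ofin i < a)"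
      by (simp add: osuc_le_iff fun_eq_iff)
    then show ?thesis
      unfolding up_def filter_ge_sorted[OF sorted_cnf[of \<alpha>], of "ofin i"]
      by (simp only: cnf_sum_append cnf_sum_replicate)
  qed
  have up_0: "up 0 \<alpha> = \<alpha>" for \<alpha> by (simp add: up_def)
  have up_m: "otype_eq ?V ?k (up m \<alpha>) (omega_pow (ofin m))" if "\<exists>a\<in>set (cnf \<alpha>). ofin m \<le> a" for \<alpha>
    unfolding up_def using that
    by (intro otype_eq_cnf_sum_above[OF m]) (auto simp: filter_empty_conv)
  have main: "\<alpha> \<Turnstile> \<phi> \<longleftrightarrow> \<beta> \<Turnstile> \<phi>"
    if \<alpha>: "\<exists>a\<in>set (cnf \<alpha>). ofin m \<le> a" and \<beta>: "\<exists>a\<in>set (cnf \<beta>). ofin m \<le> a"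
      and dig: "\<And>i. i < m \<Longrightarrow>
        count (mset (cnf \<alpha>)) (ofin i) = count (mset (cnf \<beta>)) (ofin i) \<or>
        t \<le> count (mset (cnf \<alpha>)) (ofin i) \<and> t \<le> count (mset (cnf \<beta>)) (ofin i) \<and>
        count (mset (cnf \<alpha>)) (ofin i) mod P = count (mset (cnf \<beta>)) (ofin i) mod P" for \<alpha> \<beta>
  proof -
    have "otype_eq ?V ?k (up i \<alpha>) (up i \<beta>)" if "i \<le> m" for i
      using that
    proof (induction rule: inc_induct)
      case base
      then show ?case using up_m[OF \<alpha>] otype_eq_sym[OF up_m[OF \<beta>]] by (rule otype_eq_trans)
    next
      case (step i)
      have "otype_eq ?V ?k (omega_pow (ofin i) * ofin (count (mset (cnf \<alpha>)) (ofin i)))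
        (omega_pow (ofin i) * ofin (count (mset (cnf \<beta>)) (ofin i)))"
        using dig[OF step.hyps(2)] tP(2)[OF step.hyps(2)] by auto
      then show ?case
        unfolding up_Suc[of i] by (intro otype_eq_add step.IH)
    qed
    from this[of 0] show ?thesis
      using otype_eq_models[OF assms] by (simp add: up_0)
  qed
  show ?thesis
  proof (rule exI[of _ m], rule exI[of _ t], rule exI[of _ P], intro conjI allI impI)
    show "1 \<le> P" by (rule tP(1))
  next
    fix \<alpha> \<beta>
    assume hi: "\<exists>a\<in>set (cnf \<alpha>). ofin m \<le> a" "\<exists>a\<in>set (cnf \<beta>). ofin m \<le> a"
      and dig: "\<forall>i<m. count (mset (cnf \<alpha>)) (ofin i) = count (mset (cnf \<beta>)) (ofin i) \<or>
        t \<le> count (mset (cnf \<alpha>)) (ofin i) \<and> t \<le> count (mset (cnf \<beta>)) (ofin i) \<and>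
        count (mset (cnf \<alpha>)) (ofin i) mod P = count (mset (cnf \<beta>)) (ofin i) mod P"
    show "\<alpha> \<Turnstile> \<phi> \<longleftrightarrow> \<beta> \<Turnstile> \<phi>"
      by (rule main[OF hi]) (rule dig[rule_format])
  qed
qed

section \<open>Counting weighted multisets\<close>

definition wt :: "('a \<Rightarrow> nat) \<Rightarrow> 'a multiset \<Rightarrow> nat" where
  "wt s M = (\<Sum>x\<in>#M. s x)"

definition wmsets :: "'a set \<Rightarrow> ('a \<Rightarrow> nat) \<Rightarrow> nat \<Rightarrow> 'a multiset set" where
  "wmsets X s n = {M. set_mset M \<subseteq> X \<and> wt s M = n}"

definition wcount :: "'a set \<Rightarrow> ('a \<Rightarrow> nat) \<Rightarrow> nat \<Rightarrow> nat" where
  "wcount X s n = card (wmsets X s n)"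

definition graded :: "'a set \<Rightarrow> ('a \<Rightarrow> nat) \<Rightarrow> bool" where
  "graded X s \<longleftrightarrow> (\<forall>x\<in>X. 0 < s x) \<and> (\<forall>n. finite {x\<in>X. s x \<le> n})"

text \<open>For k > 0, the coefficient at k of z A'(z) / A(z), where A(z) is the product of 1 / (1 -
  z^(s x)) over x in \<open>X\<close>, the generating function of \<open>wcount X s\<close>. This is
  \<sigma>(k) of the overview.\<close>

definition dsum :: "'a set \<Rightarrow> ('a \<Rightarrow> nat) \<Rightarrow> nat \<Rightarrow> nat" where
  "dsum X s k = (\<Sum>x | x \<in> X \<and> s x dvd k. s x)"

lemma wt_simps [simp]:
  "wt s {#} = 0" "wt s (add_mset x M) = s x + wt s M" "wt s (M + N) = wt s M + wt s N"
  "wt s (replicate_mset k x) = k * s x"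
  by (simp_all add: wt_def)

lemma graded_subset: "graded X s \<Longrightarrow> Y \<subseteq> X \<Longrightarrow> graded Y s"
  unfolding graded_def
proof (elim conjE, intro conjI allI)
  fix n assume "\<forall>n. finite {x\<in>X. s x \<le> n}" "Y \<subseteq> X"
  then show "finite {x\<in>Y. s x \<le> n}"
    by (intro finite_subset[of "{x\<in>Y. s x \<le> n}" "{x\<in>X. s x \<le> n}"]) auto
qed auto

lemma le_wt: "x \<in># M \<Longrightarrow> s x \<le> wt s M"
  by (auto dest!: multi_member_split)

lemma size_le_wt: "(\<And>x. x \<in># M \<Longrightarrow> 0 < s x) \<Longrightarrow> size M \<le> wt s M"
proof (induction M)
  case (add x M)
  have "0 < s x" "size M \<le> wt s M" using add by auto
  then show ?case by simp
qed simp

lemma finite_wmsets: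
  assumes "graded X s"
  shows "finite (wmsets X s n)"
proof -
  let ?F = "{x\<in>X. s x \<le> n}"
  have "wmsets X s n \<subseteq> mset ` {xs. set xs \<subseteq> ?F \<and> length xs \<le> n}"
  proof
    fix M assume M: "M \<in> wmsets X s n"
    obtain xs where xs: "M = mset xs" by (metis ex_mset)
    have "set_mset M \<subseteq> ?F" using M le_wt[of _ M s] by (auto simp: wmsets_def)
    moreover have "size M \<le> n"
      using M size_le_wt[of M s] assms by (auto simp: wmsets_def graded_def)
    ultimately show "M \<in> mset ` {xs. set xs \<subseteq> ?F \<and> length xs \<le> n}"
      unfolding xs by auto
  qed
  moreover have "finite ?F" using assms by (simp add: graded_def)
  ultimately show ?thesis
    using finite_lists_length_le[of ?F n] finite_imageI finite_subset by blast
qed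

lemma wcount_0: "graded X s \<Longrightarrow> wcount X s 0 = 1"
proof -
  assume g: "graded X s"
  have "M = {#}" if "M \<in> wmsets X s 0" for M
    using that g size_le_wt[of M s] by (auto simp: wmsets_def graded_def)
  then have "wmsets X s 0 = {{#}}" by (auto simp: wmsets_def)
  then show ?thesis by (simp add: wcount_def)
qed

lemma wmsets_count_ge:
  assumes "x \<in> X"
  shows "{M \<in> wmsets X s n. k \<le> count M x} =
    (if k * s x \<le> n then (+) (replicate_mset k x) ` wmsets X s (n - k * s x) else {})"
proof -
  have *: "\<exists>N. M = replicate_mset k x + N" if "k \<le> count M x" for M
    using that by (metis count_le_replicate_mset_subset_eq mset_subset_eq_exists_conv)
  show ?thesis
  proof (cases "k * s x \<le> n")
    case True
    have "M \<in> (+) (replicate_mset k x) ` wmsets X s (n - k * s x)"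
      if M: "M \<in> wmsets X s n" "k \<le> count M x" for M
    proof -
      obtain N where "M = replicate_mset k x + N" using *[OF M(2)] by auto
      then show ?thesis using M by (auto simp: wmsets_def)
    qed
    moreover have "replicate_mset k x + N \<in> {M \<in> wmsets X s n. k \<le> count M x}"
      if "N \<in> wmsets X s (n - k * s x)" for N
      using that True assms by (auto simp: wmsets_def split: if_splits)
    ultimately show ?thesis using True by auto
  next
    case False
    have "\<not> k \<le> count M x" if "M \<in> wmsets X s n" for M
    proof
      assume "k \<le> count M x"
      then obtain N where "M = replicate_mset k x + N" using * by auto
      then show False using that False by (auto simp: wmsets_def)
    qed
    then show ?thesis using False by auto
  qed
qed

lemma card_count_ge:
  assumes "x \<in> X"
  shows "card {M \<in> wmsets X s n. k \<le> count M x} =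
    (if k * s x \<le> n then wcount X s (n - k * s x) else 0)"
  unfolding wmsets_count_ge[OF assms] wcount_def by (simp add: card_image)

text \<open>Coefficientwise form of multiplying the generating function by 1 - z^(s x): the
  multisets that contain \<open>x\<close> arise from all multisets by adding one copy.\<close>

lemma wcount_remove:
  assumes "graded X s" "x \<in> X"
  shows "wcount X s n = wcount (X - {x}) s n + (if s x \<le> n then wcount X s (n - s x) else 0)"
proof -
  have "wmsets X s n = wmsets (X - {x}) s n \<union> {M \<in> wmsets X s n. 1 \<le> count M x}"
    by (auto simp: wmsets_def)
  moreover have "wmsets (X - {x}) s n \<inter> {M \<in> wmsets X s n. 1 \<le> count M x} = {}"
    by (auto simp: wmsets_def)
  ultimately have "card (wmsets X s n) = card (wmsets (X - {x}) s n) + card {M \<in> wmsets X s n. 1 \<le> count M x}"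
    using finite_wmsets[OF assms(1), of n] card_Un_disjoint by (metis finite_Un)
  then show ?thesis using card_count_ge[OF assms(2), of s n 1] by (simp add: wcount_def)
qed

lemma wcount_mono:
  assumes "graded X s" "x \<in> X" "s x = 1" "m \<le> n"
  shows "wcount X s m \<le> wcount X s n"
  using assms(4)
proof (induction rule: dec_induct)
  case (step k)
  then show ?case using wcount_remove[OF assms(1,2), of "Suc k"] assms(3) by simp
qed simp

lemma wt_eq_sum:
  assumes "finite F" "set_mset M \<subseteq> F"
  shows "wt s M = (\<Sum>x\<in>F. s x * count M x)"
  using assms(2)
proof (induction M)
  case (add y M)
  have "(\<Sum>x\<in>F. s x * count (add_mset y M) x) = (\<Sum>x\<in>F. s x * count M x + (if x = y then s x else 0))"
    by (intro sum.cong) auto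
  also have "\<dots> = (\<Sum>x\<in>F. s x * count M x) + s y"
    using assms(1) add.prems by (simp add: sum.distrib)
  finally show ?case using add by simp
qed simp

text \<open>Summing the weights of all multisets of weight \<open>n\<close> part by part, a part \<open>x\<close> of multiplicity
  \<open>k\<close> is counted once for every \<open>j \<le> k\<close>.\<close>

lemma wcount_identity:
  assumes g: "graded X s"
  shows "n * wcount X s n = (\<Sum>k=1..n. dsum X s k * wcount X s (n - k))"
proof -
  define F where "F = {x\<in>X. s x \<le> n}"
  have F: "finite F" "F \<subseteq> X" using g by (auto simp: F_def graded_def)
  have pos: "0 < s x" if "x \<in> X" for x using g that by (auto simp: graded_def)
  have MF: "set_mset M \<subseteq> F" if "M \<in> wmsets X s n" for M
    using that le_wt[of _ M s] by (auto simp: wmsets_def F_def)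
  have cnt: "count M x = (\<Sum>j=1..n. if j \<le> count M x then 1 else 0)" if "M \<in> wmsets X s n" for M x
  proof -
    have "count M x \<le> size M" by (rule count_le_size)
    also have "\<dots> \<le> n" using that size_le_wt[of M s] pos by (auto simp: wmsets_def)
    finally have "{j\<in>{1..n}. j \<le> count M x} = {1..count M x}" by auto
    then show ?thesis by (simp flip: sum.inter_filter)
  qed
  have inner: "(\<Sum>j=1..n. if j * s x \<le> n then wcount X s (n - j * s x) else 0) =
      (\<Sum>k=1..n. if s x dvd k then wcount X s (n - k) else 0)" if x: "x \<in> F" for x
  proof -
    have sx: "0 < s x" using pos x F by auto
    have "(\<Sum>j\<in>{j\<in>{1..n}. j * s x \<le> n}. wcount X s (n - j * s x)) =
        (\<Sum>k\<in>{k\<in>{1..n}. s x dvd k}. wcount X s (n - k))"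
    proof (rule sum.reindex_bij_witness[of _ "\<lambda>k. k div s x" "\<lambda>j. j * s x"])
      fix k assume "k \<in> {k\<in>{1..n}. s x dvd k}"
      then show "k div s x * s x = k" "k div s x \<in> {j\<in>{1..n}. j * s x \<le> n}"
        using sx by (auto simp: Suc_le_eq div_greater_zero_iff dvd_imp_le intro: order_trans[OF div_le_dividend])
    next
      fix j assume "j \<in> {j\<in>{1..n}. j * s x \<le> n}"
      then show "j * s x div s x = j" "j * s x \<in> {k\<in>{1..n}. s x dvd k}"
        using sx by auto
    qed simp
    then show ?thesis by (simp flip: sum.inter_filter)
  qed
  have "n * wcount X s n = (\<Sum>M\<in>wmsets X s n. wt s M)"
    by (simp add: wcount_def wmsets_def)
  also have "\<dots> = (\<Sum>M\<in>wmsets X s n. \<Sum>x\<in>F. s x * (\<Sum>j=1..n. if j \<le> count M x then 1 else 0))"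
    using wt_eq_sum[OF F(1) MF] cnt by (intro sum.cong refl) (metis (no_types, lifting) sum.cong)
  also have "\<dots> = (\<Sum>x\<in>F. s x * (\<Sum>j=1..n. \<Sum>M\<in>wmsets X s n. if j \<le> count M x then 1 else 0))"
    unfolding sum_distrib_left by (subst sum.swap) (simp add: sum.swap[of _ "wmsets X s n"])
  also have "\<dots> = (\<Sum>x\<in>F. s x * (\<Sum>j=1..n. if j * s x \<le> n then wcount X s (n - j * s x) else 0))"
  proof (intro sum.cong refl arg_cong2[of _ _ _ _ "(*)"])
    fix x j assume "x \<in> F"
    then show "(\<Sum>M\<in>wmsets X s n. if j \<le> count M x then 1 else 0) =
        (if j * s x \<le> n then wcount X s (n - j * s x) else 0)"
      using card_count_ge[of x X s n j] F finite_wmsets[OF g, of n] by (auto simp flip: sum.inter_filter)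
  qed
  also have "\<dots> = (\<Sum>x\<in>F. s x * (\<Sum>k=1..n. if s x dvd k then wcount X s (n - k) else 0))"
    using inner by (intro sum.cong refl) simp
  also have "\<dots> = (\<Sum>k=1..n. (\<Sum>x\<in>F. if s x dvd k then s x else 0) * wcount X s (n - k))"
    unfolding sum_distrib_left sum_distrib_right
    by (subst sum.swap) (intro sum.cong refl, simp)
  also have "\<dots> = (\<Sum>k=1..n. dsum X s k * wcount X s (n - k))"
  proof (intro sum.cong refl arg_cong2[of _ _ _ _ "(*)"])
    fix k assume k: "k \<in> {1..n}"
    have "s x \<le> n" if "s x dvd k" for x using dvd_imp_le[OF that] k by auto
    then have "{x\<in>F. s x dvd k} = {x. x \<in> X \<and> s x dvd k}"
      by (auto simp: F_def)
    then show "(\<Sum>x\<in>F. if s x dvd k then s x else 0) = dsum X s k"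
      using F(1) by (simp add: dsum_def flip: sum.inter_filter)
  qed
  finally show ?thesis .
qed

lemma dsum_mono:
  assumes "graded X s" "Y \<subseteq> X" "0 < k"
  shows "dsum Y s k \<le> dsum X s k"
  unfolding dsum_def
proof (rule sum_mono2)
  have "{x. x \<in> X \<and> s x dvd k} \<subseteq> {x\<in>X. s x \<le> k}" using assms(3) by (auto dest: dvd_imp_le)
  then show "finite {x. x \<in> X \<and> s x dvd k}"
    by (rule finite_subset) (use assms(1) in \<open>simp add: graded_def\<close>)
qed (use assms(2) in auto)

text \<open>The geometric series for 1 / (1 - z^(s x)), obtained by iterating
  \<open>wcount_remove\<close>; \<open>m - k\<close> is the weight of the copies of
  \<open>x\<close>. The shift by \<open>k\<close> prepares the substitution into the
  recursion.\<close>

lemma wcount_expand: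
  assumes g: "graded X s" and x: "x \<in> X" and "k \<le> n"
  shows "wcount X s (n - k) = (\<Sum>m\<in>{m\<in>{k..n}. s x dvd m - k}. wcount (X - {x}) s (n - m))"
  using assms(3)
proof (induction "n - k" arbitrary: k rule: less_induct)
  case less
  have sx: "0 < s x" using g x by (auto simp: graded_def)
  show ?case
  proof (cases "k + s x \<le> n")
    case True
    have "m \<in> {m\<in>{k..n}. s x dvd m - k} \<longleftrightarrow> m \<in> insert k {m\<in>{k + s x..n}. s x dvd m - (k + s x)}" for m
    proof (cases "k + s x \<le> m")
      case True
      then have "m - k = (m - (k + s x)) + s x" by auto
      then have "s x dvd m - k \<longleftrightarrow> s x dvd m - (k + s x)" by (metis dvd_add_triv_right_iff)
      then show ?thesis using True sx by auto
    next
      case False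
      then have "m = k" if "s x dvd m - k" "k \<le> m" using that by (auto dest: dvd_imp_le)
      then show ?thesis using False less.prems by auto
    qed
    then have eq: "{m\<in>{k..n}. s x dvd m - k} = insert k {m\<in>{k + s x..n}. s x dvd m - (k + s x)}"
      by (rule set_eqI)
    have "wcount X s (n - k) = wcount (X - {x}) s (n - k) + wcount X s (n - k - s x)"
      using wcount_remove[OF g x, of "n - k"] True by simp
    also have "wcount X s (n - k - s x) = wcount X s (n - (k + s x))" by simp
    also have "\<dots> = (\<Sum>m\<in>{m\<in>{k + s x..n}. s x dvd m - (k + s x)}. wcount (X - {x}) s (n - m))"
      using less.hyps[of "k + s x"] True sx by auto
    finally show ?thesis unfolding eq using sx by (subst sum.insert) auto
  next
    case False
    have "m = k" if "m \<in> {k..n}" "s x dvd m - k" for m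
      using that False by (auto dest: dvd_imp_le)
    then have "{m\<in>{k..n}. s x dvd m - k} = {k}"
      using less.prems by auto
    moreover have "\<not> s x \<le> n - k" using False less.prems by simp
    ultimately show ?thesis using wcount_remove[OF g x, of "n - k"] by simp
  qed
qed

text \<open>The recursion of \<open>X\<close> is rewritten over the values
  \<open>wcount (X - {x}) s (n - m)\<close>, over which the recursion of \<open>X - {x}\<close> runs
  as well. The two counts can then be compared coefficient by coefficient.\<close>

lemma wcount_identity_expand:
  assumes g: "graded X s" and x: "x \<in> X"
  shows "n * wcount X s n =
    (\<Sum>m=1..n. (\<Sum>k\<in>{k\<in>{1..m}. s x dvd m - k}. dsum X s k) * wcount (X - {x}) s (n - m))"
proof -
  have "n * wcount X s n = (\<Sum>k=1..n. \<Sum>m\<in>{m\<in>{1..n}. k \<le> m \<and> s x dvd m - k}.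
      dsum X s k * wcount (X - {x}) s (n - m))"
    unfolding wcount_identity[OF g, of n]
  proof (intro sum.cong refl)
    fix k assume k: "k \<in> {1..n}"
    then have "{m\<in>{k..n}. s x dvd m - k} = {m\<in>{1..n}. k \<le> m \<and> s x dvd m - k}" by auto
    then show "dsum X s k * wcount X s (n - k) = (\<Sum>m\<in>{m\<in>{1..n}. k \<le> m \<and> s x dvd m - k}.
        dsum X s k * wcount (X - {x}) s (n - m))"
      using wcount_expand[OF g x, of k n] k by (simp add: sum_distrib_left)
  qed
  also have "\<dots> = (\<Sum>m=1..n. \<Sum>k\<in>{k\<in>{1..n}. k \<le> m \<and> s x dvd m - k}.
      dsum X s k * wcount (X - {x}) s (n - m))"
    by (rule sum.swap_restrict) auto
  also have "\<dots> = (\<Sum>m=1..n. (\<Sum>k\<in>{k\<in>{1..m}. s x dvd m - k}. dsum X s k) * wcount (X - {x}) s (n - m))"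
  proof (intro sum.cong refl)
    fix m assume "m \<in> {1..n}"
    then have "{k\<in>{1..n}. k \<le> m \<and> s x dvd m - k} = {k\<in>{1..m}. s x dvd m - k}" by auto
    then show "(\<Sum>k\<in>{k\<in>{1..n}. k \<le> m \<and> s x dvd m - k}. dsum X s k * wcount (X - {x}) s (n - m)) =
        (\<Sum>k\<in>{k\<in>{1..m}. s x dvd m - k}. dsum X s k) * wcount (X - {x}) s (n - m)"
      by (simp add: sum_distrib_right)
  qed
  finally show ?thesis .
qed

section \<open>Slowly varying counts: the ratio limit 1\<close>

definition dsum_small :: "'a set \<Rightarrow> ('a \<Rightarrow> nat) \<Rightarrow> nat \<Rightarrow> bool" where
  "dsum_small X s q \<longleftrightarrow> (\<forall>\<epsilon>>0. \<exists>M. \<forall>m\<ge>M.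
    real (dsum X s m) \<le> \<epsilon> * real (\<Sum>k\<in>{k\<in>{1..m}. q dvd m - k}. dsum X s k))"

text \<open>Let d(n) be the count without \<open>x\<close>, and let \<tau>(m) be the sum of
  \<sigma>(k) over k = 1, ..., m congruent to m modulo \<open>s x\<close>. Then n d(n) is at most
  the sum of \<sigma>(m) d(n - m), while n times the full count is the sum of \<tau>(m) d(n - m). By
  \<open>dsum_small\<close> the first coefficients are of smaller order than the second; finitely
  many exceptional m cost only a constant times \<open>A n\<close>, which the factor n beats. The
  monotone majorant \<open>A\<close> allows a comparison with a count for other weights.\<close>

lemma wcount_remove_negligible:
  assumes g: "graded X s" and x: "x \<in> X" and small: "dsum_small X s (s x)"
    and A: "\<And>n. wcount X s n \<le> A n" "\<And>m n. m \<le> n \<Longrightarrow> A m \<le> A n"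
  shows "(\<lambda>n. real (wcount (X - {x}) s n) / real (A n)) \<longlonglongrightarrow> 0"
proof (rule LIMSEQ_I)
  fix r :: real assume r: "r > 0"
  define d where "d = wcount (X - {x}) s"
  define \<tau> where "\<tau> m = (\<Sum>k\<in>{k\<in>{1..m}. s x dvd m - k}. dsum X s k)" for m
  \<comment> \<open>The budget \<open>r\<close> is cut in three: one third for m at least
    \<open>M\<close>, one for the first \<open>M\<close> terms, and one as a margin for the strict
    inequality.\<close>
  obtain M where M: "\<And>m. m \<ge> M \<Longrightarrow> real (dsum X s m) \<le> r / 3 * real (\<tau> m)"
    using small r unfolding dsum_small_def \<tau>_def by (metis divide_pos_pos zero_less_numeral)
  define C where "C = (\<Sum>m<M. dsum X s m)"
  have dA: "d n \<le> A n" for n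
    using wcount_remove[OF g x, of n] A(1)[of n] unfolding d_def by linarith
  have bound: "real n * real (d n) \<le> r / 3 * (real n * real (A n)) + real M * real C * real (A n)" for n
  proof -
    have 1: "real (dsum (X - {x}) s m) * real (d (n - m)) \<le>
        r / 3 * (real (\<tau> m) * real (d (n - m))) + (if m < M then real C * real (A n) else 0)"
      if m: "m \<in> {1..n}" for m
    proof -
      have le: "real (dsum (X - {x}) s m) \<le> real (dsum X s m)"
        using dsum_mono[OF g, of "X - {x}" m] m by auto
      show ?thesis
      proof (cases "m < M")
        case True
        have "dsum X s m \<le> C" unfolding C_def by (rule member_le_sum) (use True in auto)
        moreover have "d (n - m) \<le> A n" using dA[of "n - m"] A(2)[of "n - m" n] by simp
        ultimately have "real (dsum (X - {x}) s m) * real (d (n - m)) \<le> real C * real (A n)"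
          using le by (intro mult_mono) auto
        moreover have "0 \<le> r / 3 * (real (\<tau> m) * real (d (n - m)))" using r by simp
        ultimately show ?thesis using True by simp
      next
        case False
        then have "real (dsum (X - {x}) s m) \<le> r / 3 * real (\<tau> m)" using le M[of m] by simp
        then have "real (dsum (X - {x}) s m) * real (d (n - m)) \<le> r / 3 * real (\<tau> m) * real (d (n - m))"
          by (rule mult_right_mono) simp
        then show ?thesis using False by (simp add: mult.assoc)
      qed
    qed
    have "real n * real (d n) = (\<Sum>m=1..n. real (dsum (X - {x}) s m) * real (d (n - m)))"
      using arg_cong[OF wcount_identity[OF graded_subset[OF g, of "X - {x}"], of n], of real]
      by (simp add: d_def)
    also have "\<dots> \<le> (\<Sum>m=1..n. r / 3 * (real (\<tau> m) * real (d (n - m))) + (if m < M then real C * real (A n) else 0))"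
      by (rule sum_mono) (rule 1)
    also have "\<dots> = r / 3 * (\<Sum>m=1..n. real (\<tau> m) * real (d (n - m))) + (\<Sum>m=1..n. if m < M then real C * real (A n) else 0)"
      by (simp add: sum.distrib sum_distrib_left)
    also have "(\<Sum>m=1..n. real (\<tau> m) * real (d (n - m))) = real n * real (wcount X s n)"
      using arg_cong[OF wcount_identity_expand[OF g x, of n], of real]
      by (simp add: d_def \<tau>_def)
    also have "(\<Sum>m=1..n. if m < M then real C * real (A n) else 0) = (\<Sum>m\<in>{m\<in>{1..n}. m < M}. real C * real (A n))"
      by (simp flip: sum.inter_filter)
    also have "\<dots> \<le> real M * (real C * real (A n))"
    proof -
      have "card {m\<in>{1..n}. m < M} \<le> card {..<M}" by (rule card_mono) auto
      then have "real (card {m\<in>{1..n}. m < M}) * (real C * real (A n)) \<le> real M * (real C * real (A n))"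
        by (intro mult_right_mono) auto
      then show ?thesis by simp
    qed
    also have "r / 3 * (real n * real (wcount X s n)) \<le> r / 3 * (real n * real (A n))"
      using A(1)[of n] r by (intro mult_left_mono) auto
    finally show ?thesis by simp
  qed
  obtain n0 :: nat where n0: "real n0 > 3 * real M * real C / r" using reals_Archimedean2 by blast
  have "norm (real (d n) / real (A n) - 0) < r" if n: "n \<ge> Suc n0" for n
  proof (cases "A n = 0")
    case False
    then have pos: "real (A n) > 0" "real n > 0" using n by auto
    have "real M * real C \<le> r / 3 * real n"
    proof -
      have "3 * real M * real C / r \<le> real n" using n0 n by linarith
      then show ?thesis using r by (simp add: field_simps)
    qed
    then have "real M * real C * real (A n) \<le> r / 3 * real n * real (A n)"
      using pos by (intro mult_right_mono) auto
    then have "real n * real (d n) \<le> real n * (2 * r / 3 * real (A n))"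
      using bound[of n] by (simp add: field_simps)
    then have "real (d n) \<le> 2 * r / 3 * real (A n)"
      using pos by simp
    also have "\<dots> < r * real (A n)" using r pos by simp
    finally have "real (d n) / real (A n) < r" using pos by (simp add: field_simps)
    then show ?thesis using pos by simp
  qed (use r in simp)
  then show "\<exists>no. \<forall>n\<ge>no. norm (real (wcount (X - {x}) s n) / real (A n) - 0) < r"
    unfolding d_def by blast
qed

lemma ratio_tendsto_plus:
  fixes f :: "nat \<Rightarrow> real"
  assumes f: "(\<lambda>n. f n / f (Suc n)) \<longlonglongrightarrow> \<rho>" and "\<rho> > 0"
  shows "(\<lambda>n. f n / f (n + k)) \<longlonglongrightarrow> \<rho> ^ k"
proof -
  have "eventually (\<lambda>n. f n / f (Suc n) > 0) sequentially"
    using f assms(2) by (rule order_tendstoD)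
  then have ne: "eventually (\<lambda>n. f n \<noteq> 0) sequentially"
    by eventually_elim auto
  show ?thesis
  proof (induction k)
    case 0
    have "eventually (\<lambda>n. f n / f (n + 0) = 1) sequentially"
      using ne by eventually_elim simp
    then show ?case by (simp add: tendsto_eventually)
  next
    case (Suc k)
    have "(\<lambda>n. f (n + k) / f (Suc (n + k))) \<longlonglongrightarrow> \<rho>"
      using LIMSEQ_ignore_initial_segment[OF f, of k] by simp
    with Suc have "(\<lambda>n. f n / f (n + k) * (f (n + k) / f (Suc (n + k)))) \<longlonglongrightarrow> \<rho> ^ k * \<rho>"
      by (intro tendsto_mult)
    moreover have "eventually (\<lambda>n. f (n + k) \<noteq> 0) sequentially"
      using ne by (rule eventually_all_ge_at_top[THEN eventually_mono]) simp
    then have "eventually (\<lambda>n. f n / f (n + k) * (f (n + k) / f (Suc (n + k))) = f n / f (n + Suc k)) sequentially"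
      by eventually_elim simp
    ultimately show ?case
      using Lim_transform_eventually by (fastforce simp: mult.commute)
  qed
qed

lemma ratio_tendsto_minus:
  fixes f :: "nat \<Rightarrow> real"
  assumes "(\<lambda>n. f n / f (Suc n)) \<longlonglongrightarrow> \<rho>" "\<rho> > 0"
  shows "(\<lambda>n. f (n - k) / f n) \<longlonglongrightarrow> \<rho> ^ k"
proof (rule LIMSEQ_offset[of _ k])
  show "(\<lambda>n. f (n + k - k) / f (n + k)) \<longlonglongrightarrow> \<rho> ^ k"
    using ratio_tendsto_plus[OF assms, of k] by simp
qed

definition pcount :: "'a set \<Rightarrow> ('a \<Rightarrow> nat) \<Rightarrow> nat \<Rightarrow> nat" where
  "pcount X s k = card {x\<in>X. s x = k}"

lemma finite_dvd_parts:
  assumes "graded X s" "0 < m"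
  shows "finite {x. x \<in> X \<and> s x dvd m}"
proof (rule finite_subset)
  show "{x. x \<in> X \<and> s x dvd m} \<subseteq> {x\<in>X. s x \<le> m}" using assms(2) by (auto dest: dvd_imp_le)
  show "finite {x\<in>X. s x \<le> m}" using assms(1) by (simp add: graded_def)
qed

lemma dsum_eq_pcount:
  assumes "graded X s" "0 < m"
  shows "dsum X s m = (\<Sum>d | d dvd m. d * pcount X s d)"
proof -
  let ?S = "{x. x \<in> X \<and> s x dvd m}"
  have "dsum X s m = (\<Sum>d\<in>{d. d dvd m}. \<Sum>x\<in>{x\<in>?S. s x = d}. s x)"
    unfolding dsum_def using finite_dvd_parts[OF assms] finite_divisors_nat[OF assms(2)]
    by (intro sum.group[symmetric]) auto
  also have "\<dots> = (\<Sum>d | d dvd m. d * pcount X s d)"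
  proof (intro sum.cong refl)
    fix d assume "d \<in> {d. d dvd m}"
    then have "{x\<in>?S. s x = d} = {x\<in>X. s x = d}" by auto
    then show "(\<Sum>x\<in>{x\<in>?S. s x = d}. s x) = d * pcount X s d"
      by (simp add: pcount_def)
  qed
  finally show ?thesis .
qed

lemma dsum_ge_pcount:
  assumes "graded X s" "0 < m"
  shows "m * pcount X s m \<le> dsum X s m"
  unfolding dsum_eq_pcount[OF assms] using finite_divisors_nat[OF assms(2)]
  by (intro member_le_sum) auto

text \<open>At most m divisors lie below m / J. The others have a cofactor of at most J, so there
  are at most J of them, each at most m. For large J this shows that the divisor sum is of smaller
  order than m^2.\<close>

lemma sum_divisors_le:
  assumes "0 < m" "0 < J"
  shows "real (\<Sum>d | d dvd m. d) \<le> real m * real m / real J + real m * real J"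
proof -
  let ?D = "{d. d dvd m}"
  have fin: "finite ?D" by (rule finite_divisors_nat[OF assms(1)])
  have "real d \<le> real m / real J + (if m \<le> J * d then real m else 0)" if "d \<in> ?D" for d
  proof (cases "m \<le> J * d")
    case True
    have "d \<le> m" using that assms by (auto dest: dvd_imp_le)
    then have "real d \<le> real m" "0 \<le> real m / real J" by simp_all
    then have "real d \<le> real m / real J + real m" by linarith
    then show ?thesis using True by simp
  next
    case False
    then have "real J * real d \<le> real m" by (metis of_nat_mult of_nat_le_iff nat_le_linear)
    then show ?thesis using False assms by (simp add: field_simps)
  qed
  then have "real (\<Sum>d\<in>?D. d) \<le> (\<Sum>d\<in>?D. real m / real J + (if m \<le> J * d then real m else 0))"
    unfolding of_nat_sum by (rule sum_mono)
  also have "\<dots> = real (card ?D) * (real m / real J) + real (card {d\<in>?D. m \<le> J * d}) * real m"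
    using fin by (simp add: sum.distrib flip: sum.inter_filter)
  also have "\<dots> \<le> real m * (real m / real J) + real J * real m"
  proof (intro add_mono mult_right_mono)
    have "?D \<subseteq> {1..m}" using assms(1) by (auto dest: dvd_imp_le intro: Suc_leI dvd_pos_nat)
    then have "card ?D \<le> card {1..m}" by (intro card_mono) auto
    then show "real (card ?D) \<le> real m" by simp
    have "inj_on (\<lambda>d. m div d) {d\<in>?D. m \<le> J * d}"
    proof (rule inj_onI)
      fix d e assume d: "d \<in> {d\<in>?D. m \<le> J * d}" and e: "e \<in> {d\<in>?D. m \<le> J * d}" and eq: "m div d = m div e"
      have "m div d * d = m div e * e" using d e by simp
      moreover have "m div e \<noteq> 0" using e assms(1) by (auto elim!: dvdE)
      ultimately show "d = e" using eq by simp
    qed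
    moreover have "(\<lambda>d. m div d) ` {d\<in>?D. m \<le> J * d} \<subseteq> {1..J}"
    proof
      fix y assume "y \<in> (\<lambda>d. m div d) ` {d\<in>?D. m \<le> J * d}"
      then obtain d where d: "d dvd m" "m \<le> J * d" "y = m div d" by auto
      then have "0 < d" using assms(1) by (auto intro: dvd_pos_nat)
      moreover have "m = y * d" using d by simp
      ultimately show "y \<in> {1..J}" using d(2) assms(1) by auto
    qed
    ultimately have "card {d\<in>?D. m \<le> J * d} \<le> card {1..J}" by (intro card_inj_on_le) auto
    then show "real (card {d\<in>?D. m \<le> J * d}) \<le> real J" by simp
  qed auto
  finally show ?thesis by (simp add: mult.commute)
qed

text \<open>From the residue class only \<open>N\<close> members \<open>m - i * q\<close> are kept,
  and from \<sigma> at each of them only the parts of exactly this weight.\<close>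

lemma sum_dsum_ge:
  assumes g: "graded X s" and q: "0 < q" and N: "\<And>i. i < N \<Longrightarrow> i * q < m"
  shows "(\<Sum>i<N. (m - i * q) * pcount X s (m - i * q)) \<le> (\<Sum>k\<in>{k\<in>{1..m}. q dvd m - k}. dsum X s k)"
proof -
  have inj: "inj_on (\<lambda>i. m - i * q) {..<N}"
  proof (rule inj_onI)
    fix i j assume "i \<in> {..<N}" "j \<in> {..<N}" "m - i * q = m - j * q"
    moreover from this have "i * q < m" "j * q < m" using N by auto
    ultimately have "i * q = j * q" by linarith
    then show "i = j" using q by simp
  qed
  have "(\<Sum>i<N. (m - i * q) * pcount X s (m - i * q)) = (\<Sum>k\<in>(\<lambda>i. m - i * q) ` {..<N}. k * pcount X s k)"
    by (simp add: sum.reindex[OF inj])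
  also have "\<dots> \<le> (\<Sum>k\<in>(\<lambda>i. m - i * q) ` {..<N}. dsum X s k)"
    using N by (intro sum_mono dsum_ge_pcount[OF g]) auto
  also have "\<dots> \<le> (\<Sum>k\<in>{k\<in>{1..m}. q dvd m - k}. dsum X s k)"
  proof (rule sum_mono2)
    show "(\<lambda>i. m - i * q) ` {..<N} \<subseteq> {k\<in>{1..m}. q dvd m - k}"
    proof
      fix k assume "k \<in> (\<lambda>i. m - i * q) ` {..<N}"
      then obtain i where i: "i < N" "k = m - i * q" by auto
      then have "m - k = i * q" using N[of i] by simp
      then show "k \<in> {k\<in>{1..m}. q dvd m - k}" using i N[of i] by auto
    qed
  qed auto
  finally show ?thesis .
qed

text \<open>Write p for \<open>pcount X s\<close>. In \<sigma>(m) the divisor m contributes m p(m),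
  and the proper divisors, being at most h = m div 2, contribute about p(h) times a divisor sum of
  order less than m^2. On the other side \<tau>(m) contains J terms close to m, each at least m p(m)
  / 4 by the ratio limit, and about m / (2 q) terms with argument at least h, each at least m p(h) /
  3 by monotonicity.\<close>

lemma dsum_small_regular:
  assumes g: "graded X s" and q: "0 < q"
    and K: "\<And>k. K \<le> k \<Longrightarrow> pcount X s k \<le> pcount X s (Suc k)" "\<And>k. K \<le> k \<Longrightarrow> 1 \<le> pcount X s k"
    and ratio: "(\<lambda>k. real (pcount X s k) / real (pcount X s (Suc k))) \<longlonglongrightarrow> 1"
  shows "dsum_small X s q"
  unfolding dsum_small_def
proof (intro allI impI)
  fix \<epsilon> :: real assume \<epsilon>: "\<epsilon> > 0"
  define p where "p = pcount X s"
  define \<tau> where "\<tau> m = (\<Sum>k\<in>{k\<in>{1..m}. q dvd m - k}. dsum X s k)" for m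
  \<comment> \<open>Relative to \<tau>(m), the divisor m costs 4 / J and the leading part of the
    divisor sum 6 q / J. Together they may use up half of \<epsilon>.\<close>
  obtain J :: nat where J: "real J > 2 * (4 + 6 * real q) / \<epsilon>" using reals_Archimedean2 by blast
  moreover have "2 * (4 + 6 * real q) / \<epsilon> > 0" using \<epsilon> by simp
  ultimately have J0: "0 < J" by (metis less_trans of_nat_0_less_iff)
  have J': "(4 + 6 * real q) / real J \<le> \<epsilon> / 2"
    using J J0 \<epsilon> by (simp add: field_simps)
  have mono: "p a \<le> p b" if "K \<le> a" "a \<le> b" for a b
    using that(2,1) by (induction rule: dec_induct) (use K(1) in \<open>auto simp: p_def intro: order_trans\<close>)
  have "eventually (\<lambda>m. \<forall>i\<in>{..<J}. real (p (m - i * q)) / real (p m) > 1 / 2) sequentially"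
  proof (rule eventually_ball_finite)
    show "\<forall>i\<in>{..<J}. eventually (\<lambda>m. real (p (m - i * q)) / real (p m) > 1 / 2) sequentially"
    proof
      fix i
      have "(\<lambda>m. real (p (m - i * q)) / real (p m)) \<longlonglongrightarrow> 1 ^ (i * q)"
        unfolding p_def by (rule ratio_tendsto_minus[OF ratio]) simp
      then show "eventually (\<lambda>m. real (p (m - i * q)) / real (p m) > 1 / 2) sequentially"
        by (rule order_tendstoD) simp
    qed
  qed simp
  then obtain M1 where M1: "\<And>m i. M1 \<le> m \<Longrightarrow> i < J \<Longrightarrow> real (p (m - i * q)) / real (p m) > 1 / 2"
    unfolding eventually_sequentially by auto
  \<comment> \<open>\<open>C\<close> covers the divisors below \<open>K\<close>, where nothing is
    known about monotonicity. The choice of \<open>M2\<close> then lets the lower-order terms take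
    the other half of \<epsilon>.\<close>
  define C where "C = (\<Sum>d<K. d * p d)"
  obtain M2 :: nat where M2: "real M2 > 12 * real q * (real C + real J) / \<epsilon>" using reals_Archimedean2 by blast
  define M where "M = Max {M1, M2, 2 * J * q + 1, 2 * K + 2}"
  have "real (dsum X s m) \<le> \<epsilon> * real (\<tau> m)" if mM: "m \<ge> M" for m
  proof -
    have m: "M1 \<le> m" "M2 \<le> m" "2 * J * q + 1 \<le> m" "2 * K + 2 \<le> m"
      using mM unfolding M_def by auto
    then have m0: "0 < m" by simp
    define h where "h = m div 2"
    have "m \<le> 3 * h" "K \<le> h" "h \<le> m" "h \<le> m - h" using m(4) unfolding h_def by presburger+
    then have h: "K \<le> h" "real h \<ge> real m / 3" "h \<le> m" "m - h \<ge> h" by auto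
    have ph: "1 \<le> p h" using K(2)[OF h(1)] by (simp add: p_def)
    have tau1: "real J * (real m * real (p m)) \<le> 4 * real (\<tau> m)"
    proof -
      have iq: "2 * (i * q) < m" if "i < J" for i
      proof -
        have "i * q \<le> J * q" using that by simp
        then show ?thesis using m(3) by linarith
      qed
      have "real m * real (p m) / 4 \<le> real ((m - i * q) * p (m - i * q))" if "i < J" for i
      proof -
        have pm: "real (p m) > 0" using K(2)[of m] m by (simp add: p_def)
        then have 1: "real (p m) / 2 \<le> real (p (m - i * q))"
          using M1[OF m(1) that] by (simp add: field_simps)
        have 2: "real m / 2 \<le> real (m - i * q)" using iq[OF that] by linarith
        have "real m / 2 * (real (p m) / 2) \<le> real (m - i * q) * real (p (m - i * q))"
          by (rule mult_mono[OF 2 1]) auto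
        then show ?thesis by simp
      qed
      then have "(\<Sum>i<J. real m * real (p m) / 4) \<le> (\<Sum>i<J. real ((m - i * q) * p (m - i * q)))"
        by (intro sum_mono) auto
      also have "\<dots> \<le> real (\<tau> m)"
      proof -
        have "(\<Sum>i<J. (m - i * q) * p (m - i * q)) \<le> \<tau> m"
          unfolding \<tau>_def p_def
        proof (rule sum_dsum_ge[OF g q])
          fix i assume "i < J"
          from iq[OF this] show "i * q < m" by simp
        qed
        then show ?thesis by (metis of_nat_sum of_nat_le_iff)
      qed
      finally show ?thesis by simp
    qed
    have tau2: "real m * real m * real (p h) \<le> 6 * real q * real (\<tau> m)"
    proof -
      define N where "N = m div (2 * q) + 1"
      have iq: "i * q \<le> h" if "i < N" for i
      proof -
        have "i \<le> m div (2 * q)" using that by (simp add: N_def)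
        then have "i * (2 * q) \<le> m" using q by (metis less_eq_div_iff_mult_less_eq mult_pos_pos zero_less_numeral)
        then show ?thesis by (simp add: h_def)
      qed
      have hm: "h < m" using m0 by (simp add: h_def)
      have "real m / 3 * real (p h) \<le> real ((m - i * q) * p (m - i * q))" if "i < N" for i
      proof -
        have "h \<le> m - i * q" using iq[OF that] h(4) by linarith
        then have "p h \<le> p (m - i * q)" "real m / 3 \<le> real (m - i * q)"
          using mono[OF h(1)] h(2) by auto
        then show ?thesis unfolding of_nat_mult by (intro mult_mono) auto
      qed
      then have "(\<Sum>i<N. real m / 3 * real (p h)) \<le> (\<Sum>i<N. real ((m - i * q) * p (m - i * q)))"
        by (intro sum_mono) auto
      also have "\<dots> \<le> real (\<tau> m)"
      proof -
        have "(\<Sum>i<N. (m - i * q) * p (m - i * q)) \<le> \<tau> m"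
          unfolding \<tau>_def p_def
        proof (rule sum_dsum_ge[OF g q])
          fix i assume "i < N"
          from iq[OF this] hm show "i * q < m" by simp
        qed
        then show ?thesis by (metis of_nat_sum of_nat_le_iff)
      qed
      finally have 1: "real N * (real m / 3 * real (p h)) \<le> real (\<tau> m)" by simp
      have "m < N * (2 * q)" unfolding N_def using q dividend_less_div_times[of "2 * q" m] by simp
      then have "real m \<le> 2 * real q * real N"
        by (metis less_imp_le mult.commute of_nat_le_iff of_nat_mult of_nat_numeral mult.left_commute)
      then have "real m * (real m * real (p h)) \<le> 2 * real q * real N * (real m * real (p h))"
        by (rule mult_right_mono) simp
      also have "\<dots> = 6 * real q * (real N * (real m / 3 * real (p h)))" by simp
      also have "\<dots> \<le> 6 * real q * real (\<tau> m)" using 1 by (intro mult_left_mono) auto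
      finally show ?thesis by simp
    qed
    have "real (dsum X s m) = (\<Sum>d | d dvd m. real d * real (p d))"
      unfolding dsum_eq_pcount[OF g m0] p_def by simp
    also have "\<dots> \<le> (\<Sum>d | d dvd m. (if d = m then real m * real (p m) else 0) +
        (if d < K then real (d * p d) else 0) + real d * real (p h))"
    proof (rule sum_mono)
      fix d assume d: "d \<in> {d. d dvd m}"
      consider "d = m" | "d < K" | "d \<noteq> m" "K \<le> d" by linarith
      then show "real d * real (p d) \<le> (if d = m then real m * real (p m) else 0) +
        (if d < K then real (d * p d) else 0) + real d * real (p h)"
      proof cases
        case 3
        obtain e where e: "m = d * e" using d by (auto elim: dvdE)
        then have "e \<noteq> 0" "e \<noteq> 1" using m0 3 by auto
        then have "2 \<le> e" by linarith
        then have "d * 2 \<le> m" unfolding e by (rule mult_le_mono2)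
        then have "d \<le> h" by (simp add: h_def)
        then have "p d \<le> p h" using mono 3 by blast
        then show ?thesis using 3 by (simp add: mult_left_mono)
      qed auto
    qed
    also have "\<dots> = real m * real (p m) + (\<Sum>d | d dvd m. if d < K then real (d * p d) else 0)
        + real (\<Sum>d | d dvd m. d) * real (p h)"
      using finite_divisors_nat[OF m0] by (simp add: sum.distrib sum_distrib_right)
    also have "(\<Sum>d | d dvd m. if d < K then real (d * p d) else 0) \<le> real C"
    proof -
      have "(\<Sum>d | d dvd m. if d < K then real (d * p d) else 0) = (\<Sum>d\<in>{d\<in>{d. d dvd m}. d < K}. real (d * p d))"
        using finite_divisors_nat[OF m0] by (simp only: sum.inter_filter)
      also have "\<dots> \<le> (\<Sum>d<K. real (d * p d))" by (rule sum_mono2) auto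
      finally show ?thesis by (simp add: C_def)
    qed
    also have "real (\<Sum>d | d dvd m. d) * real (p h) \<le> (real m * real m / real J + real m * real J) * real (p h)"
      by (intro mult_right_mono sum_divisors_le m0 J0) simp
    also have "real C \<le> real m * real C * real (p h)"
    proof -
      have "1 * real C * 1 \<le> real m * real C * real (p h)"
        using m0 ph by (intro mult_mono) auto
      then show ?thesis by simp
    qed
    finally have 1: "real (dsum X s m) \<le> real m * real (p m) + real m * real m * real (p h) / real J
        + real m * real (p h) * (real C + real J)"
      by (simp add: algebra_simps)
    have 2: "real m * real (p m) \<le> 4 / real J * real (\<tau> m)"
      using tau1 J0 by (simp add: field_simps)
    have 3: "real m * real m * real (p h) / real J \<le> 6 * real q / real J * real (\<tau> m)"
      using divide_right_mono[OF tau2, of "real J"] by simp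
    have "12 * real q * (real C + real J) / \<epsilon> \<le> real m" using M2 m(2) by linarith
    then have "6 * real q * (real C + real J) / real m \<le> \<epsilon> / 2"
      using \<epsilon> m0 by (simp add: field_simps)
    then have "6 * real q * (real C + real J) / real m * real (\<tau> m) \<le> \<epsilon> / 2 * real (\<tau> m)"
      by (rule mult_right_mono) simp
    moreover have "real m * real (p h) * (real C + real J) \<le> 6 * real q * (real C + real J) / real m * real (\<tau> m)"
    proof -
      have "real m * real m * real (p h) * (real C + real J) \<le> 6 * real q * real (\<tau> m) * (real C + real J)"
        by (intro mult_right_mono tau2) simp
      then show ?thesis using m0 by (simp add: field_simps)
    qed
    ultimately have 4: "real m * real (p h) * (real C + real J) \<le> \<epsilon> / 2 * real (\<tau> m)" by linarith
    have "(4 + 6 * real q) / real J * real (\<tau> m) \<le> \<epsilon> / 2 * real (\<tau> m)"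
      by (rule mult_right_mono[OF J']) simp
    then have "4 / real J * real (\<tau> m) + 6 * real q / real J * real (\<tau> m) \<le> \<epsilon> / 2 * real (\<tau> m)"
      by (simp add: add_divide_distrib distrib_right)
    then show ?thesis using order_trans[OF 1 add_mono[OF add_mono[OF 2 3] 4]] by linarith
  qed
  then show "\<exists>M. \<forall>m\<ge>M. real (dsum X s m) \<le> \<epsilon> * real (\<Sum>k\<in>{k\<in>{1..m}. q dvd m - k}. dsum X s k)"
    unfolding \<tau>_def by blast
qed

text \<open>With finitely many parts \<sigma> is bounded, while a part of weight 1 divides
  everything and makes the sum over k = 1, ..., m at least m. This is the base of the induction on
  \<gamma>.\<close>

lemma dsum_small_finite:
  assumes "finite X" "x \<in> X" "s x = 1"
  shows "dsum_small X s 1"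
  unfolding dsum_small_def
proof (intro allI impI)
  fix \<epsilon> :: real assume \<epsilon>: "\<epsilon> > 0"
  define B where "B = (\<Sum>x\<in>X. s x)"
  have ub: "dsum X s m \<le> B" for m
    unfolding dsum_def B_def by (rule sum_mono2) (use assms in auto)
  have lb: "1 \<le> dsum X s m" for m
  proof -
    have "s x \<le> dsum X s m" unfolding dsum_def by (rule member_le_sum) (use assms in auto)
    then show ?thesis using assms by simp
  qed
  obtain M :: nat where M: "real M > real B / \<epsilon>" using reals_Archimedean2 by blast
  have "real (dsum X s m) \<le> \<epsilon> * real (\<Sum>k\<in>{k\<in>{1..m}. 1 dvd m - k}. dsum X s k)" if "m \<ge> M" for m
  proof -
    have "real B \<le> \<epsilon> * real m" using M that \<epsilon> by (simp add: field_simps) (smt (verit) mult_left_mono of_nat_le_iff)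
    moreover have "m \<le> (\<Sum>k\<in>{k\<in>{1..m}. 1 dvd m - k}. dsum X s k)"
    proof -
      have "{k\<in>{1..m}. 1 dvd m - k} = {1..m}" by auto
      then show ?thesis using sum_mono[of "{1..m}" "\<lambda>_. 1" "dsum X s"] lb by simp
    qed
    ultimately show ?thesis
      using ub[of m] \<epsilon> by (smt (verit) mult_left_mono of_nat_le_iff)
  qed
  then show "\<exists>M. \<forall>m\<ge>M. real (dsum X s m) \<le> \<epsilon> * real (\<Sum>k\<in>{k\<in>{1..m}. 1 dvd m - k}. dsum X s k)"
    by blast
qed

lemma wcount_pos:
  assumes "graded X s" "x \<in> X" "s x = 1"
  shows "0 < wcount X s n"
  using wcount_mono[OF assms, of 0 n] wcount_0[OF assms(1)] by simp

text \<open>The difference of two consecutive counts is the count without the part \<open>x\<close>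
  of weight 1, which is negligible.\<close>

lemma wcount_ratio:
  assumes g: "graded X s" and x: "x \<in> X" "s x = 1" and small: "dsum_small X s 1"
  shows "(\<lambda>n. real (wcount X s n) / real (wcount X s (Suc n))) \<longlonglongrightarrow> 1"
proof -
  have "(\<lambda>n. real (wcount (X - {x}) s n) / real (wcount X s n)) \<longlonglongrightarrow> 0"
    by (rule wcount_remove_negligible[OF g x(1)]) (use small x wcount_mono[OF g x] in auto)
  then have "(\<lambda>n. real (wcount (X - {x}) s (Suc n)) / real (wcount X s (Suc n))) \<longlonglongrightarrow> 0"
    by (rule LIMSEQ_Suc)
  then have "(\<lambda>n. 1 - real (wcount (X - {x}) s (Suc n)) / real (wcount X s (Suc n))) \<longlonglongrightarrow> 1 - 0"
    by (intro tendsto_intros)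
  moreover have "1 - real (wcount (X - {x}) s (Suc n)) / real (wcount X s (Suc n)) =
      real (wcount X s n) / real (wcount X s (Suc n))" for n
  proof -
    have "real (wcount X s n) = real (wcount X s (Suc n)) - real (wcount (X - {x}) s (Suc n))"
      using wcount_remove[OF g x(1), of "Suc n"] x(2) by simp
    moreover have "wcount X s (Suc n) \<noteq> 0" using wcount_pos[OF g x, of "Suc n"] by simp
    ultimately show ?thesis by (simp add: diff_divide_distrib)
  qed
  ultimately show ?thesis by simp
qed

text \<open>Multisets with at least \<open>k\<close> copies of \<open>x\<close> correspond to all
  multisets of a weight smaller by the constant \<open>k * s x\<close>, and by the ratio limit these
  are asymptotically as many.\<close>

lemma card_count_less_negligible:
  assumes g: "graded X s" and x: "x \<in> X"
    and ratio: "(\<lambda>n. real (wcount X s n) / real (wcount X s (Suc n))) \<longlonglongrightarrow> 1"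
  shows "(\<lambda>n. real (card {M \<in> wmsets X s n. count M x < k}) / real (wcount X s n)) \<longlonglongrightarrow> 0"
proof -
  let ?w = "k * s x"
  have "(\<lambda>n. 1 - real (wcount X s (n - ?w)) / real (wcount X s n)) \<longlonglongrightarrow> 1 - 1 ^ ?w"
    by (intro tendsto_intros ratio_tendsto_minus[OF ratio]) simp
  then have lim: "(\<lambda>n. 1 - real (wcount X s (n - ?w)) / real (wcount X s n)) \<longlonglongrightarrow> 0" by simp
  have "eventually (\<lambda>n. real (wcount X s n) / real (wcount X s (Suc n)) > 0) sequentially"
    using ratio by (rule order_tendstoD) simp
  then have "eventually (\<lambda>n. 1 - real (wcount X s (n - ?w)) / real (wcount X s n) =
      real (card {M \<in> wmsets X s n. count M x < k}) / real (wcount X s n)) sequentially"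
    using eventually_ge_at_top[of ?w]
  proof eventually_elim
    case (elim n)
    let ?L = "{M \<in> wmsets X s n. count M x < k}" and ?H = "{M \<in> wmsets X s n. k \<le> count M x}"
    have "card (?L \<union> ?H) = card ?L + card ?H"
      by (rule card_Un_disjoint) (use finite_wmsets[OF g, of n] in auto)
    moreover have "?L \<union> ?H = wmsets X s n" by auto
    ultimately have "wcount X s n = card ?L + card ?H" by (simp add: wcount_def)
    then have "real (card {M \<in> wmsets X s n. count M x < k}) = real (wcount X s n) - real (wcount X s (n - ?w))"
      using card_count_ge[OF x, of s n k] elim by simp
    moreover have "real (wcount X s n) \<noteq> 0" using elim(1) by (simp add: zero_less_divide_iff)
    ultimately show ?case by (simp add: diff_divide_distrib)
  qed
  with lim show ?thesis by (rule Lim_transform_eventually)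
qed

section \<open>Residues of multiplicities\<close>

definition rescale :: "nat \<Rightarrow> 'a set \<Rightarrow> ('a \<Rightarrow> nat) \<Rightarrow> 'a \<Rightarrow> nat" where
  "rescale P Y s x = (if x \<in> Y then P * s x else s x)"

definition digits_mset :: "'a set \<Rightarrow> ('a \<Rightarrow> nat) \<Rightarrow> 'a multiset" where
  "digits_mset Y R = (\<Sum>x\<in>Y. replicate_mset (R x) x)"

definition blowup :: "nat \<Rightarrow> 'a set \<Rightarrow> 'a multiset \<Rightarrow> 'a multiset" where
  "blowup P Y M = (\<Sum>x\<in>#M. replicate_mset (if x \<in> Y then P else 1) x)"

lemma graded_rescale: 
  assumes "graded X s" "0 < P"
  shows "graded X (rescale P Y s)"
  unfolding graded_def
proof (intro conjI ballI allI)
  fix n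
  have "s x \<le> rescale P Y s x" for x using assms(2) by (simp add: rescale_def)
  then have "{x\<in>X. rescale P Y s x \<le> n} \<subseteq> {x\<in>X. s x \<le> n}" by (auto intro: order_trans)
  moreover have "finite {x\<in>X. s x \<le> n}" using assms(1) by (simp add: graded_def)
  ultimately show "finite {x\<in>X. rescale P Y s x \<le> n}" by (rule finite_subset)
qed (use assms in \<open>auto simp: graded_def rescale_def\<close>)

lemma count_digits_mset: "finite Y \<Longrightarrow> count (digits_mset Y R) x = (if x \<in> Y then R x else 0)"
  by (simp add: digits_mset_def count_sum)

lemma count_blowup: "count (blowup P Y M) x = (if x \<in> Y then P else 1) * count M x"
  by (induction M) (auto simp: blowup_def)

lemma wt_blowup: "wt s (blowup P Y M) = wt (rescale P Y s) M"
  by (induction M) (auto simp: blowup_def rescale_def)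

lemma set_blowup: "0 < P \<Longrightarrow> set_mset (blowup P Y M) = set_mset M"
  by (induction M) (auto simp: blowup_def)

lemma blowup_inject:
  assumes "0 < P" "blowup P Y M = blowup P Y N"
  shows "M = N"
proof (rule multiset_eqI)
  fix x
  have "count (blowup P Y M) x = count (blowup P Y N) x" using assms(2) by simp
  then show "count M x = count N x" using assms(1) by (simp add: count_blowup split: if_splits)
qed

lemma set_digits_mset: "finite Y \<Longrightarrow> set_mset (digits_mset Y R) \<subseteq> Y"
  by (metis count_digits_mset count_eq_zero_iff subsetI)

text \<open>Division with remainder of the multiplicities in \<open>Y\<close> by \<open>P\<close>:
  \<open>R\<close> collects the remainders and \<open>N\<close> the quotients. A part of
  \<open>Y\<close> in \<open>N\<close> stands for \<open>P\<close> copies, and this is what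
  \<open>rescale\<close> charges for it.\<close>

lemma wmsets_residue:
  fixes s :: "'a \<Rightarrow> nat"
  assumes Y: "finite Y" "Y \<subseteq> X" and P: "0 < P" and R: "R \<in> (\<Pi>\<^sub>E x\<in>Y. {..<P})"
  defines "w \<equiv> wt s (digits_mset Y R)"
  shows "{M \<in> wmsets X s n. restrict (\<lambda>x. count M x mod P) Y = R} =
    (if w \<le> n then (\<lambda>N. digits_mset Y R + blowup P Y N) ` wmsets X (rescale P Y s) (n - w) else {})"
proof -
  have *: "w \<le> n \<and> M \<in> (\<lambda>N. digits_mset Y R + blowup P Y N) ` wmsets X (rescale P Y s) (n - w)"
    if M: "M \<in> wmsets X s n" "restrict (\<lambda>x. count M x mod P) Y = R" for M
  proof -
    \<comment> \<open>Here \<open>digits_mset\<close> just builds a multiset from prescribed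
      multiplicities.\<close>
    define N where "N = digits_mset (set_mset M) (\<lambda>x. if x \<in> Y then count M x div P else count M x)"
    have N: "count N x = (if x \<in> Y then count M x div P else count M x)" for x
      unfolding N_def by (simp add: count_digits_mset not_in_iff)
    have "R x = count M x mod P" if "x \<in> Y" for x using M(2) that by auto
    then have eq: "M = digits_mset Y R + blowup P Y N"
      by (intro multiset_eqI) (simp add: count_digits_mset[OF Y(1)] count_blowup N)
    have "set_mset N \<subseteq> X"
      using set_digits_mset[of "set_mset M"] M(1) unfolding N_def wmsets_def by blast
    moreover have "w + wt (rescale P Y s) N = n"
      using M(1) eq unfolding w_def wmsets_def by (metis (mono_tags, lifting) mem_Collect_eq wt_blowup wt_simps(3))
    ultimately have "N \<in> wmsets X (rescale P Y s) (n - w)" "w \<le> n"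
      by (auto simp: wmsets_def)
    then show ?thesis using eq by blast
  qed
  have **: "digits_mset Y R + blowup P Y N \<in> {M \<in> wmsets X s n. restrict (\<lambda>x. count M x mod P) Y = R}"
    if "w \<le> n" "N \<in> wmsets X (rescale P Y s) (n - w)" for N
  proof -
    have "set_mset (digits_mset Y R + blowup P Y N) \<subseteq> X"
      using set_digits_mset[OF Y(1), of R] set_blowup[OF P, of Y N] Y(2) that(2)
      by (auto simp: wmsets_def)
    moreover have "wt s (digits_mset Y R + blowup P Y N) = n"
      using that by (simp add: wt_blowup wmsets_def w_def)
    moreover have "restrict (\<lambda>x. count (digits_mset Y R + blowup P Y N) x mod P) Y = R"
    proof
      fix x
      have "R x < P" if "x \<in> Y" using R that by auto
      moreover have "R x = undefined" if "x \<notin> Y" using R that by (rule PiE_arb)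
      ultimately show "restrict (\<lambda>x. count (digits_mset Y R + blowup P Y N) x mod P) Y x = R x"
        by (simp add: count_digits_mset[OF Y(1)] count_blowup restrict_def)
    qed
    ultimately show ?thesis by (simp add: wmsets_def)
  qed
  show ?thesis
  proof (cases "w \<le> n")
    case True
    show ?thesis unfolding if_P[OF True]
      by (rule subset_antisym[OF subsetI subsetI]) (use * ** True in blast)+
  next
    case False
    then show ?thesis using * by auto
  qed
qed

lemma card_residue:
  fixes s :: "'a \<Rightarrow> nat"
  assumes Y: "finite Y" "Y \<subseteq> X" and P: "0 < P" and R: "R \<in> (\<Pi>\<^sub>E x\<in>Y. {..<P})"
  defines "w \<equiv> wt s (digits_mset Y R)"
  shows "card {M \<in> wmsets X s n. restrict (\<lambda>x. count M x mod P) Y = R} =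
    (if w \<le> n then wcount X (rescale P Y s) (n - w) else 0)"
proof -
  have "inj_on (\<lambda>N. digits_mset Y R + blowup P Y N) S" for S
  proof (rule inj_onI)
    fix N N' assume "digits_mset Y R + blowup P Y N = digits_mset Y R + blowup P Y N'"
    then have "blowup P Y N = blowup P Y N'" by simp
    then show "N = N'" by (rule blowup_inject[OF P])
  qed
  then show ?thesis
    unfolding wmsets_residue[OF Y P R] w_def by (simp add: card_image wcount_def)
qed

lemma card_residues:
  assumes g: "graded X s" and Y: "finite Y" "Y \<subseteq> X" and P: "0 < P" and G: "G \<subseteq> (\<Pi>\<^sub>E x\<in>Y. {..<P})"
  shows "card {M \<in> wmsets X s n. restrict (\<lambda>x. count M x mod P) Y \<in> G} =
    (\<Sum>R\<in>G. if wt s (digits_mset Y R) \<le> n then wcount X (rescale P Y s) (n - wt s (digits_mset Y R)) else 0)"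
proof -
  have finG: "finite G" by (rule finite_subset[OF G]) (use Y in \<open>auto intro: finite_PiE\<close>)
  have "{M \<in> wmsets X s n. restrict (\<lambda>x. count M x mod P) Y \<in> G} =
      (\<Union>R\<in>G. {M \<in> wmsets X s n. restrict (\<lambda>x. count M x mod P) Y = R})" by auto
  then have "card {M \<in> wmsets X s n. restrict (\<lambda>x. count M x mod P) Y \<in> G} =
      (\<Sum>R\<in>G. card {M \<in> wmsets X s n. restrict (\<lambda>x. count M x mod P) Y = R})"
    using finG finite_wmsets[OF g, of n] by (simp only:) (rule card_UN_disjoint, auto)
  also have "\<dots> = (\<Sum>R\<in>G. if wt s (digits_mset Y R) \<le> n then wcount X (rescale P Y s) (n - wt s (digits_mset Y R)) else 0)"
    by (intro sum.cong refl card_residue[OF Y P]) (use G in blast)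
  finally show ?thesis .
qed

text \<open>Restricting the multiplicities of the parts in \<open>Y\<close> to multiples of \<open>P\<close> amounts to rescaling
  these parts. Two remaining parts of consecutive weights \<open>q\<close> and \<open>q + 1\<close> make the rescaled
  counting function vary slowly, so that all residue classes receive the same share.\<close>

lemma residues_equidistributed:
  fixes s :: "'a \<Rightarrow> nat"
  assumes g: "graded X s" and x0: "x0 \<in> X" "s x0 = 1"
    and ratio: "(\<lambda>n. real (wcount X s n) / real (wcount X s (Suc n))) \<longlonglongrightarrow> 1"
    and Y: "finite Y" "Y \<subseteq> X" and P: "0 < P"
    and x1: "x1 \<in> X - Y" "x2 \<in> X - Y" "s x2 = Suc (s x1)"
    and small: "dsum_small X (rescale P Y s) (s x1)" "dsum_small X (rescale P Y s) (s x2)"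
    and G: "G \<subseteq> (\<Pi>\<^sub>E x\<in>Y. {..<P})"
  shows "(\<lambda>n. real (card {M \<in> wmsets X s n. restrict (\<lambda>x. count M x mod P) Y \<in> G}) / real (wcount X s n))
    \<longlonglongrightarrow> real (card G) / real (card (\<Pi>\<^sub>E x\<in>Y. {..<P}))"
proof -
  define A where "A n = real (wcount X s n)" for n
  define f where "f n = real (wcount X (rescale P Y s) n)" for n
  define All where "All = (\<Pi>\<^sub>E x\<in>Y. {..<P})"
  define w where "w R = wt s (digits_mset Y R)" for R
  have finAll: "finite All" unfolding All_def using Y by (auto intro: finite_PiE)
  have "{..<P} \<noteq> {}" using P by auto
  then have cardAll: "card All \<noteq> 0" using finAll by (simp add: All_def PiE_eq_empty_iff)
  have Apos: "A n > 0" for n using wcount_pos[OF g x0] by (simp add: A_def)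
  have ratioA: "(\<lambda>n. A n / A (Suc n)) \<longlonglongrightarrow> 1" using ratio by (simp add: A_def)
  have g': "graded X (rescale P Y s)" by (rule graded_rescale[OF g P])
  have le: "wcount X (rescale P Y s) n \<le> wcount X s n" for n
  proof -
    have "blowup P Y ` wmsets X (rescale P Y s) n \<subseteq> wmsets X s n"
      using set_blowup[OF P, of Y] by (auto simp: wmsets_def wt_blowup)
    moreover have "inj_on (blowup P Y) (wmsets X (rescale P Y s) n)"
    proof (rule inj_onI)
      fix N N' assume "blowup P Y N = blowup P Y N'"
      then show "N = N'" by (rule blowup_inject[OF P])
    qed
    ultimately show ?thesis
      unfolding wcount_def using finite_wmsets[OF g] by (meson card_inj_on_le)
  qed
  have step: "(\<lambda>n. (f n - f (n - s x)) / A n) \<longlonglongrightarrow> 0"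
    if x: "x \<in> X - Y" "dsum_small X (rescale P Y s) (s x)" for x
  proof -
    have sx: "rescale P Y s x = s x" using x by (simp add: rescale_def)
    have "(\<lambda>n. real (wcount (X - {x}) (rescale P Y s) n) / real (wcount X s n)) \<longlonglongrightarrow> 0"
      by (rule wcount_remove_negligible[OF g']) (use x sx le wcount_mono[OF g x0] in auto)
    moreover have "eventually (\<lambda>n. real (wcount (X - {x}) (rescale P Y s) n) / real (wcount X s n) =
        (f n - f (n - s x)) / A n) sequentially"
      using eventually_ge_at_top[of "s x"]
    proof eventually_elim
      case (elim n)
      then show ?case
        using wcount_remove[OF g', of x n] x sx by (simp add: f_def A_def)
    qed
    ultimately show ?thesis by (rule Lim_transform_eventually)
  qed
  define q where "q = s x1"
  \<comment> \<open>Shifts by \<open>q\<close> and by \<open>q + 1\<close> change \<open>f\<close>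
    by a negligible amount. Both are applied at n + q, and their difference is a shift by one; the
    ratio limit of \<open>A\<close> brings the denominator back to \<open>A n\<close>.\<close>
  have shift1: "(\<lambda>n. (f n - f (n - 1)) / A n) \<longlonglongrightarrow> 0"
  proof -
    have 1: "(\<lambda>n. (f (n + q) - f n) / A (n + q)) \<longlonglongrightarrow> 0"
      using LIMSEQ_ignore_initial_segment[OF step[OF x1(1) small(1)], of q] by (simp add: q_def)
    have 2: "(\<lambda>n. (f (n + q) - f (n - 1)) / A (n + q)) \<longlonglongrightarrow> 0"
    proof -
      have "n + q - Suc q = n - 1" for n by simp
      then show ?thesis
        using LIMSEQ_ignore_initial_segment[OF step[OF x1(2) small(2)], of q] x1(3) by (simp add: q_def)
    qed
    have "(\<lambda>n. A n / A (n + q)) \<longlonglongrightarrow> 1 ^ q" by (rule ratio_tendsto_plus[OF ratioA]) simp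
    then have 3: "(\<lambda>n. inverse (A n / A (n + q))) \<longlonglongrightarrow> 1"
      using tendsto_inverse by fastforce
    have lim: "(\<lambda>n. ((f (n + q) - f (n - 1)) / A (n + q) - (f (n + q) - f n) / A (n + q)) * inverse (A n / A (n + q)))
        \<longlonglongrightarrow> (0 - 0) * 1"
      by (intro tendsto_mult tendsto_diff 1 2 3)
    have eq: "((f (n + q) - f (n - 1)) / A (n + q) - (f (n + q) - f n) / A (n + q)) * inverse (A n / A (n + q)) =
        (f n - f (n - 1)) / A n" for n
      using Apos[of n] Apos[of "n + q"] by (simp add: diff_divide_distrib[symmetric])
    show ?thesis using lim unfolding eq by simp
  qed
  have shift: "(\<lambda>n. (f n - f (n - k)) / A n) \<longlonglongrightarrow> 0" for k
  proof (induction k)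
    case (Suc k)
    have lim: "(\<lambda>n. (f n - f (n - 1)) / A n * (A n / A (n + k))) \<longlonglongrightarrow> 0 * 1 ^ k"
      by (intro tendsto_mult shift1 ratio_tendsto_plus[OF ratioA]) simp
    have eq: "(f n - f (n - 1)) / A n * (A n / A (n + k)) = (f (n + k - k) - f (n + k - Suc k)) / A (n + k)" for n
      using Apos[of n] by simp
    have "(\<lambda>n. (f (n + k - k) - f (n + k - Suc k)) / A (n + k)) \<longlonglongrightarrow> 0"
      using lim unfolding eq by simp
    then have "(\<lambda>n. (f (n - k) - f (n - Suc k)) / A n) \<longlonglongrightarrow> 0"
      by (rule LIMSEQ_offset)
    from tendsto_add[OF Suc this] show ?case by (simp add: add_divide_distrib[symmetric])
  qed simp
  define W where "W = Max (insert 0 (w ` All))"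
  have W: "w R \<le> W" if "R \<in> All" for R unfolding W_def using finAll that by simp
  have sumeq: "real (card {M \<in> wmsets X s n. restrict (\<lambda>x. count M x mod P) Y \<in> H}) = (\<Sum>R\<in>H. f (n - w R))"
    if "H \<subseteq> All" "W \<le> n" for H n
  proof -
    have "w R \<le> n" if "R \<in> H" for R using W that \<open>H \<subseteq> All\<close> \<open>W \<le> n\<close> by (meson order_trans subsetD)
    then have "(\<Sum>R\<in>H. if w R \<le> n then wcount X (rescale P Y s) (n - w R) else 0) =
        (\<Sum>R\<in>H. wcount X (rescale P Y s) (n - w R))"
      by (intro sum.cong) auto
    then show ?thesis
      using card_residues[OF g Y P, of H n] that unfolding f_def w_def All_def by simp
  qed
  \<comment> \<open>The values \<open>f (n - w R)\<close> add up to \<open>A n\<close> over all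
    residue vectors, and each differs negligibly from \<open>f n\<close>. So \<open>f n\<close> is
    asymptotically \<open>A n / card All\<close>.\<close>
  have fA: "(\<lambda>n. f n / A n) \<longlonglongrightarrow> 1 / real (card All)"
  proof -
    have "(\<lambda>n. (1 + (\<Sum>R\<in>All. (f n - f (n - w R)) / A n)) / real (card All)) \<longlonglongrightarrow> (1 + (\<Sum>R\<in>All. 0)) / real (card All)"
      by (intro tendsto_intros shift) (use cardAll in simp)
    then have lim: "(\<lambda>n. (1 + (\<Sum>R\<in>All. (f n - f (n - w R)) / A n)) / real (card All)) \<longlonglongrightarrow> 1 / real (card All)"
      by simp
    have "eventually (\<lambda>n. (1 + (\<Sum>R\<in>All. (f n - f (n - w R)) / A n)) / real (card All) = f n / A n) sequentially"
      using eventually_ge_at_top[of W]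
    proof eventually_elim
      case (elim n)
      have "{M \<in> wmsets X s n. restrict (\<lambda>x. count M x mod P) Y \<in> All} = wmsets X s n"
        using P by (auto simp: All_def)
      then have "A n = (\<Sum>R\<in>All. f (n - w R))"
        using sumeq[of All n] elim by (simp add: A_def wcount_def)
      then have "(\<Sum>R\<in>All. (f n - f (n - w R)) / A n) = real (card All) * (f n / A n) - 1"
        using Apos[of n] by (simp add: sum_divide_distrib[symmetric] sum_subtractf diff_divide_distrib)
      then show ?case using cardAll by simp
    qed
    with lim show ?thesis by (rule Lim_transform_eventually)
  qed
  have "(\<lambda>n. f n / A n - (f n - f (n - k)) / A n) \<longlonglongrightarrow> 1 / real (card All) - 0" for k
    by (intro tendsto_diff fA shift)
  then have fk: "(\<lambda>n. f (n - k) / A n) \<longlonglongrightarrow> 1 / real (card All)" for k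
    by (simp add: diff_divide_distrib[symmetric])
  have "(\<lambda>n. \<Sum>R\<in>G. f (n - w R) / A n) \<longlonglongrightarrow> (\<Sum>R\<in>G. 1 / real (card All))"
    by (intro tendsto_sum fk)
  then have "(\<lambda>n. (\<Sum>R\<in>G. f (n - w R)) / A n) \<longlonglongrightarrow> real (card G) / real (card All)"
    by (simp add: sum_divide_distrib)
  moreover have "eventually (\<lambda>n. (\<Sum>R\<in>G. f (n - w R)) / A n =
      real (card {M \<in> wmsets X s n. restrict (\<lambda>x. count M x mod P) Y \<in> G}) / real (wcount X s n)) sequentially"
    using eventually_ge_at_top[of W]
  proof eventually_elim
    case (elim n)
    then show ?case using sumeq[of G n] G by (simp add: A_def All_def)
  qed
  ultimately show ?thesis unfolding All_def by (rule Lim_transform_eventually)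
qed

section \<open>Splitting off finitely many parts\<close>

lemma wmsets_split:
  assumes "Y \<subseteq> X"
  shows "bij_betw (\<lambda>(M, N). M + N) (SIGMA M : (\<Union>k\<le>n. wmsets Y s k \<inter> V). wmsets (X - Y) s (n - wt s M))
    {M \<in> wmsets X s n. filter_mset (\<lambda>x. x \<in> Y) M \<in> V}"
proof (rule bij_betw_byWitness[of _ "\<lambda>M. (filter_mset (\<lambda>x. x \<in> Y) M, filter_mset (\<lambda>x. x \<notin> Y) M)"])
  have filt: "filter_mset (\<lambda>x. x \<in> Y) (M + N) = M" "filter_mset (\<lambda>x. x \<notin> Y) (M + N) = N"
    if "set_mset M \<subseteq> Y" "set_mset N \<subseteq> X - Y" for M N
  proof -
    have "filter_mset (\<lambda>x. x \<in> Y) M = M" "filter_mset (\<lambda>x. x \<in> Y) N = {#}"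
      "filter_mset (\<lambda>x. x \<notin> Y) M = {#}" "filter_mset (\<lambda>x. x \<notin> Y) N = N"
      using that by (auto simp: filter_mset_eq_conv filter_mset_eq_mempty_iff)
    then show "filter_mset (\<lambda>x. x \<in> Y) (M + N) = M" "filter_mset (\<lambda>x. x \<notin> Y) (M + N) = N"
      by simp_all
  qed
  show "\<forall>a\<in>SIGMA M : (\<Union>k\<le>n. wmsets Y s k \<inter> V). wmsets (X - Y) s (n - wt s M).
      (\<lambda>M. (filter_mset (\<lambda>x. x \<in> Y) M, filter_mset (\<lambda>x. x \<notin> Y) M)) ((\<lambda>(M, N). M + N) a) = a"
    using filt by (auto simp: wmsets_def simp del: filter_union_mset)
  show "\<forall>M\<in>{M \<in> wmsets X s n. filter_mset (\<lambda>x. x \<in> Y) M \<in> V}.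
      (\<lambda>(M, N). M + N) (filter_mset (\<lambda>x. x \<in> Y) M, filter_mset (\<lambda>x. x \<notin> Y) M) = M"
    using multiset_partition by auto
  show "(\<lambda>(M, N). M + N) ` (SIGMA M : (\<Union>k\<le>n. wmsets Y s k \<inter> V). wmsets (X - Y) s (n - wt s M))
      \<subseteq> {M \<in> wmsets X s n. filter_mset (\<lambda>x. x \<in> Y) M \<in> V}"
  proof (rule image_subsetI, clarify, intro conjI)
    fix M N k assume MN: "M \<in> wmsets Y s k" "M \<in> V" "k \<le> n" "N \<in> wmsets (X - Y) s (n - wt s M)"
    then have sub: "set_mset M \<subseteq> Y" "set_mset N \<subseteq> X - Y" by (auto simp: wmsets_def)
    then have "set_mset (M + N) \<subseteq> X" using assms by auto
    then show "M + N \<in> wmsets X s n" using MN by (auto simp: wmsets_def)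
    show "filter_mset (\<lambda>x. x \<in> Y) (M + N) \<in> V" unfolding filt(1)[OF sub] by (rule MN(2))
  qed
  show "(\<lambda>M. (filter_mset (\<lambda>x. x \<in> Y) M, filter_mset (\<lambda>x. x \<notin> Y) M)) ` {M \<in> wmsets X s n. filter_mset (\<lambda>x. x \<in> Y) M \<in> V}
      \<subseteq> (SIGMA M : (\<Union>k\<le>n. wmsets Y s k \<inter> V). wmsets (X - Y) s (n - wt s M))"
  proof (rule image_subsetI, intro SigmaI)
    fix M assume "M \<in> {M \<in> wmsets X s n. filter_mset (\<lambda>x. x \<in> Y) M \<in> V}"
    then have M: "M \<in> wmsets X s n" "filter_mset (\<lambda>x. x \<in> Y) M \<in> V" by auto
    have sum: "wt s (filter_mset (\<lambda>x. x \<in> Y) M) + wt s (filter_mset (\<lambda>x. x \<notin> Y) M) = n"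
      using M(1) multiset_partition[of M "\<lambda>x. x \<in> Y"] by (metis (mono_tags, lifting) mem_Collect_eq wmsets_def wt_simps(3))
    then show "filter_mset (\<lambda>x. x \<in> Y) M \<in> (\<Union>k\<le>n. wmsets Y s k \<inter> V)"
      using M(2) by (auto simp: wmsets_def)
    show "filter_mset (\<lambda>x. x \<notin> Y) M \<in> wmsets (X - Y) s (n - wt s (filter_mset (\<lambda>x. x \<in> Y) M))"
      using M(1) sum by (auto simp: wmsets_def)
  qed
qed

text \<open>The part inside \<open>Y\<close> and the rest are independent except for the total
  weight, hence the convolution. The set \<open>V\<close> is arbitrary, so that it can later be
  taken as the set of low parts that make a sentence true.\<close>

lemma card_split:
  assumes g: "graded X s" and "Y \<subseteq> X"
  shows "card {M \<in> wmsets X s n. filter_mset (\<lambda>x. x \<in> Y) M \<in> V} =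
    (\<Sum>k\<le>n. card (wmsets Y s k \<inter> V) * wcount (X - Y) s (n - k))"
proof -
  have fin: "finite (wmsets Y s k)" for k
    by (rule finite_wmsets[OF graded_subset[OF g assms(2)]])
  have fin': "finite (wmsets (X - Y) s k)" for k
    by (rule finite_wmsets[OF graded_subset[OF g]]) auto
  have "card {M \<in> wmsets X s n. filter_mset (\<lambda>x. x \<in> Y) M \<in> V} =
      card (SIGMA M : (\<Union>k\<le>n. wmsets Y s k \<inter> V). wmsets (X - Y) s (n - wt s M))"
    using bij_betw_same_card[OF wmsets_split[OF assms(2)]] by metis
  also have "\<dots> = (\<Sum>M\<in>(\<Union>k\<le>n. wmsets Y s k \<inter> V). wcount (X - Y) s (n - wt s M))"
    using fin fin' by (subst card_SigmaI) (auto simp: wcount_def)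
  also have "\<dots> = (\<Sum>k\<le>n. \<Sum>M\<in>wmsets Y s k \<inter> V. wcount (X - Y) s (n - wt s M))"
    using fin by (intro sum.UNION_disjoint) (auto simp: wmsets_def)
  also have "\<dots> = (\<Sum>k\<le>n. card (wmsets Y s k \<inter> V) * wcount (X - Y) s (n - k))"
    by (intro sum.cong refl) (simp add: wmsets_def)
  finally show ?thesis .
qed

text \<open>A multiset is determined by its multiplicities on \<open>Y\<close>, and none of them
  exceeds the weight. A polynomial bound is strong enough against the exponential growth at
  \<open>\<epsilon>\<^sub>0\<close>.\<close>

lemma wcount_finite_le:
  assumes "finite Y" "graded Y s"
  shows "wcount Y s k \<le> (k + 1) ^ card Y"
proof -
  have "(\<lambda>M. restrict (count M) Y) ` wmsets Y s k \<subseteq> (\<Pi>\<^sub>E x\<in>Y. {..k})"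
  proof (rule image_subsetI)
    fix M assume M: "M \<in> wmsets Y s k"
    have "count M x \<le> k" for x
      using count_le_size[of M x] size_le_wt[of M s] M assms(2)
      by (force simp: wmsets_def graded_def)
    then show "restrict (count M) Y \<in> (\<Pi>\<^sub>E x\<in>Y. {..k})" by auto
  qed
  moreover have "inj_on (\<lambda>M. restrict (count M) Y) (wmsets Y s k)"
  proof (rule inj_onI)
    fix M N assume MN: "M \<in> wmsets Y s k" "N \<in> wmsets Y s k" "restrict (count M) Y = restrict (count N) Y"
    have "count M x = count N x" for x
    proof (cases "x \<in> Y")
      case True
      then show ?thesis using MN(3) by (metis restrict_apply')
    next
      case False
      then have "x \<notin># M" "x \<notin># N" using MN by (auto simp: wmsets_def)
      then show ?thesis by (simp add: not_in_iff)
    qed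
    then show "M = N" by (rule multiset_eqI)
  qed
  ultimately have "wcount Y s k \<le> card (\<Pi>\<^sub>E x\<in>Y. {..k})"
    unfolding wcount_def using assms(1) by (intro card_inj_on_le) (auto intro: finite_PiE)
  also have "\<dots> = (k + 1) ^ card Y" using assms(1) by (simp add: card_PiE)
  finally show ?thesis .
qed

text \<open>Removing a part \<open>y\<close> multiplies the limit by 1 - \<rho>^(s y), according to
  the factor 1 - z^(s y) of the generating function.\<close>

lemma wcount_remove_ratio:
  assumes g: "graded X s" and "finite Y" "Y \<subseteq> X"
    and ratio: "(\<lambda>n. real (wcount X s n) / real (wcount X s (Suc n))) \<longlonglongrightarrow> \<rho>" "\<rho> > 0"
  shows "\<exists>b. (\<lambda>n. real (wcount (X - Y) s n) / real (wcount X s n)) \<longlonglongrightarrow> b"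
  using assms(2,3)
proof (induction Y rule: finite_induct)
  case empty
  have "eventually (\<lambda>n. real (wcount X s n) / real (wcount X s (Suc n)) > 0) sequentially"
    using ratio by (rule order_tendstoD)
  then have "eventually (\<lambda>n. real (wcount (X - {}) s n) / real (wcount X s n) = 1) sequentially"
    by eventually_elim (auto simp: zero_less_divide_iff)
  then show ?case by (intro exI[of _ 1] tendsto_eventually)
next
  case (insert y Y)
  then obtain b where b: "(\<lambda>n. real (wcount (X - Y) s n) / real (wcount X s n)) \<longlonglongrightarrow> b" by auto
  have g': "graded (X - Y) s" by (rule graded_subset[OF g]) auto
  have y: "y \<in> X - Y" using insert by auto
  define k where "k = s y"
  have "(\<lambda>n. real (wcount (X - Y) s n) / real (wcount X s n) * (real (wcount X s n) / real (wcount X s (n + k)))) \<longlonglongrightarrow> b * \<rho> ^ k"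
    by (intro tendsto_mult b ratio_tendsto_plus[OF ratio])
  moreover have "eventually (\<lambda>n. real (wcount X s n) / real (wcount X s (Suc n)) > 0) sequentially"
    using ratio by (rule order_tendstoD)
  then have "eventually (\<lambda>n. real (wcount (X - Y) s n) / real (wcount X s n) * (real (wcount X s n) / real (wcount X s (n + k)))
      = real (wcount (X - Y) s (n + k - k)) / real (wcount X s (n + k))) sequentially"
    by eventually_elim (auto simp: zero_less_divide_iff)
  ultimately have "(\<lambda>n. real (wcount (X - Y) s (n + k - k)) / real (wcount X s (n + k))) \<longlonglongrightarrow> b * \<rho> ^ k"
    by (rule Lim_transform_eventually)
  then have "(\<lambda>n. real (wcount (X - Y) s (n - k)) / real (wcount X s n)) \<longlonglongrightarrow> b * \<rho> ^ k"
    by (rule LIMSEQ_offset)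
  with b have "(\<lambda>n. real (wcount (X - Y) s n) / real (wcount X s n) - real (wcount (X - Y) s (n - k)) / real (wcount X s n))
      \<longlonglongrightarrow> b - b * \<rho> ^ k"
    by (rule tendsto_diff)
  moreover have "eventually (\<lambda>n. real (wcount (X - Y) s n) / real (wcount X s n) - real (wcount (X - Y) s (n - k)) / real (wcount X s n)
      = real (wcount (X - insert y Y) s n) / real (wcount X s n)) sequentially"
    using eventually_ge_at_top[of k]
  proof eventually_elim
    case (elim n)
    have "X - Y - {y} = X - insert y Y" by auto
    then have "wcount (X - Y) s n = wcount (X - insert y Y) s n + wcount (X - Y) s (n - k)"
      using wcount_remove[OF g' y, of n] elim by (simp add: k_def)
    then show ?case by (simp add: diff_divide_distrib[symmetric])
  qed
  ultimately show ?case by (intro exI) (rule Lim_transform_eventually)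
qed

text \<open>Deleting one chosen element is injective if the element is remembered. At
  \<open>\<epsilon>\<^sub>0\<close>, where the parts are counted by the same sequence, this becomes
  a recursion of Catalan type.\<close>

lemma wcount_first_part:
  assumes g: "graded X s"
  shows "wcount X s (Suc n) \<le> (\<Sum>k\<le>n. pcount X s (Suc k) * wcount X s (n - k))"
proof -
  define c where "c M = (SOME x. x \<in># M)" for M :: "'a multiset"
  have c: "c M \<in># M" if "M \<in> wmsets X s (Suc n)" for M
  proof -
    have "M \<noteq> {#}" using that by (auto simp: wmsets_def)
    then show ?thesis unfolding c_def by (metis multiset_nonemptyE someI_ex)
  qed
  define T where "T = (SIGMA k : {..n}. {x\<in>X. s x = Suc k} \<times> wmsets X s (n - k))"
  have finT: "finite T" unfolding T_def
  proof (intro finite_SigmaI finite_cartesian_product finite_wmsets[OF g])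
    fix k show "finite {x\<in>X. s x = Suc k}"
      by (rule finite_subset[of _ "{x\<in>X. s x \<le> Suc k}"]) (use g in \<open>auto simp: graded_def\<close>)
  qed simp
  have "(\<lambda>M. (s (c M) - 1, c M, M - {#c M#})) ` wmsets X s (Suc n) \<subseteq> T"
  proof (rule image_subsetI)
    fix M assume M: "M \<in> wmsets X s (Suc n)"
    obtain N where N: "M = add_mset (c M) N" using multi_member_split[OF c[OF M]] by blast
    have "set_mset M \<subseteq> X" "wt s M = Suc n" using M by (auto simp: wmsets_def)
    then have "c M \<in> X" "s (c M) + wt s N = Suc n" "set_mset N \<subseteq> X" "M - {#c M#} = N"
      using N by (metis insert_subset set_mset_add_mset_insert, metis wt_simps(2),
        metis insert_subset set_mset_add_mset_insert, metis add_mset_remove_trivial)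
    moreover have "0 < s (c M)" using g \<open>c M \<in> X\<close> by (auto simp: graded_def)
    ultimately show "(s (c M) - 1, c M, M - {#c M#}) \<in> T"
      by (auto simp: T_def wmsets_def)
  qed
  moreover have "inj_on (\<lambda>M. (s (c M) - 1, c M, M - {#c M#})) (wmsets X s (Suc n))"
  proof (rule inj_onI)
    fix M N assume MN: "M \<in> wmsets X s (Suc n)" "N \<in> wmsets X s (Suc n)"
      "(s (c M) - 1, c M, M - {#c M#}) = (s (c N) - 1, c N, N - {#c N#})"
    then show "M = N" using c[OF MN(1)] c[OF MN(2)] by (metis insert_DiffM prod.inject)
  qed
  ultimately have "wcount X s (Suc n) \<le> card T"
    unfolding wcount_def using finT by (intro card_inj_on_le)
  also have "card T = (\<Sum>k\<le>n. pcount X s (Suc k) * wcount X s (n - k))"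
    unfolding T_def
  proof (subst card_SigmaI)
    show "\<forall>a\<in>{..n}. finite ({x \<in> X. s x = Suc a} \<times> wmsets X s (n - a))"
    proof (intro ballI finite_cartesian_product finite_wmsets[OF g])
      fix k show "finite {x\<in>X. s x = Suc k}"
        by (rule finite_subset[of _ "{x\<in>X. s x \<le> Suc k}"]) (use g in \<open>auto simp: graded_def\<close>)
    qed
  qed (simp_all add: card_cartesian_product pcount_def wcount_def)
  finally show ?thesis .
qed

section \<open>Ratio limit for the number of rooted trees\<close>

unbundle no vec_syntax
unbundle fps_syntax

text \<open>Read as trees whose subtrees at the root are the exponents, ordinals of norm n are
  rooted trees with n + 1 vertices, and \<open>c n\<close> is their number. \<open>rec\<close> is
  then Polya's recursion, and \<open>catalan\<close> compares with plane trees to show that the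
  radius of convergence is positive.\<close>

locale otter =
  fixes c :: "nat \<Rightarrow> real"
  assumes c_0: "c 0 = 1" and c_pos: "c n > 0"
    and rec: "real n * c n = (\<Sum>k=1..n. (\<Sum>d | d dvd k. real d * c (d - 1)) * c (n - k))"
    and catalan: "c (Suc n) \<le> (\<Sum>k\<le>n. c k * c (n - k))"
begin

section \<open>Exponential growth rate\<close>

lemma c_nonneg: "c n \<ge> 0"
  using c_pos[of n] by simp

text \<open>The constants come from y = 1 + z y^2: at z = 1/4 the value y = 2 is a fixed point, so
  the bound 2 on the partial sums reproduces itself.\<close>

lemma sum_c_le: "(\<Sum>n\<le>N. c n * (1 / 4) ^ n) \<le> 2"
proof (induction N)
  case 0
  then show ?case by (simp add: c_0)
next
  case (Suc N)
  define g where "g n = c n * (1 / 4) ^ n" for n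
  have g: "g n \<ge> 0" for n by (simp add: g_def c_nonneg)
  have "(\<Sum>n\<le>N. \<Sum>k\<le>n. g k * g (n - k)) = (\<Sum>(i, j)\<in>{(i, j). i + j \<le> N}. g i * g j)"
    by (rule sum.triangle_reindex_eq[symmetric])
  also have "\<dots> \<le> (\<Sum>(i, j)\<in>{..N} \<times> {..N}. g i * g j)"
    by (rule sum_mono2) (auto simp: g)
  also have "\<dots> = (\<Sum>n\<le>N. g n) * (\<Sum>n\<le>N. g n)"
    by (simp add: sum_product sum.cartesian_product)
  also have "\<dots> \<le> 2 * 2"
    using Suc by (intro mult_mono sum_nonneg g) (auto simp: g_def)
  finally have le4: "(\<Sum>n\<le>N. \<Sum>k\<le>n. g k * g (n - k)) \<le> 4" by simp
  have "g (Suc n) \<le> 1 / 4 * (\<Sum>k\<le>n. g k * g (n - k))" for n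
  proof -
    have "g (Suc n) \<le> (\<Sum>k\<le>n. c k * c (n - k)) * (1 / 4) ^ Suc n"
      unfolding g_def by (intro mult_right_mono catalan) auto
    also have "\<dots> = 1 / 4 * (\<Sum>k\<le>n. c k * c (n - k) * (1 / 4) ^ n)"
      by (simp add: sum_distrib_right)
    also have "(\<Sum>k\<le>n. c k * c (n - k) * (1 / 4) ^ n) = (\<Sum>k\<le>n. g k * g (n - k))"
    proof (intro sum.cong refl)
      fix k assume "k \<in> {..n}"
      then have "(1 / 4 :: real) ^ n = (1 / 4) ^ k * (1 / 4) ^ (n - k)" by (simp flip: power_add)
      then show "c k * c (n - k) * (1 / 4) ^ n = g k * g (n - k)" by (simp add: g_def)
    qed
    finally show ?thesis .
  qed
  then have "(\<Sum>n\<le>N. g (Suc n)) \<le> (\<Sum>n\<le>N. 1 / 4 * (\<Sum>k\<le>n. g k * g (n - k)))"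
    by (rule sum_mono)
  also have "\<dots> \<le> 1 / 4 * 4"
    unfolding sum_distrib_left[symmetric] using le4 by (intro mult_left_mono) auto
  finally have "(\<Sum>n\<le>N. g (Suc n)) \<le> 1" by simp
  moreover have "(\<Sum>n\<le>Suc N. g n) = g 0 + (\<Sum>n\<le>N. g (Suc n))"
    by (rule sum.atMost_Suc_shift)
  moreover have "g 0 = 1" by (simp add: g_def c_0)
  ultimately show ?case by (simp add: g_def)
qed

lemma c_le: "c n \<le> 2 * 4 ^ n"
proof -
  have "c n * (1 / 4) ^ n \<le> (\<Sum>n\<le>n. c n * (1 / 4) ^ n)"
    by (rule member_le_sum[of n "{..n}" "\<lambda>n. c n * (1 / 4) ^ n"]) (auto simp: c_nonneg)
  also have "\<dots> \<le> 2" by (rule sum_c_le)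
  finally show ?thesis by (simp add: field_simps)
qed

definition sg :: "nat \<Rightarrow> real" where
  "sg k = (\<Sum>d | d dvd k. real d * c (d - 1))"

lemma sg_ge: "0 < k \<Longrightarrow> real k * c (k - 1) \<le> sg k"
  unfolding sg_def by (rule member_le_sum[of k "{d. d dvd k}" "\<lambda>d. real d * c (d - 1)"])
    (auto simp: c_nonneg)

text \<open>For n = i + j + 1 and j \<le> i only the term k = i + 1 of the recursion is kept, and in
  it only the divisor k itself. As i + 1 is at least n / 2, a factor 2 is lost.\<close>

lemma c_supermult: "c i * c j / 2 \<le> c (i + j + 1)"
proof -
  have *: "c i * c j / 2 \<le> c (i + j + 1)" if "j \<le> i" for i j
  proof -
    define n where "n = i + j + 1"
    have sg0: "0 \<le> sg k" for k unfolding sg_def by (intro sum_nonneg mult_nonneg_nonneg c_nonneg) auto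
    have "real n / 2 * (c i * c j) \<le> real (i + 1) * c i * c j"
    proof -
      have "real n / 2 \<le> real (i + 1)" using that by (simp add: n_def)
      then have "real n / 2 * (c i * c j) \<le> real (i + 1) * (c i * c j)"
        by (intro mult_right_mono mult_nonneg_nonneg c_nonneg)
      then show ?thesis by (simp add: mult.assoc)
    qed
    also have "\<dots> \<le> sg (i + 1) * c (n - (i + 1))"
      using sg_ge[of "i + 1"] c_nonneg[of j] by (simp add: n_def mult_right_mono)
    also have "\<dots> \<le> (\<Sum>k=1..n. sg k * c (n - k))"
      by (rule member_le_sum[of "i + 1" "{1..n}" "\<lambda>k. sg k * c (n - k)"])
        (auto simp: n_def sg0 c_nonneg)
    also have "\<dots> = real n * c n" using rec[of n] by (simp add: sg_def)
    finally have "real n * (c i * c j / 2) \<le> real n * c n" by simp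
    then show ?thesis by (simp add: n_def)
  qed
  show ?thesis
  proof (cases "j \<le> i")
    case True
    then show ?thesis by (rule *)
  next
    case False
    then have "i \<le> j" by simp
    from *[OF this] show ?thesis by (simp add: ac_simps)
  qed
qed

text \<open>The shift and the factor 1/2 turn \<open>c_supermult\<close> into exact
  supermultiplicativity at positive arguments, as required by Fekete's argument.\<close>

definition u :: "nat \<Rightarrow> real" where
  "u n = c (n - 1) / 2"

lemma u_pos: "u n > 0"
  by (simp add: u_def c_pos)

lemma u_supermult: "1 \<le> a \<Longrightarrow> 1 \<le> b \<Longrightarrow> u a * u b \<le> u (a + b)"
proof -
  assume "1 \<le> a" "1 \<le> b"
  then have eq: "a - 1 + (b - 1) + 1 = a + b - 1" by simp
  show ?thesis using c_supermult[of "a - 1" "b - 1", unfolded eq] by (simp add: u_def)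
qed

text \<open>The growth rate of \<open>c\<close> in the form of Fekete's lemma, so 1 / \<mu> is the
  radius of convergence of T.\<close>

definition \<mu> :: real where
  "\<mu> = (SUP n\<in>{1..}. root n (u n))"

lemma bdd_root_u: "bdd_above ((\<lambda>n. root n (u n)) ` {1..})"
proof (rule bdd_aboveI)
  fix x assume "x \<in> (\<lambda>n. root n (u n)) ` {1..}"
  then obtain n where n: "1 \<le> n" "x = root n (u n)" by auto
  have "u n \<le> 4 ^ (n - 1)" using c_le[of "n - 1"] by (simp add: u_def)
  also have "\<dots> \<le> 4 ^ n" by (rule power_increasing) auto
  finally have "root n (u n) \<le> root n (4 ^ n)" using n(1) by simp
  also have "\<dots> = 4" using n(1) by (simp add: real_root_power_cancel)
  finally show "x \<le> 4" using n(2) by simp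
qed

lemma u_le: "1 \<le> n \<Longrightarrow> u n \<le> \<mu> ^ n"
proof -
  assume n: "1 \<le> n"
  have "root n (u n) \<le> \<mu>" unfolding \<mu>_def using n by (intro cSUP_upper bdd_root_u) auto
  then have "root n (u n) ^ n \<le> \<mu> ^ n" using n u_pos[of n] by (intro power_mono) auto
  then show ?thesis using n u_pos[of n] by simp
qed

lemma u_power: "1 \<le> m \<Longrightarrow> 1 \<le> r \<Longrightarrow> u m ^ k * u r \<le> u (k * m + r)"
proof (induction k)
  case (Suc k)
  have "u m ^ Suc k * u r = u m * (u m ^ k * u r)" by simp
  also have "\<dots> \<le> u m * u (k * m + r)"
    using Suc u_pos[of m] by (intro mult_left_mono) auto
  also have "\<dots> \<le> u (m + (k * m + r))" using Suc.prems by (intro u_supermult) auto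
  finally show ?case by (simp add: ac_simps)
qed simp

text \<open>The harder half of Fekete's lemma: some \<open>u m\<close> exceeds \<nu>^m, and any n is
  cut into pieces of length \<open>m\<close> and one remainder. \<open>K\<close> is the worst case
  over the possible remainders.\<close>

lemma u_ge:
  assumes "0 < \<nu>" "\<nu> < \<mu>"
  obtains K where "K > 0" "\<And>n. 1 \<le> n \<Longrightarrow> K * \<nu> ^ n \<le> u n"
proof -
  obtain m where m: "1 \<le> m" "\<nu> < root m (u m)"
    using assms(2) unfolding \<mu>_def by (subst (asm) less_cSUP_iff[OF _ bdd_root_u]) auto
  have um: "\<nu> ^ m \<le> u m"
  proof -
    have "\<nu> ^ m \<le> root m (u m) ^ m" using m assms by (intro power_mono) auto
    then show ?thesis using m u_pos[of m] by simp
  qed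
  define K where "K = Min ((\<lambda>r. u r / \<nu> ^ r) ` {1..m})"
  have "K > 0" unfolding K_def using m(1) u_pos assms(1) by (subst Min_gr_iff) auto
  moreover have "K * \<nu> ^ n \<le> u n" if n: "1 \<le> n" for n
  proof -
    \<comment> \<open>Dividing n - 1 instead of n makes the remainder run through 1, ..., m, since
      supermultiplicativity holds only for positive arguments.\<close>
    define k where "k = (n - 1) div m"
    define r where "r = (n - 1) mod m + 1"
    have r: "1 \<le> r" "r \<le> m" using m(1) by (auto simp: r_def Suc_le_eq)
    have nkr: "n = k * m + r" using n by (simp add: k_def r_def)
    have "K \<le> u r / \<nu> ^ r" unfolding K_def using r by (intro Min_le) auto
    then have "K * \<nu> ^ r \<le> u r" using assms(1) by (simp add: field_simps)
    then have "(\<nu> ^ m) ^ k * (K * \<nu> ^ r) \<le> u m ^ k * u r"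
      using um assms(1) u_pos[of m] \<open>K > 0\<close> by (intro mult_mono power_mono) auto
    also have "\<dots> \<le> u n" unfolding nkr using m(1) r(1) by (rule u_power)
    finally show ?thesis unfolding nkr
      by (simp add: power_add power_mult[symmetric] mult.commute mult.left_commute)
  qed
  ultimately show thesis by (rule that)
qed

text \<open>The first value that forces growth: \<open>u 4\<close> is 2, whereas \<open>u 1\<close>,
  \<open>u 2\<close> and \<open>u 3\<close> are at most 1.\<close>

lemma c_3: "c 3 = 4"
proof -
  have d2: "{d::nat. d dvd 2} = {1, 2}"
  proof -
    have "d = 1 \<or> d = 2" if "d dvd 2" for d :: nat
    proof -
      have "d \<le> 2" using that by (auto dest: dvd_imp_le)
      then have "d = 0 \<or> d = 1 \<or> d = 2" by linarith
      then show ?thesis using that by auto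
    qed
    then show ?thesis by auto
  qed
  have d3: "{d::nat. d dvd 3} = {1, 3}"
  proof -
    have "d = 1 \<or> d = 3" if "d dvd 3" for d :: nat
    proof -
      have "d \<le> 3" using that by (auto dest: dvd_imp_le)
      then have "d = 0 \<or> d = 1 \<or> d = 2 \<or> d = 3" by linarith
      then show ?thesis using that by auto
    qed
    then show ?thesis by auto
  qed
  have s: "{1..1::nat} = {1}" "{1..2::nat} = {1, 2}" "{1..3::nat} = {1, 2, 3}" by auto
  have d1: "{d::nat. d dvd 1} = {1}" by auto
  have 1: "c 1 = 1" using rec[of 1] unfolding s d1 by (simp add: c_0)
  have 2: "2 * c 2 = 4" using rec[of 2] unfolding s sum.insert_if d2 using d1 d2 1 by (simp add: c_0)
  show ?thesis using rec[of 3] unfolding s using d1 d2 d3 1 2 by (simp add: c_0)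
qed

lemma \<mu>_gt_1: "\<mu> > 1"
proof (rule ccontr)
  assume "\<not> \<mu> > 1"
  have "2 \<le> \<mu> ^ 4" using u_le[of 4] by (simp add: u_def c_3)
  moreover have "0 \<le> \<mu>"
  proof -
    have "root 1 (u 1) \<le> \<mu>" unfolding \<mu>_def by (intro cSUP_upper bdd_root_u) auto
    then show ?thesis using u_pos[of 1] by simp
  qed
  then have "\<mu> ^ 4 \<le> 1" using \<open>\<not> \<mu> > 1\<close> by (intro power_le_one) auto
  ultimately show False by simp
qed

lemma c_le_\<mu>: "c n \<le> 2 * \<mu> ^ Suc n"
  using u_le[of "Suc n"] by (simp add: u_def)

subsection \<open>Generating functions\<close>

definition Cf :: "real fps" where "Cf = Abs_fps c"
definition Tf :: "real fps" where "Tf = fps_X * Cf"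
text \<open>Since C(z) is the exponential of the sum of T(z^k) / k over k \<ge> 1, this factor keeps
  exactly the terms with k \<ge> 2. They are the reason for its larger radius of
  convergence.\<close>

definition Qf :: "real fps" where "Qf = Cf * (fps_exp (-1) oo Tf)"
definition Gf :: "real fps" where "Gf = fps_X * fps_exp (-1)"
definition Ff :: "real fps" where "Ff = fps_inv Gf"
definition Wf :: "real fps" where "Wf = fps_X * Qf"

lemma Tf_nth: "Tf $ n = (if n = 0 then 0 else c (n - 1))"
  by (simp add: Tf_def Cf_def)

text \<open>W = T exp(-T) is the composition of \<open>Gf\<close> with T, and \<open>Ff\<close>
  inverts \<open>Gf\<close>.\<close>

lemma Ff_compose_Wf: "Ff oo Wf = Tf"
proof -
  have T0: "Tf $ 0 = 0" by (simp add: Tf_nth)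
  have "Wf = Tf * (fps_exp (-1) oo Tf)" by (simp add: Wf_def Qf_def Tf_def mult.assoc)
  also have "\<dots> = Gf oo Tf"
    unfolding Gf_def by (simp add: fps_compose_mult_distrib[OF T0] T0)
  finally have W: "Wf = Gf oo Tf" .
  have "Ff oo (Gf oo Tf) = Ff oo Gf oo Tf"
    by (rule fps_compose_assoc[OF T0]) (simp add: Gf_def)
  also have "Ff oo Gf = fps_X" unfolding Ff_def by (rule fps_inv) (simp_all add: Gf_def)
  finally show ?thesis using W T0 by simp
qed

text \<open>With E = exp(F) one has F = z E and E' = E F'. Comparing coefficients gives a recursion
  for E without negative terms.\<close>

lemma Ff_nonneg: "Ff $ n \<ge> 0"
proof -
  define E where "E = fps_exp 1 oo Ff"
  have F0: "Ff $ 0 = 0" by (simp add: Ff_def fps_inv_def)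
  have "Gf oo Ff = fps_X" unfolding Ff_def by (rule fps_inv_right) (simp_all add: Gf_def)
  then have 1: "Ff * (fps_exp (-1) oo Ff) = fps_X"
    unfolding Gf_def by (simp add: fps_compose_mult_distrib[OF F0] F0)
  have "(fps_exp (-1) oo Ff) * E = (fps_exp (-1) * fps_exp 1) oo Ff"
    unfolding E_def by (simp add: fps_compose_mult_distrib[OF F0])
  also have "fps_exp (-1) * fps_exp 1 = (1 :: real fps)"
    by (simp flip: fps_exp_add_mult)
  finally have "(fps_exp (-1) oo Ff) * E = 1" by simp
  with 1 have FE: "Ff = fps_X * E" by (metis mult.assoc mult.right_neutral)
  have FSuc: "Ff $ Suc j = E $ j" for j by (subst FE) simp
  have E': "fps_deriv E = E * fps_deriv Ff"
    unfolding E_def by (simp add: fps_compose_deriv[OF F0])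
  have Epos: "E $ n \<ge> 0" for n
  proof (induction n rule: less_induct)
    case (less n)
    show ?case
    proof (cases n)
      case 0
      then show ?thesis by (simp add: E_def)
    next
      case (Suc m)
      have "real (Suc m) * E $ Suc m = (\<Sum>i=0..m. E $ i * (real (Suc (m - i)) * E $ (m - i)))"
        using arg_cong[OF E', of "\<lambda>f. f $ m"] by (simp add: fps_mult_nth FSuc)
      also have "\<dots> \<ge> 0"
        using less Suc by (intro sum_nonneg mult_nonneg_nonneg) auto
      finally show ?thesis unfolding Suc by (simp add: zero_le_mult_iff)
    qed
  qed
  show ?thesis unfolding FE using Epos by simp
qed

definition proper_sg :: "nat \<Rightarrow> real" where
  "proper_sg n = (\<Sum>d\<in>{d. d dvd n} - {n}. real d * c (d - 1))"

lemma proper_sg_nonneg: "proper_sg n \<ge> 0"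
  unfolding proper_sg_def by (intro sum_nonneg mult_nonneg_nonneg c_nonneg) auto

lemma Qf_0: "Qf $ 0 = 1"
  by (simp add: Qf_def Cf_def c_0)

text \<open>Logarithmic derivative of Q = C exp(-T): subtracting z T' from z C' / C removes the
  divisor d = k from \<open>sg k\<close>.\<close>

lemma Qf_rec: "real n * Qf $ n = (\<Sum>k=1..n. proper_sg k * Qf $ (n - k))"
proof -
  have T0: "Tf $ 0 = 0" by (simp add: Tf_nth)
  define S where "S = Abs_fps (\<lambda>k. if k = 0 then 0 else sg k)"
  have S: "fps_X * fps_deriv Cf = S * Cf"
  proof (rule fps_ext)
    fix n
    have "(S * Cf) $ n = (\<Sum>k=0..n. (if k = 0 then 0 else sg k) * c (n - k))"
      by (simp add: fps_mult_nth S_def Cf_def)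
    also have "\<dots> = (\<Sum>k=1..n. sg k * c (n - k))"
      by (rule sum.mono_neutral_cong_right) auto
    also have "\<dots> = real n * c n" using rec[of n] by (simp add: sg_def)
    also have "\<dots> = (fps_X * fps_deriv Cf) $ n" by (cases n) (simp_all add: Cf_def)
    finally show "(fps_X * fps_deriv Cf) $ n = (S * Cf) $ n" by simp
  qed
  define R where "R = S - fps_X * fps_deriv Tf"
  have R: "R $ k = (if k = 0 then 0 else proper_sg k)" for k
  proof (cases "k = 0")
    case False
    have "sg k = real k * c (k - 1) + proper_sg k"
      unfolding sg_def proper_sg_def using False by (subst sum.remove[of _ k]) auto
    moreover obtain j where "k = Suc j" using False by (cases k) auto
    ultimately show ?thesis by (simp add: R_def S_def Tf_nth)
  qed (simp add: R_def S_def)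
  have "fps_X * fps_deriv Qf = R * Qf"
  proof -
    have "fps_deriv (fps_exp (-1) oo Tf) = - ((fps_exp (-1) oo Tf) * fps_deriv Tf)"
      by (simp add: fps_compose_deriv[OF T0] fps_compose_mult_distrib[OF T0] fps_const_neg[symmetric] fps_compose_uminus del: fps_const_neg)
    then have "fps_X * fps_deriv Qf =
        (fps_X * fps_deriv Cf) * (fps_exp (-1) oo Tf) - fps_X * fps_deriv Tf * Qf"
      unfolding Qf_def by (simp add: algebra_simps)
    also have "\<dots> = R * Qf" unfolding S R_def Qf_def by (simp add: algebra_simps)
    finally show ?thesis .
  qed
  then have "(fps_X * fps_deriv Qf) $ n = (\<Sum>k=0..n. (if k = 0 then 0 else proper_sg k) * Qf $ (n - k))"
    by (simp add: fps_mult_nth R)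
  also have "\<dots> = (\<Sum>k=1..n. proper_sg k * Qf $ (n - k))"
    by (rule sum.mono_neutral_cong_right) auto
  finally show ?thesis by (cases n) simp_all
qed

lemma Qf_nonneg: "Qf $ n \<ge> 0"
proof (induction n rule: less_induct)
  case (less n)
  show ?case
  proof (cases "n = 0")
    case False
    have "real n * Qf $ n \<ge> 0"
      unfolding Qf_rec using less by (intro sum_nonneg mult_nonneg_nonneg proper_sg_nonneg) auto
    then show ?thesis using False by (simp add: zero_le_mult_iff)
  qed (simp add: Qf_0)
qed

text \<open>The divisor 1 of n is proper from n = 2 on, whereas the coefficient at 1 vanishes. So W
  = z + z^3/2 + z^4/3 + ..., and 3 and 4 are the first two consecutive degrees that occur in
  it.\<close>

lemma Qf_pos: "2 \<le> n \<Longrightarrow> Qf $ n > 0"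
proof -
  assume n: "2 \<le> n"
  have "real 1 * c (1 - 1) \<le> proper_sg n" unfolding proper_sg_def
    using n by (intro member_le_sum[of 1 _ "\<lambda>d. real d * c (d - 1)"]) (auto simp: c_nonneg)
  then have "0 < proper_sg n * Qf $ (n - n)" using c_0 Qf_0 by simp
  also have "\<dots> \<le> (\<Sum>k=1..n. proper_sg k * Qf $ (n - k))"
    using n by (intro member_le_sum[of n "{1..n}" "\<lambda>k. proper_sg k * Qf $ (n - k)"]) (auto simp: proper_sg_nonneg Qf_nonneg)
  finally have "0 < real n * Qf $ n" using Qf_rec[of n] by simp
  then show ?thesis using n by (simp add: zero_less_mult_iff)
qed

lemma Wf_nth: "Wf $ n = (if n = 0 then 0 else Qf $ (n - 1))"
  by (simp add: Wf_def)

lemma Wf_nonneg: "Wf $ n \<ge> 0"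
  by (simp add: Wf_nth Qf_nonneg)

text \<open>Proper divisors are at most n / 2, so the growth is at most that of n^2 \<mu>^(n/2). The
  16th root \<open>x\<close> avoids fractional exponents: x^8, x^12 and x^16 stand for \<mu>^(1/2),
  \<mu>^(3/4) and \<mu>.\<close>

lemma proper_sg_le:
  assumes "\<mu> = x ^ 16" "x > 1"
  shows "proper_sg n \<le> 2 * (real n)\<^sup>2 * x ^ (8 * n)"
proof (cases "n = 0")
  case True
  \<comment> \<open>Every number divides 0, so the sum ranges over an infinite set and is 0 by
    convention.\<close>
  have "proper_sg 0 = 0 \<or> infinite ({d. d dvd (0::nat)} - {0})" by auto
  moreover have "infinite ({d. d dvd (0::nat)} - {0})" by (simp add: infinite_remove)
  ultimately show ?thesis using True by (simp add: proper_sg_def)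
next
  case False
  have "proper_sg n \<le> (\<Sum>d\<in>{d. d dvd n} - {n}. real n * (2 * x ^ (8 * n)))"
    unfolding proper_sg_def
  proof (rule sum_mono)
    fix d assume d: "d \<in> {d. d dvd n} - {n}"
    obtain e where e: "n = d * e" using d by (auto elim: dvdE)
    then have "e \<noteq> 0" "e \<noteq> 1" "d \<noteq> 0" using False d by auto
    then have "2 \<le> e" by linarith
    then have dn: "d * 2 \<le> n" unfolding e by (rule mult_le_mono2)
    have "c (d - 1) \<le> 2 * \<mu> ^ Suc (d - 1)" by (rule c_le_\<mu>)
    also have "\<mu> ^ Suc (d - 1) = x ^ (16 * d)"
      unfolding assms(1) using \<open>d \<noteq> 0\<close> by (simp flip: power_mult)
    also have "x ^ (16 * d) \<le> x ^ (8 * n)" using dn assms(2) by (intro power_increasing) auto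
    finally show "real d * c (d - 1) \<le> real n * (2 * x ^ (8 * n))"
      using dn c_nonneg by (intro mult_mono) auto
  qed
  also have "\<dots> \<le> real n * (real n * (2 * x ^ (8 * n)))"
  proof -
    have "{d. d dvd n} \<subseteq> {1..n}" using False by (auto dest: dvd_imp_le intro: Suc_leI dvd_pos_nat)
    then have "card ({d. d dvd n} - {n}) \<le> card {1..n}" by (intro card_mono) auto
    then show ?thesis using assms(2) by (simp only: sum_constant) (intro mult_right_mono, auto)
  qed
  finally show ?thesis by (simp add: power2_eq_square ac_simps)
qed

text \<open>The rate \<nu> = \<mu>^(3/4) lies strictly between the rate of \<open>proper_sg\<close>
  and \<mu>, so the sum of \<open>proper_sg k\<close> / \<nu>^k is bounded by some \<open>D\<close>.
  The recursion then gives n Q(n) \<le> D K \<nu>^n inductively, which suffices for n \<ge> D;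
  \<open>K\<close> takes care of the smaller n.\<close>

lemma Qf_growth:
  obtains \<nu> K where "1 < \<nu>" "\<nu> < \<mu>" "\<And>n. Qf $ n \<le> K * \<nu> ^ n"
proof -
  define x where "x = root 16 \<mu>"
  have x: "\<mu> = x ^ 16" "x > 1" unfolding x_def using \<mu>_gt_1 by auto
  define y where "y = 1 / x"
  have y: "0 < y" "y < 1" using x(2) by (auto simp: y_def)
  define \<nu> where "\<nu> = x ^ 12"
  have \<nu>: "1 < \<nu>" "\<nu> < \<mu>" unfolding \<nu>_def x(1) using x(2) by (auto intro: power_strict_increasing)
  have "(\<lambda>n. real n * y ^ n) \<longlonglongrightarrow> 0"
    using powser_times_n_limit_0[of y] y by simp
  then have "Bseq (\<lambda>n. real n * y ^ n)" by (intro convergent_imp_Bseq convergentI)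
  then obtain B where B: "0 < B" "\<And>n. norm (real n * y ^ n) \<le> B" by (auto simp: Bseq_def)
  \<comment> \<open>Half of the surplus y^(4k) tames the factor k^2, the other half remains as a
    geometric series.\<close>
  have rB: "proper_sg k / \<nu> ^ k \<le> 2 * B\<^sup>2 * (y\<^sup>2) ^ k" for k
  proof -
    have "proper_sg k / \<nu> ^ k \<le> 2 * (real k)\<^sup>2 * x ^ (8 * k) / \<nu> ^ k"
      using proper_sg_le[OF x, of k] \<nu>(1) by (intro divide_right_mono) auto
    also have "x ^ (8 * k) / \<nu> ^ k = y ^ (4 * k)"
    proof -
      have "\<nu> ^ k = x ^ (8 * k) * x ^ (4 * k)" unfolding \<nu>_def by (simp flip: power_mult power_add)
      then show ?thesis using x(2) by (simp add: y_def power_one_over field_simps)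
    qed
    then have "2 * (real k)\<^sup>2 * x ^ (8 * k) / \<nu> ^ k = 2 * (real k * y ^ k)\<^sup>2 * (y\<^sup>2) ^ k"
      by (simp add: power_mult_distrib power_mult[symmetric] power_add[symmetric] mult.assoc times_divide_eq_right[symmetric] del: times_divide_eq_right)
    also have "\<dots> \<le> 2 * B\<^sup>2 * (y\<^sup>2) ^ k"
      using B(2)[of k] y by (intro mult_right_mono mult_left_mono power_mono) auto
    finally show ?thesis .
  qed
  define D where "D = 2 * B\<^sup>2 * (1 / (1 - y\<^sup>2))"
  have y2: "y\<^sup>2 < 1" using y by (simp add: power_less_one_iff)
  have sumD: "(\<Sum>k=1..n. proper_sg k / \<nu> ^ k) \<le> D" for n
  proof -
    have "(\<Sum>k=1..n. proper_sg k / \<nu> ^ k) \<le> (\<Sum>k=1..n. 2 * B\<^sup>2 * (y\<^sup>2) ^ k)" by (intro sum_mono rB)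
    also have "\<dots> = 2 * B\<^sup>2 * (\<Sum>k=1..n. (y\<^sup>2) ^ k)" by (simp add: sum_distrib_left)
    also have "(\<Sum>k=1..n. (y\<^sup>2) ^ k) \<le> (\<Sum>k. (y\<^sup>2) ^ k)"
      using y y2 by (intro sum_le_suminf summable_geometric) auto
    also have "\<dots> = 1 / (1 - y\<^sup>2)" using y y2 by (intro suminf_geometric) auto
    finally show ?thesis unfolding D_def by (simp add: mult_left_mono)
  qed
  obtain N0 :: nat where N0: "D \<le> real N0" using real_arch_simple by blast
  define K where "K = (\<Sum>m\<le>N0. Qf $ m / \<nu> ^ m)"
  have K0: "K \<ge> 0" unfolding K_def using Qf_nonneg \<nu> by (intro sum_nonneg divide_nonneg_nonneg) auto
  have "Qf $ n \<le> K * \<nu> ^ n" for n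
  proof (induction n rule: less_induct)
    case (less n)
    show ?case
    proof (cases "n \<le> N0")
      case True
      have "Qf $ n / \<nu> ^ n \<le> K" unfolding K_def using True Qf_nonneg \<nu>
        by (intro member_le_sum[of n _ "\<lambda>m. Qf $ m / \<nu> ^ m"]) auto
      then show ?thesis using \<nu> by (simp add: field_simps)
    next
      case False
      have "real n * Qf $ n \<le> (\<Sum>k=1..n. proper_sg k * (K * \<nu> ^ (n - k)))"
        unfolding Qf_rec using less by (intro sum_mono mult_left_mono proper_sg_nonneg) auto
      also have "\<dots> = (\<Sum>k=1..n. K * \<nu> ^ n * (proper_sg k / \<nu> ^ k))"
        using \<nu> by (intro sum.cong refl) (simp add: power_diff)
      also have "\<dots> = K * \<nu> ^ n * (\<Sum>k=1..n. proper_sg k / \<nu> ^ k)" by (simp add: sum_distrib_left)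
      also have "\<dots> \<le> K * \<nu> ^ n * real n"
        using sumD[of n] N0 False K0 \<nu> by (intro mult_left_mono) auto
      finally have "real n * Qf $ n \<le> real n * (K * \<nu> ^ n)" by (simp add: ac_simps)
      then show ?thesis using False by simp
    qed
  qed
  with \<nu> show thesis by (rule that)
qed

end

section \<open>Values and coefficients of compositions of nonnegative power series\<close>

lemma fps_power_nth_nonneg:
  fixes U :: "real fps"
  assumes "\<And>n. U $ n \<ge> 0"
  shows "(U ^ k) $ n \<ge> 0"
proof (induction k arbitrary: n)
  case (Suc k)
  then show ?case using assms by (auto simp: fps_mult_nth intro!: sum_nonneg)
qed auto

lemma fps_power_sums:
  fixes U :: "real fps"
  assumes U: "\<And>n. U $ n \<ge> 0" and z: "z \<ge> 0" and sm: "summable (\<lambda>n. U $ n * z ^ n)"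
  shows "(\<lambda>n. (U ^ k) $ n * z ^ n) sums (\<Sum>n. U $ n * z ^ n) ^ k"
proof (induction k)
  case 0
  have "(\<lambda>n. if n = 0 then z ^ n else 0) sums (z ^ 0)" by (rule sums_single)
  moreover have "(if n = 0 then z ^ n else 0) = (1 :: real fps) $ n * z ^ n" for n by simp
  ultimately show ?case by simp
next
  case (Suc k)
  have "(\<lambda>n. \<Sum>i\<le>n. (U $ i * z ^ i) * ((U ^ k) $ (n - i) * z ^ (n - i))) sums
      ((\<Sum>n. U $ n * z ^ n) * (\<Sum>n. (U ^ k) $ n * z ^ n))"
    using sm Suc[THEN sums_summable] U z fps_power_nth_nonneg[OF U]
    by (intro Cauchy_product_sums) (simp_all add: abs_mult)
  moreover have "(\<Sum>i\<le>n. (U $ i * z ^ i) * ((U ^ k) $ (n - i) * z ^ (n - i))) = (U ^ Suc k) $ n * z ^ n" for n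
  proof -
    have "(U ^ Suc k) $ n * z ^ n = (\<Sum>i\<le>n. U $ i * (U ^ k) $ (n - i) * z ^ n)"
      by (simp add: fps_mult_nth atLeast0AtMost sum_distrib_right)
    also have "\<dots> = (\<Sum>i\<le>n. (U $ i * z ^ i) * ((U ^ k) $ (n - i) * z ^ (n - i)))"
    proof (intro sum.cong refl)
      fix i assume "i \<in> {..n}"
      then have "z ^ n = z ^ i * z ^ (n - i)" by (simp flip: power_add)
      then show "U $ i * (U ^ k) $ (n - i) * z ^ n = (U $ i * z ^ i) * ((U ^ k) $ (n - i) * z ^ (n - i))"
        by simp
    qed
    finally show ?thesis by simp
  qed
  ultimately show ?case using Suc by (simp add: sums_iff)
qed

text \<open>A nonnegative series at a positive point bounds each of its terms, so the n-th
  coefficient of U^k times z^n is at most U(z)^k. This plays the part of Cauchy's estimate.\<close>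

lemma fps_compose_nth_le:
  fixes U F :: "real fps"
  assumes "\<And>n. U $ n \<ge> 0" "\<And>n. F $ n \<ge> 0" "z \<ge> 0" "summable (\<lambda>n. U $ n * z ^ n)"
    and "(\<Sum>n. U $ n * z ^ n) \<le> y"
  shows "(F oo U) $ n * z ^ n \<le> (\<Sum>k\<le>n. F $ k * y ^ k)"
proof -
  have le: "(U ^ k) $ n * z ^ n \<le> y ^ k" for k
  proof -
    have "(U ^ k) $ n * z ^ n \<le> (\<Sum>m\<le>n. (U ^ k) $ m * z ^ m)"
      using assms fps_power_nth_nonneg[OF assms(1)]
      by (intro member_le_sum[of n _ "\<lambda>m. (U ^ k) $ m * z ^ m"]) auto
    also have "\<dots> \<le> (\<Sum>m. (U ^ k) $ m * z ^ m)"
      using fps_power_sums[OF assms(1,3,4), of k] assms(3) fps_power_nth_nonneg[OF assms(1)]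
      by (intro sum_le_suminf) (auto simp: sums_iff)
    also have "\<dots> = (\<Sum>n. U $ n * z ^ n) ^ k"
      using fps_power_sums[OF assms(1,3,4), of k] by (simp add: sums_iff)
    also have "\<dots> \<le> y ^ k"
      using assms by (intro power_mono suminf_nonneg) auto
    finally show ?thesis .
  qed
  have "(F oo U) $ n * z ^ n = (\<Sum>k\<le>n. F $ k * ((U ^ k) $ n * z ^ n))"
    by (simp add: fps_compose_nth atLeast0AtMost sum_distrib_right mult.assoc)
  also have "\<dots> \<le> (\<Sum>k\<le>n. F $ k * y ^ k)"
    by (intro sum_mono mult_left_mono le assms)
  finally show ?thesis .
qed

context otter
begin

lemma Wf_summable:
  obtains z1 where "1 / \<mu> < z1" "\<And>z. \<bar>z\<bar> < z1 \<Longrightarrow> summable (\<lambda>n. Wf $ n * z ^ n)"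
proof -
  obtain \<nu> K where \<nu>: "1 < \<nu>" "\<nu> < \<mu>" and K: "\<And>n. Qf $ n \<le> K * \<nu> ^ n"
    using Qf_growth by metis
  have K0: "K \<ge> 0" using K[of 0] Qf_0 by simp
  have "summable (\<lambda>n. Wf $ n * z ^ n)" if z: "\<bar>z\<bar> < 1 / \<nu>" for z
  proof (rule summable_comparison_test')
    have "\<bar>\<nu> * z\<bar> < 1" using z \<nu> by (simp add: abs_mult field_simps)
    then show "summable (\<lambda>n. K * \<bar>\<nu> * z\<bar> ^ n)" by (intro summable_mult summable_geometric) simp
    fix n :: nat
    have "Wf $ n \<le> K * \<nu> ^ n"
    proof (cases n)
      case (Suc m)
      have "Wf $ n \<le> K * \<nu> ^ m" using K[of m] by (simp add: Wf_nth Suc)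
      also have "\<dots> \<le> K * \<nu> ^ n" using \<nu> K0 unfolding Suc by (intro mult_left_mono power_increasing) auto
      finally show ?thesis .
    qed (use K0 in \<open>simp add: Wf_nth\<close>)
    then have "Wf $ n * \<bar>z\<bar> ^ n \<le> K * \<nu> ^ n * \<bar>z\<bar> ^ n" by (intro mult_right_mono) auto
    then show "norm (Wf $ n * z ^ n) \<le> K * \<bar>\<nu> * z\<bar> ^ n"
      using Wf_nonneg[of n] \<nu> by (simp add: abs_mult power_abs power_mult_distrib mult.assoc)
  qed
  moreover have "1 / \<mu> < 1 / \<nu>" using \<nu> by (simp add: field_simps)
  ultimately show thesis using that by blast
qed

definition wval :: "real \<Rightarrow> real" where
  "wval z = (\<Sum>n. Wf $ n * z ^ n)"

lemma Wf_power_nth_0: "n < k \<Longrightarrow> (Wf ^ k) $ n = 0"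
  using startsby_zero_power_prefix[of Wf k] by (simp add: Wf_nth)

text \<open>All terms are nonnegative, and F(W) = T holds coefficientwise, so the bound is T(x). In
  this way convergence of F at W(x) is inherited from convergence of T at x.\<close>

lemma sum_Ff_bounded:
  assumes "0 < x" "x < 1 / \<mu>"
  obtains B where "\<And>K. (\<Sum>k\<le>K. Ff $ k * wval x ^ k) \<le> B"
proof -
  obtain z1 where z1: "1 / \<mu> < z1" "\<And>z. \<bar>z\<bar> < z1 \<Longrightarrow> summable (\<lambda>n. Wf $ n * z ^ n)"
    using Wf_summable by metis
  have sm: "summable (\<lambda>n. Wf $ n * x ^ n)" using assms z1 by (intro z1(2)) auto
  have \<mu>0: "\<mu> > 0" using \<mu>_gt_1 by simp
  have smT: "summable (\<lambda>n. Tf $ n * x ^ n)"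
  proof (rule summable_comparison_test')
    have "\<bar>\<mu> * x\<bar> < 1" using assms \<mu>0 by (simp add: abs_mult field_simps)
    then show "summable (\<lambda>n. 2 * (\<mu> * x) ^ n)" by (intro summable_mult summable_geometric) simp
    fix n :: nat
    have "Tf $ n \<le> 2 * \<mu> ^ n"
      using c_le_\<mu>[of "n - 1"] by (cases n) (simp_all add: Tf_nth)
    moreover have "0 \<le> Tf $ n" by (simp add: Tf_nth c_nonneg)
    ultimately show "norm (Tf $ n * x ^ n) \<le> 2 * (\<mu> * x) ^ n"
      using assms by (simp add: abs_mult power_mult_distrib mult_right_mono flip: mult.assoc)
  qed
  have "(\<Sum>k\<le>K. Ff $ k * wval x ^ k) \<le> (\<Sum>n. Tf $ n * x ^ n)" for K
  proof -
    have "(\<lambda>n. \<Sum>k\<le>K. Ff $ k * ((Wf ^ k) $ n * x ^ n)) sums (\<Sum>k\<le>K. Ff $ k * wval x ^ k)"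
      unfolding wval_def using assms
      by (intro sums_sum sums_mult fps_power_sums Wf_nonneg sm) auto
    then have s: "summable (\<lambda>n. \<Sum>k\<le>K. Ff $ k * ((Wf ^ k) $ n * x ^ n))"
      and eq: "(\<Sum>k\<le>K. Ff $ k * wval x ^ k) = (\<Sum>n. \<Sum>k\<le>K. Ff $ k * ((Wf ^ k) $ n * x ^ n))"
      by (auto simp: sums_iff)
    have "(\<Sum>k\<le>K. Ff $ k * ((Wf ^ k) $ n * x ^ n)) \<le> Tf $ n * x ^ n" for n
    proof -
      have nn: "Ff $ k * ((Wf ^ k) $ n * x ^ n) \<ge> 0" for k
        using assms by (intro mult_nonneg_nonneg Ff_nonneg fps_power_nth_nonneg Wf_nonneg) auto
      have "(\<Sum>k\<le>K. Ff $ k * ((Wf ^ k) $ n * x ^ n)) \<le> (\<Sum>k\<le>max K n. Ff $ k * ((Wf ^ k) $ n * x ^ n))"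
        using nn by (intro sum_mono2) auto
      also have "\<dots> = (\<Sum>k\<le>n. Ff $ k * ((Wf ^ k) $ n * x ^ n))"
        by (rule sum.mono_neutral_right) (auto simp: Wf_power_nth_0)
      also have "\<dots> = (Ff oo Wf) $ n * x ^ n"
        by (simp add: fps_compose_nth atLeast0AtMost sum_distrib_right mult.assoc)
      finally show ?thesis by (simp add: Ff_compose_Wf)
    qed
    then show ?thesis unfolding eq by (intro suminf_le s smT)
  qed
  then show thesis by (rule that)
qed

text \<open>Lowering the value of \<open>W\<close> at \<open>1 / \<mu>\<close>, however little, lowers the exponential growth rate of
  \<open>F(W)\<close>.\<close>

lemma perturbed_growth:
  assumes nn: "\<And>n. (Wf + fps_const \<alpha> * fps_X ^ 3 + fps_const \<beta> * fps_X ^ 4) $ n \<ge> 0"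
    and neg: "\<alpha> + \<beta> / \<mu> < 0"
  obtains K \<nu> where "0 < \<nu>" "\<nu> < \<mu>"
    "\<And>n. (Ff oo (Wf + fps_const \<alpha> * fps_X ^ 3 + fps_const \<beta> * fps_X ^ 4)) $ n \<le> K * \<nu> ^ n"
proof -
  define U where "U = Wf + fps_const \<alpha> * fps_X ^ 3 + fps_const \<beta> * fps_X ^ 4"
  obtain z1 where z1: "1 / \<mu> < z1" "\<And>z. \<bar>z\<bar> < z1 \<Longrightarrow> summable (\<lambda>n. Wf $ n * z ^ n)"
    using Wf_summable by metis
  have \<mu>0: "\<mu> > 0" using \<mu>_gt_1 by simp
  define uval where "uval z = wval z + \<alpha> * z ^ 3 + \<beta> * z ^ 4" for z
  have U_sums: "(\<lambda>n. U $ n * z ^ n) sums uval z" if "\<bar>z\<bar> < z1" for z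
  proof -
    have "(\<lambda>n. Wf $ n * z ^ n) sums wval z" unfolding wval_def using z1(2)[OF that] by (rule summable_sums)
    moreover have "(\<lambda>n. if n = 3 then \<alpha> * z ^ n else 0) sums (\<alpha> * z ^ 3)" by (rule sums_single)
    moreover have "(\<lambda>n. if n = 4 then \<beta> * z ^ n else 0) sums (\<beta> * z ^ 4)" by (rule sums_single)
    ultimately have "(\<lambda>n. Wf $ n * z ^ n + (if n = 3 then \<alpha> * z ^ n else 0) + (if n = 4 then \<beta> * z ^ n else 0)) sums uval z"
      unfolding uval_def by (intro sums_add)
    moreover have "Wf $ n * z ^ n + (if n = 3 then \<alpha> * z ^ n else 0) + (if n = 4 then \<beta> * z ^ n else 0) = U $ n * z ^ n" for n
      by (simp add: U_def algebra_simps)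
    ultimately show ?thesis by simp
  qed
  have cont: "isCont wval (1 / \<mu>)"
  proof -
    define r where "r = (1 / \<mu> + z1) / 2"
    have r: "1 / \<mu> < r" "r < z1" using z1(1) by (auto simp: r_def)
    have "0 < r" using r(1) \<mu>0 by (meson divide_pos_pos less_trans zero_less_one)
    then have "isCont (\<lambda>z. \<Sum>n. Wf $ n * z ^ n) (1 / \<mu>)"
      using r \<mu>0 by (intro isCont_powser[of _ r] z1(2)) auto
    then show ?thesis by (simp add: wval_def[abs_def])
  qed
  then have contU: "isCont uval (1 / \<mu>)"
    unfolding uval_def[abs_def] by (intro continuous_intros)
  have lt: "uval (1 / \<mu>) < wval (1 / \<mu>)"
  proof -
    have "(1 / \<mu>) ^ 3 * (\<alpha> + \<beta> / \<mu>) < 0" using neg \<mu>0 by (intro mult_pos_neg) auto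
    moreover have "r ^ 3 * (\<alpha> + \<beta> * r) = \<alpha> * r ^ 3 + \<beta> * r ^ 4" for r
      by (simp add: algebra_simps eval_nat_numeral)
    from this[of "1 / \<mu>"] have "(1 / \<mu>) ^ 3 * (\<alpha> + \<beta> / \<mu>) = \<alpha> * (1 / \<mu>) ^ 3 + \<beta> * (1 / \<mu>) ^ 4"
      by simp
    ultimately have "\<alpha> * (1 / \<mu>) ^ 3 + \<beta> * (1 / \<mu>) ^ 4 < 0" by (simp only:)
    then show ?thesis by (simp add: uval_def)
  qed
  \<comment> \<open>By continuity there are a point x below 1 / \<mu> with W(x) > m and a point z
    beyond 1 / \<mu> with U(z) < m. F converges at W(x), hence dominates at U(z), and the
    coefficients of F(U) are at most of order z^(-n) with 1 / z < \<mu>.\<close>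
  then obtain m where m: "uval (1 / \<mu>) < m" "m < wval (1 / \<mu>)" using dense by blast
  have "eventually (\<lambda>z. m < wval z) (at (1 / \<mu>))"
    using cont m(2) unfolding isCont_def by (rule order_tendstoD)
  moreover have "eventually (\<lambda>z. uval z < m) (at (1 / \<mu>))"
    using contU m(1) unfolding isCont_def by (rule order_tendstoD)
  ultimately have "eventually (\<lambda>z. m < wval z \<and> uval z < m) (at (1 / \<mu>))" by (rule eventually_conj)
  then obtain \<delta> where \<delta>: "\<delta> > 0" "\<And>z. z \<noteq> 1 / \<mu> \<Longrightarrow> dist z (1 / \<mu>) < \<delta> \<Longrightarrow> m < wval z \<and> uval z < m"
    unfolding eventually_at by auto
  define e where "e = min (\<delta> / 2) (min (1 / \<mu> / 2) ((z1 - 1 / \<mu>) / 2))"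
  have "0 < 1 / \<mu>" using \<mu>0 by simp
  then have e: "0 < e" "e < \<delta>" "e < 1 / \<mu>" "1 / \<mu> + e < z1" 
  proof -
    have "0 < e \<and> e < \<delta> \<and> e < r \<and> r + e < z1"
      if "0 < r" "r < z1" "e = min (\<delta> / 2) (min (r / 2) ((z1 - r) / 2))" for r
      using that \<delta>(1) by (auto simp: min_def field_simps)
    from this[OF \<open>0 < 1 / \<mu>\<close> z1(1) e_def] show "0 < e" "e < \<delta>" "e < 1 / \<mu>" "1 / \<mu> + e < z1"
      by simp_all
  qed
  define x where "x = 1 / \<mu> - e"
  define z where "z = 1 / \<mu> + e"
  have x: "0 < x" "x < 1 / \<mu>" using e by (auto simp: x_def)
  have wx: "m < wval x" using \<delta>(2)[of x] e by (auto simp: x_def dist_real_def)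
  have uz: "uval z < m" using \<delta>(2)[of z] e by (auto simp: z_def dist_real_def)
  have z: "0 < z" "1 / \<mu> < z" "\<bar>z\<bar> < z1" using e \<open>0 < 1 / \<mu>\<close> by (auto simp: z_def)
  obtain B where B: "\<And>K. (\<Sum>k\<le>K. Ff $ k * wval x ^ k) \<le> B" using sum_Ff_bounded[OF x] by metis
  have "(Ff oo U) $ n \<le> B * (1 / z) ^ n" for n
  proof -
    have "(Ff oo U) $ n * z ^ n \<le> (\<Sum>k\<le>n. Ff $ k * wval x ^ k)"
      using nn Ff_nonneg z U_sums[OF z(3)] wx uz
      by (intro fps_compose_nth_le) (auto simp: U_def sums_iff)
    also have "\<dots> \<le> B" by (rule B)
    finally show ?thesis using z(1) by (simp add: field_simps)
  qed
  moreover have "0 < 1 / z" "1 / z < \<mu>" using z \<mu>0 by (auto simp: field_simps)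
  ultimately show thesis using that unfolding U_def by blast
qed

section \<open>Exchanging factors of degree 3 and 4\<close>

definition w3 :: real where "w3 = Wf $ 3"
definition w4 :: real where "w4 = Wf $ 4"
definition Vf :: "real fps" where
  "Vf = Wf - fps_const w3 * fps_X ^ 3 - fps_const w4 * fps_X ^ 4"

lemma w_pos: "w3 > 0" "w4 > 0"
  by (simp_all add: w3_def w4_def Wf_nth Qf_pos)

lemma Vf_nonneg: "Vf $ n \<ge> 0"
  by (simp add: Vf_def w3_def w4_def Wf_nonneg)

text \<open>\<open>contrib n (k, N, i)\<close> is the contribution to the coefficient of \<open>z\<^sup>n\<close> in \<open>F(W)\<close> of the products
  of \<open>k\<close> terms of \<open>W\<close>, exactly \<open>N - i\<close> of which have degree 3 and \<open>i\<close> degree 4.\<close>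

definition contrib :: "nat \<Rightarrow> nat \<times> nat \<times> nat \<Rightarrow> real" where
  "contrib n = (\<lambda>(k, N, i). Ff $ k * real (k choose N) * real (N choose i) * w3 ^ (N - i) * w4 ^ i *
    (if 3 * N + i \<le> n then (Vf ^ (k - N)) $ (n - (3 * N + i)) else 0))"

definition indices :: "nat \<Rightarrow> (nat \<times> nat \<times> nat) set" where
  "indices m = (SIGMA k:{..m}. SIGMA N:{..k}. {..N})"

lemma contrib_nonneg: "contrib n j \<ge> 0"
  using w_pos by (auto simp: contrib_def intro!: mult_nonneg_nonneg Ff_nonneg fps_power_nth_nonneg Vf_nonneg split: prod.split)

lemma finite_indices: "finite (indices m)"
  by (simp add: indices_def)

lemma sum_indices: "(\<Sum>j\<in>indices m. f j) = (\<Sum>k\<le>m. \<Sum>N\<le>k. \<Sum>i\<le>N. f (k, N, i))"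
  by (simp add: indices_def sum.Sigma split_def)

text \<open>The binomial theorem is applied twice, with \<open>a\<close> and \<open>b\<close>
  marking the factors of degree 3 and 4. The k-th power starts in degree k, so the index set may be
  enlarged from n to any m, and one set can serve the coefficients n and n + 1 alike.\<close>

lemma weighted_sum_contrib:
  assumes "n \<le> m"
  shows "(Ff oo (Vf + fps_const (a * w3) * fps_X ^ 3 + fps_const (b * w4) * fps_X ^ 4)) $ n =
    (\<Sum>(k, N, i)\<in>indices m. contrib n (k, N, i) * (a ^ (N - i) * b ^ i))"
proof -
  define P where "P = fps_const (b * w4) * fps_X ^ 4 + fps_const (a * w3) * (fps_X ^ 3 :: real fps)"
  have U: "Vf + fps_const (a * w3) * fps_X ^ 3 + fps_const (b * w4) * fps_X ^ 4 = P + Vf"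
    by (simp add: P_def)
  have P: "P ^ N = (\<Sum>i\<le>N. fps_const (real (N choose i) * (b * w4) ^ i * (a * w3) ^ (N - i)) * fps_X ^ (3 * N + i))" for N
  proof -
    have "P ^ N = (\<Sum>i\<le>N. of_nat (N choose i) * (fps_const (b * w4) * fps_X ^ 4) ^ i * (fps_const (a * w3) * fps_X ^ 3) ^ (N - i))"
      unfolding P_def by (rule binomial_ring)
    also have "\<dots> = (\<Sum>i\<le>N. fps_const (real (N choose i) * (b * w4) ^ i * (a * w3) ^ (N - i)) * fps_X ^ (3 * N + i))"
    proof (intro sum.cong refl)
      fix i assume "i \<in> {..N}"
      then have e: "3 * N + i = 4 * i + 3 * (N - i)" by simp
      show "of_nat (N choose i) * (fps_const (b * w4) * fps_X ^ 4) ^ i * (fps_const (a * w3) * fps_X ^ 3) ^ (N - i) =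
          fps_const (real (N choose i) * (b * w4) ^ i * (a * w3) ^ (N - i)) * fps_X ^ (3 * N + i)"
        unfolding e power_add power_mult fps_of_nat[symmetric]
        by (simp add: power_mult_distrib fps_const_power fps_const_mult[symmetric] ac_simps del: fps_const_mult)
    qed
    finally show ?thesis .
  qed
  have nth: "Ff $ k * ((P + Vf) ^ k) $ n = (\<Sum>N\<le>k. \<Sum>i\<le>N. contrib n (k, N, i) * (a ^ (N - i) * b ^ i))" for k
  proof -
    have "((P + Vf) ^ k) $ n = (\<Sum>N\<le>k. (of_nat (k choose N) * P ^ N * Vf ^ (k - N)) $ n)"
      by (simp add: binomial_ring fps_sum_nth)
    also have "\<dots> = (\<Sum>N\<le>k. \<Sum>i\<le>N. real (k choose N) * (real (N choose i) * (b * w4) ^ i * (a * w3) ^ (N - i)) *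
        (if 3 * N + i \<le> n then (Vf ^ (k - N)) $ (n - (3 * N + i)) else 0))"
    proof (intro sum.cong refl)
      fix N
      have "of_nat (k choose N) * P ^ N * Vf ^ (k - N) =
          (\<Sum>i\<le>N. fps_const (real (k choose N) * (real (N choose i) * (b * w4) ^ i * (a * w3) ^ (N - i))) *
            (fps_X ^ (3 * N + i) * Vf ^ (k - N)))"
        unfolding P fps_of_nat[symmetric] sum_distrib_left sum_distrib_right
        by (intro sum.cong refl) (simp add: fps_const_mult[symmetric] mult.assoc del: fps_const_mult)
      then show "(of_nat (k choose N) * P ^ N * Vf ^ (k - N)) $ n =
          (\<Sum>i\<le>N. real (k choose N) * (real (N choose i) * (b * w4) ^ i * (a * w3) ^ (N - i)) *
            (if 3 * N + i \<le> n then (Vf ^ (k - N)) $ (n - (3 * N + i)) else 0))"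
        by (auto simp: fps_sum_nth fps_X_power_mult_nth intro!: sum.cong)
    qed
    finally show ?thesis
      unfolding sum_distrib_left contrib_def
      by (simp add: sum_distrib_left power_mult_distrib ac_simps)
  qed
  have zero: "((P + Vf) ^ k) $ n = 0" if "n < k" for k
  proof -
    have "(P + Vf) $ 0 = 0" by (simp add: P_def Vf_def Wf_nth)
    then show ?thesis using startsby_zero_power_prefix[of "P + Vf" k] that by blast
  qed
  have "(Ff oo (P + Vf)) $ n = (\<Sum>k\<le>n. Ff $ k * ((P + Vf) ^ k) $ n)"
    by (simp add: fps_compose_nth atLeast0AtMost)
  also have "\<dots> = (\<Sum>k\<le>m. Ff $ k * ((P + Vf) ^ k) $ n)"
    using assms zero by (intro sum.mono_neutral_left) auto
  also have "\<dots> = (\<Sum>k\<le>m. \<Sum>N\<le>k. \<Sum>i\<le>N. contrib n (k, N, i) * (a ^ (N - i) * b ^ i))"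
    by (simp only: nth)
  finally show ?thesis unfolding U sum_indices by simp
qed

lemma sum_contrib:
  assumes "n \<le> m"
  shows "(\<Sum>j\<in>indices m. contrib n j) = Tf $ n"
proof -
  have "Vf + fps_const (1 * w3) * fps_X ^ 3 + fps_const (1 * w4) * fps_X ^ 4 = Wf"
    by (simp add: Vf_def)
  then have "Tf $ n = (\<Sum>(k, N, i)\<in>indices m. contrib n (k, N, i) * (1 ^ (N - i) * 1 ^ i))"
    using weighted_sum_contrib[OF assms, of 1 1] by (simp add: Ff_compose_Wf)
  also have "\<dots> = (\<Sum>j\<in>indices m. contrib n j)" by (rule sum.cong) auto
  finally show ?thesis by simp
qed

lemma Tf_ge:
  assumes "0 < \<nu>" "\<nu> < \<mu>"
  obtains K where "K > 0" "\<And>n. 1 \<le> n \<Longrightarrow> K * \<nu> ^ n \<le> Tf $ n"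
proof -
  obtain K where K: "K > 0" "\<And>n. 1 \<le> n \<Longrightarrow> K * \<nu> ^ n \<le> u n" using u_ge[OF assms] by metis
  have "2 * K * \<nu> ^ n \<le> Tf $ n" if "1 \<le> n" for n
    using K(2)[OF that] that by (simp add: u_def Tf_nth)
  moreover have "2 * K > 0" using K(1) by simp
  ultimately show thesis using that by blast
qed

text \<open>A half-plane in the numbers \<open>N - i\<close> and \<open>i\<close> of factors of
  degree 3 and 4. All kinds of bad indices are of this form.\<close>

definition tail :: "real \<Rightarrow> real \<Rightarrow> real \<Rightarrow> (nat \<times> nat \<times> nat) set" where
  "tail \<alpha> \<beta> M = {(k, N, i). - M \<le> \<alpha> * real (N - i) + \<beta> * real i}"

text \<open>Exponential tilting: terms in a half-plane away from the mean are negligible.\<close>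

lemma tail_negligible:
  assumes neg: "\<alpha> * w3 + \<beta> * w4 / \<mu> < 0"
  shows "(\<lambda>n. (\<Sum>j\<in>indices (n + l) \<inter> tail \<alpha> \<beta> M. contrib n j) / Tf $ n) \<longlonglongrightarrow> 0"
proof -
  have \<mu>0: "\<mu> > 0" using \<mu>_gt_1 by simp
  \<comment> \<open>Up to the factor \<mu>^(-3) and the constant V(1 / \<mu>) this is the value at 1
    / \<mu> of W with its terms of degree 3 and 4 tilted by exp(\<alpha> x) and exp(\<beta> x). By
    hypothesis the derivative at 0 is negative, so a small tilt lowers this value.\<close>
  define g where "g x = w3 * exp (\<alpha> * x) + w4 / \<mu> * exp (\<beta> * x)" for x
  have "(g has_real_derivative (w3 * \<alpha> + w4 / \<mu> * \<beta>)) (at 0)"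
    using \<mu>0 unfolding g_def by (auto intro!: derivative_eq_intros)
  moreover have "w3 * \<alpha> + w4 / \<mu> * \<beta> < 0" using neg by (simp add: ac_simps)
  ultimately obtain d where d: "d > 0" "\<And>h. h > 0 \<Longrightarrow> h < d \<Longrightarrow> g (0 + h) < g 0"
    using DERIV_neg_dec_right by blast
  define x where "x = d / 2"
  have x: "x > 0" "g x < g 0" using d(1) d(2)[of x] by (auto simp: x_def)
  define a where "a = exp (\<alpha> * x)"
  define b where "b = exp (\<beta> * x)"
  have U: "Vf + fps_const (a * w3) * fps_X ^ 3 + fps_const (b * w4) * fps_X ^ 4 =
      Wf + fps_const ((a - 1) * w3) * fps_X ^ 3 + fps_const ((b - 1) * w4) * fps_X ^ 4"
    by (rule fps_ext) (simp add: Vf_def algebra_simps)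
  have neg': "(a - 1) * w3 + (b - 1) * w4 / \<mu> < 0"
    using x(2) by (simp add: g_def a_def b_def algebra_simps diff_divide_distrib)
  have nn': "(Wf + fps_const ((a - 1) * w3) * fps_X ^ 3 + fps_const ((b - 1) * w4) * fps_X ^ 4) $ n \<ge> 0" for n
    unfolding U[symmetric] using Vf_nonneg[of n] w_pos by (simp add: a_def b_def)
  obtain K \<nu> where \<nu>: "0 < \<nu>" "\<nu> < \<mu>" and
    K0: "\<And>n. (Ff oo (Wf + fps_const ((a - 1) * w3) * fps_X ^ 3 + fps_const ((b - 1) * w4) * fps_X ^ 4)) $ n \<le> K * \<nu> ^ n"
    by (rule perturbed_growth[OF nn' neg']) (rule that)
  have K: "(Ff oo (Vf + fps_const (a * w3) * fps_X ^ 3 + fps_const (b * w4) * fps_X ^ 4)) $ n \<le> K * \<nu> ^ n" for n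
    unfolding U by (rule K0)
  have bound: "(\<Sum>j\<in>indices (n + l) \<inter> tail \<alpha> \<beta> M. contrib n j) \<le> exp (x * M) * K * \<nu> ^ n" for n
  proof -
    have "(\<Sum>j\<in>indices (n + l) \<inter> tail \<alpha> \<beta> M. contrib n j) \<le>
        (\<Sum>j\<in>indices (n + l) \<inter> tail \<alpha> \<beta> M. exp (x * M) * (case j of (k, N, i) \<Rightarrow> contrib n (k, N, i) * (a ^ (N - i) * b ^ i)))"
    proof (rule sum_mono)
      fix j assume j: "j \<in> indices (n + l) \<inter> tail \<alpha> \<beta> M"
      obtain k N i where kNi: "j = (k, N, i)" by (cases j) auto
      have "x * - M \<le> x * (\<alpha> * real (N - i) + \<beta> * real i)"
        using j x(1) by (intro mult_left_mono) (auto simp: kNi tail_def)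
      then have "1 \<le> exp (x * M + x * (\<alpha> * real (N - i) + \<beta> * real i))" by simp
      also have "\<dots> = exp (x * M) * (a ^ (N - i) * b ^ i)"
        by (simp add: a_def b_def exp_add[symmetric] exp_of_nat_mult[symmetric] algebra_simps)
      finally have "contrib n j * 1 \<le> contrib n j * (exp (x * M) * (a ^ (N - i) * b ^ i))"
        by (rule mult_left_mono) (rule contrib_nonneg)
      then show "contrib n j \<le> exp (x * M) * (case j of (k, N, i) \<Rightarrow> contrib n (k, N, i) * (a ^ (N - i) * b ^ i))"
        by (simp add: kNi ac_simps)
    qed
    also have "\<dots> \<le> (\<Sum>j\<in>indices (n + l). exp (x * M) * (case j of (k, N, i) \<Rightarrow> contrib n (k, N, i) * (a ^ (N - i) * b ^ i)))"
      by (rule sum_mono2) (auto simp: finite_indices a_def b_def contrib_nonneg)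
    also have "\<dots> = exp (x * M) * (Ff oo (Vf + fps_const (a * w3) * fps_X ^ 3 + fps_const (b * w4) * fps_X ^ 4)) $ n"
      unfolding weighted_sum_contrib[OF le_add1[of n l]] by (simp add: sum_distrib_left)
    also have "\<dots> \<le> exp (x * M) * (K * \<nu> ^ n)" by (intro mult_left_mono K) simp
    finally show ?thesis by simp
  qed
  \<comment> \<open>T is known to dominate every rate below \<mu>, but not \<mu>^n itself; hence the
    intermediate rate.\<close>
  obtain \<nu>' where \<nu>': "\<nu> < \<nu>'" "\<nu>' < \<mu>" using \<nu>(2) dense by blast
  have \<nu>'0: "0 < \<nu>'" using \<nu>(1) \<nu>'(1) by simp
  obtain L where L: "L > 0" "\<And>n. 1 \<le> n \<Longrightarrow> L * \<nu>' ^ n \<le> Tf $ n" using Tf_ge[OF \<nu>'0 \<nu>'(2)] by metis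
  define D where "D = \<bar>exp (x * M) * K / L\<bar>"
  have "(\<lambda>n. D * (\<nu> / \<nu>') ^ n) \<longlonglongrightarrow> D * 0"
    using \<nu>(1) \<nu>' by (intro tendsto_mult tendsto_const LIMSEQ_realpow_zero) auto
  then have lim: "(\<lambda>n. D * (\<nu> / \<nu>') ^ n) \<longlonglongrightarrow> 0" by simp
  show ?thesis
  proof (rule tendsto_sandwich[OF _ _ tendsto_const lim])
    show "eventually (\<lambda>n. 0 \<le> (\<Sum>j\<in>indices (n + l) \<inter> tail \<alpha> \<beta> M. contrib n j) / Tf $ n) sequentially"
      by (intro always_eventually allI divide_nonneg_nonneg sum_nonneg contrib_nonneg) (simp add: Tf_nth c_nonneg)
    show "eventually (\<lambda>n. (\<Sum>j\<in>indices (n + l) \<inter> tail \<alpha> \<beta> M. contrib n j) / Tf $ n \<le> D * (\<nu> / \<nu>') ^ n) sequentially"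
      using eventually_ge_at_top[of 1]
    proof eventually_elim
      case (elim n)
      have pos: "0 < L * \<nu>' ^ n" using L(1) \<nu>'0 by simp
      have "(\<Sum>j\<in>indices (n + l) \<inter> tail \<alpha> \<beta> M. contrib n j) / Tf $ n \<le> (\<bar>exp (x * M) * K\<bar> * \<nu> ^ n) / (L * \<nu>' ^ n)"
      proof (rule frac_le)
        have "exp (x * M) * K * \<nu> ^ n \<le> \<bar>exp (x * M) * K\<bar> * \<nu> ^ n"
          using \<nu>(1) by (intro mult_right_mono) auto
        then show "(\<Sum>j\<in>indices (n + l) \<inter> tail \<alpha> \<beta> M. contrib n j) \<le> \<bar>exp (x * M) * K\<bar> * \<nu> ^ n"
          using bound[of n] by linarith
      qed (use pos L(2)[OF elim] \<nu>(1) in auto)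
      also have "\<dots> = D * (\<nu> / \<nu>') ^ n"
        using L(1) by (simp add: D_def power_divide)
      finally show ?case .
    qed
  qed
qed

end

context otter
begin

text \<open>Exchanging one factor of degree 3 for one of degree 4 raises the degree by one and
  leaves \<open>k\<close>, \<open>N\<close> and the power of \<open>Vf\<close> alone. The
  contribution changes by the factor (N - i) w4 / ((i + 1) w3), which is near \<mu> when (N - i) / i
  is near \<mu> w3 / w4.\<close>

lemma contrib_shift:
  assumes "i < N"
  shows "contrib (Suc n) (k, N, Suc i) * (real (Suc i) * w3) = contrib n (k, N, i) * (real (N - i) * w4)"
proof -
  have "Suc i * (N choose Suc i) = (N - i) * (N choose i)"
    using binomial_absorption[of i N] binomial_absorb_comp[of N i] by simp
  then have ch: "real (Suc i) * real (N choose Suc i) = real (N - i) * real (N choose i)"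
    by (metis of_nat_mult)
  have w: "w3 * w3 ^ (N - Suc i) = w3 ^ (N - i)"
    using assms by (metis Suc_diff_Suc power_Suc)
  define Z where "Z = (if 3 * N + i \<le> n then (Vf ^ (k - N)) $ (n - (3 * N + i)) else 0)"
  have a: "contrib (Suc n) (k, N, Suc i) = Ff $ k * real (k choose N) * real (N choose Suc i) * w3 ^ (N - Suc i) * w4 ^ Suc i * Z"
    by (simp add: contrib_def Z_def)
  have b: "contrib n (k, N, i) = Ff $ k * real (k choose N) * real (N choose i) * w3 ^ (N - i) * w4 ^ i * Z"
    by (simp add: contrib_def Z_def)
  have "contrib (Suc n) (k, N, Suc i) * (real (Suc i) * w3) =
      Ff $ k * real (k choose N) * (real (Suc i) * real (N choose Suc i)) * (w3 * w3 ^ (N - Suc i)) * (w4 * w4 ^ i) * Z"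
    unfolding a power_Suc by (simp only: ac_simps)
  also have "\<dots> = contrib n (k, N, i) * (real (N - i) * w4)"
    unfolding ch w b by (simp only: ac_simps)
  finally show ?thesis .
qed

lemma Tf_pos: "1 \<le> n \<Longrightarrow> Tf $ n > 0"
  by (simp add: Tf_nth c_pos)

text \<open>At 1 / \<mu> the terms of degree 3 and 4 are in the proportion \<mu> w3 : w4, the
  typical value of (N - i) : i. On indices with this proportion up to \<epsilon> the exchange is
  injective and multiplies each contribution by a factor within 2 \<epsilon> of \<mu>. The remaining
  indices account for the factors 1 - \<epsilon>.\<close>

lemma Tf_ratio_bounds:
  assumes \<epsilon>: "0 < \<epsilon>" "2 * \<epsilon> < \<mu>"
  shows "eventually (\<lambda>n. (\<mu> - 2 * \<epsilon>) * (1 - \<epsilon>) * Tf $ n \<le> Tf $ Suc n \<and>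
    (1 - \<epsilon>) * Tf $ Suc n \<le> (\<mu> + 2 * \<epsilon>) * Tf $ n) sequentially"
proof -
  have \<mu>0: "\<mu> > 0" using \<mu>_gt_1 by simp
  define \<kappa> where "\<kappa> = (\<mu> - \<epsilon>) * w3 / w4"
  define \<kappa>' where "\<kappa>' = (\<mu> + \<epsilon>) * w3 / w4"
  \<comment> \<open>For i > M each entry has its use: 1 makes \<open>i\<close> positive, \<mu> /
    \<epsilon> absorbs the step from i to i + 1 in the lower bound, and w4 / (w3 \<epsilon>) absorbs
    the step from N - i to N - i + 1 in the upper bound.\<close>
  define M where "M = Max {1, \<mu> / \<epsilon>, w4 / (w3 * \<epsilon>)}"
  have M: "1 \<le> M" "\<mu> / \<epsilon> \<le> M" "w4 / (w3 * \<epsilon>) \<le> M" by (simp_all add: M_def)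
  \<comment> \<open>The three bad half-planes are: \<open>i\<close> at most \<open>M\<close>, the
    ratio of \<open>N - i\<close> to \<open>i\<close> at most \<kappa>, and this ratio at least
    \<kappa>'.\<close>
  define B0 where "B0 = tail 0 (-1) M"
  define B1 where "B1 = tail (-1) \<kappa> 0"
  define B2 where "B2 = tail 1 (- \<kappa>') 0"
  have neg0: "0 * w3 + (-1) * w4 / \<mu> < 0" using w_pos \<mu>0 by simp
  have neg1: "(-1) * w3 + \<kappa> * w4 / \<mu> < 0"
  proof -
    have "\<kappa> * w4 / \<mu> = w3 - \<epsilon> * w3 / \<mu>" using w_pos \<mu>0 by (simp add: \<kappa>_def field_simps)
    then show ?thesis using \<epsilon> w_pos \<mu>0 by simp
  qed
  have neg2: "1 * w3 + (- \<kappa>') * w4 / \<mu> < 0"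
  proof -
    have "\<kappa>' * w4 / \<mu> = w3 + \<epsilon> * w3 / \<mu>" using w_pos \<mu>0 by (simp add: \<kappa>'_def field_simps)
    then show ?thesis using \<epsilon> w_pos \<mu>0 by simp
  qed
  define bad where "bad = B0 \<union> B1 \<union> B2"
  \<comment> \<open>The offset \<open>l\<close> is 1 for the coefficient n and 0 for the coefficient
    n + 1, so that both are summed over \<open>indices (Suc n)\<close>.\<close>
  have bad: "eventually (\<lambda>n. (\<Sum>j\<in>indices (n + l) \<inter> bad. contrib n j) \<le> \<epsilon> * Tf $ n) sequentially" for l
  proof -
    have ev: "eventually (\<lambda>n. (\<Sum>j\<in>indices (n + l) \<inter> B. contrib n j) / Tf $ n < \<epsilon> / 3) sequentially"
      if "B \<in> {B0, B1, B2}" for B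
    proof -
      have "(\<lambda>n. (\<Sum>j\<in>indices (n + l) \<inter> B. contrib n j) / Tf $ n) \<longlonglongrightarrow> 0"
        using that tail_negligible[OF neg0] tail_negligible[OF neg1] tail_negligible[OF neg2]
        unfolding B0_def B1_def B2_def by auto
      then show ?thesis by (rule order_tendstoD) (use \<epsilon> in simp)
    qed
    show ?thesis
      using ev[of B0, simplified] ev[of B1, simplified] ev[of B2, simplified] eventually_ge_at_top[of 1]
    proof eventually_elim
      case (elim n)
      have pos: "Tf $ n > 0" using elim(4) by (rule Tf_pos)
      have split: "(\<Sum>j\<in>A \<union> B. contrib n j) \<le> (\<Sum>j\<in>A. contrib n j) + (\<Sum>j\<in>B. contrib n j)" if "finite A" "finite B" for A B
        using sum.union_inter[OF that, of "contrib n"] sum_nonneg[of "A \<inter> B" "contrib n"] contrib_nonneg[of n] by auto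
      have "indices (n + l) \<inter> bad = (indices (n + l) \<inter> B0) \<union> (indices (n + l) \<inter> B1) \<union> (indices (n + l) \<inter> B2)"
        by (auto simp: bad_def)
      then have "(\<Sum>j\<in>indices (n + l) \<inter> bad. contrib n j) \<le>
          (\<Sum>j\<in>indices (n + l) \<inter> B0. contrib n j) + (\<Sum>j\<in>indices (n + l) \<inter> B1. contrib n j) + (\<Sum>j\<in>indices (n + l) \<inter> B2. contrib n j)"
        using split[of "indices (n + l) \<inter> B0" "indices (n + l) \<inter> B1"]
          split[of "(indices (n + l) \<inter> B0) \<union> (indices (n + l) \<inter> B1)" "indices (n + l) \<inter> B2"] finite_indices[of "n + l"] by simp
      also have "\<dots> \<le> \<epsilon> / 3 * Tf $ n + \<epsilon> / 3 * Tf $ n + \<epsilon> / 3 * Tf $ n"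
        using elim(1,2,3) pos by (intro add_mono) (simp_all add: pos_divide_less_eq)
      finally show ?case by simp
    qed
  qed
  have good: "(\<Sum>j\<in>indices m - bad. contrib n j) = Tf $ n - (\<Sum>j\<in>indices m \<inter> bad. contrib n j)" if "n \<le> m" for n m
    using sum.Int_Diff[OF finite_indices[of m], of "contrib n" bad] sum_contrib[OF that] by simp
  have goodD: "real (N - i) > \<kappa> * real i" "real (N - i) < \<kappa>' * real i" "real i > M"
    if "(k, N, i) \<notin> bad" for k N i
    using that by (auto simp: bad_def B0_def B1_def B2_def tail_def)
  have \<kappa>0: "\<kappa> > 0" using \<epsilon> w_pos by (simp add: \<kappa>_def)
  have lower: "(\<mu> - 2 * \<epsilon>) * (\<Sum>j\<in>indices (Suc n) - bad. contrib n j) \<le> Tf $ Suc n" for n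
  proof -
    define \<phi> where "\<phi> = (\<lambda>(k :: nat, N :: nat, i). (k, N, Suc i))"
    have inj: "inj_on \<phi> A" for A by (auto simp: inj_on_def \<phi>_def)
    have iN: "i < N" if "(k, N, i) \<notin> bad" for k N i
    proof -
      have "0 < \<kappa> * real i" using \<kappa>0 goodD(3)[OF that] M(1) by simp
      then show ?thesis using goodD(1)[OF that] by simp
    qed
    have "(\<mu> - 2 * \<epsilon>) * contrib n j \<le> contrib (Suc n) (\<phi> j)" if j: "j \<in> indices (Suc n) - bad" for j
    proof -
      obtain k N i where kNi: "j = (k, N, i)" by (cases j) auto
      have nb: "(k, N, i) \<notin> bad" using j kNi by simp
      have i: "real i > \<mu> / \<epsilon>" "real i > 0" using goodD(3)[OF nb] M by auto
      have "\<mu> < \<epsilon> * real i" using i(1) \<epsilon> by (simp add: field_simps)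
      then have "(\<mu> - 2 * \<epsilon>) * real (Suc i) \<le> (\<mu> - \<epsilon>) * real i"
        using \<epsilon> by (simp add: algebra_simps)
      then have "(\<mu> - 2 * \<epsilon>) * real (Suc i) * w3 \<le> (\<mu> - \<epsilon>) * real i * w3"
        using w_pos by (intro mult_right_mono) auto
      also have "\<dots> = \<kappa> * real i * w4" using w_pos by (simp add: \<kappa>_def)
      also have "\<dots> \<le> real (N - i) * w4"
        using goodD(1)[OF nb] w_pos by (intro mult_right_mono) auto
      finally have "contrib n (k, N, i) * ((\<mu> - 2 * \<epsilon>) * real (Suc i) * w3) \<le> contrib n (k, N, i) * (real (N - i) * w4)"
        by (intro mult_left_mono contrib_nonneg)
      also have "\<dots> = contrib (Suc n) (k, N, Suc i) * (real (Suc i) * w3)"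
        using contrib_shift[OF iN[OF nb]] by simp
      finally have "((\<mu> - 2 * \<epsilon>) * contrib n (k, N, i)) * (real (Suc i) * w3) \<le> contrib (Suc n) (k, N, Suc i) * (real (Suc i) * w3)"
        by (simp only: ac_simps)
      moreover have "0 < real (Suc i) * w3" using w_pos by simp
      ultimately have "(\<mu> - 2 * \<epsilon>) * contrib n (k, N, i) \<le> contrib (Suc n) (k, N, Suc i)"
        by (simp only: mult_le_cancel_right_pos)
      then show ?thesis by (simp add: kNi \<phi>_def)
    qed
    then have "(\<mu> - 2 * \<epsilon>) * (\<Sum>j\<in>indices (Suc n) - bad. contrib n j) \<le> (\<Sum>j\<in>indices (Suc n) - bad. contrib (Suc n) (\<phi> j))"
      unfolding sum_distrib_left by (rule sum_mono)
    also have "\<dots> = (\<Sum>j\<in>\<phi> ` (indices (Suc n) - bad). contrib (Suc n) j)"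
      by (simp add: sum.reindex[OF inj])
    also have "\<dots> \<le> (\<Sum>j\<in>indices (Suc n). contrib (Suc n) j)"
    proof (rule sum_mono2[OF finite_indices _ contrib_nonneg])
      show "\<phi> ` (indices (Suc n) - bad) \<subseteq> indices (Suc n)"
      proof (rule image_subsetI)
        fix j assume j: "j \<in> indices (Suc n) - bad"
        obtain k N i where kNi: "j = (k, N, i)" by (cases j) auto
        then have "i < N" using iN[of k N i] j by auto
        then show "\<phi> j \<in> indices (Suc n)" using j by (auto simp: kNi \<phi>_def indices_def)
      qed
    qed
    also have "\<dots> = Tf $ Suc n" by (rule sum_contrib) simp
    finally show ?thesis .
  qed
  have upper: "(\<Sum>j\<in>indices (Suc n) - bad. contrib (Suc n) j) \<le> (\<mu> + 2 * \<epsilon>) * Tf $ n" for n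
  proof -
    define \<psi> where "\<psi> = (\<lambda>(k :: nat, N :: nat, i :: nat). (k, N, i - 1))"
    have ge1: "1 \<le> i" if "(k, N, i) \<notin> bad" for k N i
      using goodD(3)[OF that] M(1) by (cases i) auto
    have inj: "inj_on \<psi> (indices (Suc n) - bad)"
    proof (rule inj_onI)
      fix j j' assume j: "j \<in> indices (Suc n) - bad" and j': "j' \<in> indices (Suc n) - bad" and eq: "\<psi> j = \<psi> j'"
      obtain k N i where kNi: "j = (k, N, i)" by (cases j) auto
      obtain k' N' i' where kNi': "j' = (k', N', i')" by (cases j') auto
      have "1 \<le> i" "1 \<le> i'" using ge1[of k N i] ge1[of k' N' i'] j j' kNi kNi' by auto
      then show "j = j'" using eq by (auto simp: kNi kNi' \<psi>_def)
    qed
    have "contrib (Suc n) j \<le> (\<mu> + 2 * \<epsilon>) * contrib n (\<psi> j)" if j: "j \<in> indices (Suc n) - bad" for j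
    proof -
      obtain k N i where kNi: "j = (k, N, i)" by (cases j) auto
      have nb: "(k, N, i) \<notin> bad" using j kNi by simp
      obtain i' where i': "i = Suc i'" using ge1[OF nb] by (cases i) auto
      have "i \<le> N" using j by (simp add: kNi indices_def)
      then have lt: "i' < N" and eqN: "real (N - i') = real (N - i) + 1" by (auto simp: i')
      have "real i > w4 / (w3 * \<epsilon>)" using goodD(3)[OF nb] M by auto
      then have "w4 \<le> \<epsilon> * real i * w3" using \<epsilon> w_pos by (simp add: field_simps)
      moreover have "real (N - i) * w4 \<le> \<kappa>' * real i * w4"
        using goodD(2)[OF nb] w_pos by (intro mult_right_mono) auto
      moreover have "\<kappa>' * real i * w4 = (\<mu> + \<epsilon>) * real i * w3" using w_pos by (simp add: \<kappa>'_def)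
      ultimately have "real (N - i') * w4 \<le> (\<mu> + 2 * \<epsilon>) * (real i * w3)"
        unfolding eqN by (simp add: algebra_simps)
      then have "contrib n (k, N, i') * (real (N - i') * w4) \<le> contrib n (k, N, i') * ((\<mu> + 2 * \<epsilon>) * (real i * w3))"
        by (intro mult_left_mono contrib_nonneg)
      then have "contrib (Suc n) (k, N, i) * (real i * w3) \<le> ((\<mu> + 2 * \<epsilon>) * contrib n (k, N, i')) * (real i * w3)"
        unfolding i' contrib_shift[OF lt] by (simp only: ac_simps)
      moreover have "0 < real i * w3" using w_pos i' by simp
      ultimately have "contrib (Suc n) (k, N, i) \<le> (\<mu> + 2 * \<epsilon>) * contrib n (k, N, i')"
        by (simp only: mult_le_cancel_right_pos)
      then show ?thesis by (simp add: kNi \<psi>_def i')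
    qed
    then have "(\<Sum>j\<in>indices (Suc n) - bad. contrib (Suc n) j) \<le> (\<mu> + 2 * \<epsilon>) * (\<Sum>j\<in>indices (Suc n) - bad. contrib n (\<psi> j))"
      unfolding sum_distrib_left by (rule sum_mono)
    also have "(\<Sum>j\<in>indices (Suc n) - bad. contrib n (\<psi> j)) = (\<Sum>j\<in>\<psi> ` (indices (Suc n) - bad). contrib n j)"
      by (simp add: sum.reindex[OF inj])
    also have "(\<mu> + 2 * \<epsilon>) * \<dots> \<le> (\<mu> + 2 * \<epsilon>) * (\<Sum>j\<in>indices (Suc n). contrib n j)"
    proof (intro mult_left_mono sum_mono2[OF finite_indices _ contrib_nonneg])
      show "\<psi> ` (indices (Suc n) - bad) \<subseteq> indices (Suc n)" by (auto simp: \<psi>_def indices_def)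
    qed (use \<epsilon> \<mu>0 in auto)
    also have "(\<Sum>j\<in>indices (Suc n). contrib n j) = Tf $ n" by (rule sum_contrib) simp
    finally show ?thesis .
  qed
  have "eventually (\<lambda>n. (\<Sum>j\<in>indices (Suc n) \<inter> bad. contrib n j) \<le> \<epsilon> * Tf $ n) sequentially"
    using bad[of 1] by simp
  moreover have "eventually (\<lambda>n. (\<Sum>j\<in>indices (Suc n) \<inter> bad. contrib (Suc n) j) \<le> \<epsilon> * Tf $ Suc n) sequentially"
    using eventually_sequentially_Suc[THEN iffD2, OF bad[of 0]] by simp
  ultimately show ?thesis
  proof eventually_elim
    case (elim n)
    have "(1 - \<epsilon>) * Tf $ n \<le> (\<Sum>j\<in>indices (Suc n) - bad. contrib n j)"
      using elim(1) good[of n "Suc n"] by (simp add: algebra_simps)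
    then have "(\<mu> - 2 * \<epsilon>) * ((1 - \<epsilon>) * Tf $ n) \<le> (\<mu> - 2 * \<epsilon>) * (\<Sum>j\<in>indices (Suc n) - bad. contrib n j)"
      using \<epsilon> by (intro mult_left_mono) auto
    also have "\<dots> \<le> Tf $ Suc n" by (rule lower)
    finally have 1: "(\<mu> - 2 * \<epsilon>) * (1 - \<epsilon>) * Tf $ n \<le> Tf $ Suc n" by (simp only: mult.assoc)
    have "(1 - \<epsilon>) * Tf $ Suc n \<le> (\<Sum>j\<in>indices (Suc n) - bad. contrib (Suc n) j)"
      using elim(2) good[of "Suc n" "Suc n"] by (simp add: algebra_simps)
    also have "\<dots> \<le> (\<mu> + 2 * \<epsilon>) * Tf $ n" by (rule upper)
    finally show ?case using 1 by simp
  qed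
qed

lemma Tf_ratio: "(\<lambda>n. Tf $ Suc n / Tf $ n) \<longlonglongrightarrow> \<mu>"
proof (rule LIMSEQ_I)
  fix r :: real assume r: "r > 0"
  have \<mu>0: "\<mu> > 0" using \<mu>_gt_1 by simp
  have t1: "((\<lambda>\<epsilon>. (\<mu> - 2 * \<epsilon>) * (1 - \<epsilon>)) \<longlongrightarrow> \<mu>) (at_right 0)"
    by (auto intro!: tendsto_eq_intros)
  have t2: "((\<lambda>\<epsilon>. (\<mu> + 2 * \<epsilon>) / (1 - \<epsilon>)) \<longlongrightarrow> \<mu>) (at_right 0)"
    by (auto intro!: tendsto_eq_intros)
  have t3: "((\<lambda>\<epsilon>. 2 * \<epsilon>) \<longlongrightarrow> 0) (at_right (0::real))"
    by (auto intro!: tendsto_eq_intros)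
  have "eventually (\<lambda>\<epsilon>. \<mu> - r < (\<mu> - 2 * \<epsilon>) * (1 - \<epsilon>) \<and> (\<mu> + 2 * \<epsilon>) / (1 - \<epsilon>) < \<mu> + r \<and>
      2 * \<epsilon> < \<mu> \<and> 2 * \<epsilon> < 1 \<and> 0 < \<epsilon>) (at_right 0)"
    using r \<mu>0
    by (intro eventually_conj order_tendstoD[OF t1] order_tendstoD[OF t2] order_tendstoD(2)[OF t3] eventually_at_right_less) auto
  then obtain \<epsilon> where \<epsilon>: "\<mu> - r < (\<mu> - 2 * \<epsilon>) * (1 - \<epsilon>)" "(\<mu> + 2 * \<epsilon>) / (1 - \<epsilon>) < \<mu> + r"
    "2 * \<epsilon> < \<mu>" "2 * \<epsilon> < 1" "0 < \<epsilon>"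
    using eventually_happens'[OF trivial_limit_at_right_real] by blast
  have "eventually (\<lambda>n. norm (Tf $ Suc n / Tf $ n - \<mu>) < r) sequentially"
    using Tf_ratio_bounds[OF \<epsilon>(5,3)] eventually_ge_at_top[of 1]
  proof eventually_elim
    case (elim n)
    have pos: "Tf $ n > 0" using elim(2) by (rule Tf_pos)
    have "(\<mu> - 2 * \<epsilon>) * (1 - \<epsilon>) \<le> Tf $ Suc n / Tf $ n"
      using elim(1) pos by (simp add: pos_le_divide_eq)
    moreover have "Tf $ Suc n / Tf $ n \<le> (\<mu> + 2 * \<epsilon>) / (1 - \<epsilon>)"
      using elim(1) pos \<epsilon>(4) by (simp add: pos_divide_le_eq pos_le_divide_eq ac_simps)
    ultimately show ?case using \<epsilon>(1,2) by (simp add: abs_less_iff)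
  qed
  then show "\<exists>no. \<forall>n\<ge>no. norm (Tf $ Suc n / Tf $ n - \<mu>) < r"
    by (simp add: eventually_sequentially)
qed

theorem c_ratio: "(\<lambda>n. c n / c (Suc n)) \<longlonglongrightarrow> 1 / \<mu>"
proof -
  have \<mu>0: "\<mu> > 0" using \<mu>_gt_1 by simp
  have "(\<lambda>n. Tf $ Suc (Suc n) / Tf $ Suc n) \<longlonglongrightarrow> \<mu>"
    by (rule LIMSEQ_Suc[OF Tf_ratio])
  then have "(\<lambda>n. inverse (Tf $ Suc (Suc n) / Tf $ Suc n)) \<longlonglongrightarrow> inverse \<mu>"
    using \<mu>0 by (intro tendsto_inverse) auto
  then show ?thesis by (simp add: Tf_nth inverse_eq_divide)
qed

end

unbundle no fps_syntax

section \<open>Ordinals as multisets of exponents\<close>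

definition cw :: "ordinal \<Rightarrow> nat" where
  "cw a = Suc (cnf_norm a)"

definition mcnf :: "ordinal \<Rightarrow> ordinal multiset" where
  "mcnf \<alpha> = mset (cnf \<alpha>)"

lemma set_mcnf [simp]: "set_mset (mcnf \<alpha>) = set (cnf \<alpha>)"
  by (simp add: mcnf_def)

lemma sorted_rev_ge: "sorted_wrt (\<ge>) xs \<longleftrightarrow> sorted (rev xs)"
  by (simp add: sorted_wrt_rev)

lemma cnf_eq_mcnf: "cnf \<alpha> = rev (sorted_list_of_multiset (mcnf \<alpha>))"
proof -
  have "sorted_list_of_multiset (mset (rev (cnf \<alpha>))) = rev (cnf \<alpha>)"
    using sorted_cnf[of \<alpha>] by (simp only: sorted_list_of_multiset_mset sorted_rev_ge sorted_sort_id)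
  then show ?thesis by (simp add: mcnf_def)
qed

lemma inj_mcnf: "inj mcnf"
proof (rule injI)
  fix \<alpha> \<beta> assume "mcnf \<alpha> = mcnf \<beta>"
  then have "cnf \<alpha> = cnf \<beta>" by (metis cnf_eq_mcnf)
  then show "\<alpha> = \<beta>" by (metis cnf_sum_cnf)
qed

lemma mcnf_cnf_sum: "sorted_wrt (\<ge>) as \<Longrightarrow> mcnf (cnf_sum as) = mset as"
  by (simp add: mcnf_def cnf_cnf_sum)

lemma mcnf_surj: "\<exists>\<alpha>. mcnf \<alpha> = M"
proof -
  have "sorted_wrt (\<ge>) (rev (sorted_list_of_multiset M))"
    by (simp add: sorted_rev_ge)
  from mcnf_cnf_sum[OF this] show ?thesis by (intro exI) simp
qed

lemma cnf_norm_eq_wt: "\<alpha> < \<epsilon>\<^sub>0 \<Longrightarrow> cnf_norm \<alpha> = wt cw (mcnf \<alpha>)"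
proof -
  assume "\<alpha> < \<epsilon>\<^sub>0"
  then have "cnf_norm \<alpha> = length (cnf \<alpha>) + (\<Sum>a\<leftarrow>cnf \<alpha>. cnf_norm a)"
    by (rule cnf_norm_is_cnf[OF _ is_cnf_cnf])
  moreover have "wt cw (mset as) = length as + (\<Sum>a\<leftarrow>as. cnf_norm a)" for as
    by (induction as) (simp_all add: cw_def)
  ultimately show ?thesis by (simp add: mcnf_def)
qed

text \<open>An ordinal of norm at most \<open>n\<close> is given by a list of at most
  \<open>n\<close> exponents, each of norm less than \<open>n\<close>.\<close>

lemma finite_norm_le: "finite {\<alpha>. \<alpha> < \<epsilon>\<^sub>0 \<and> cnf_norm \<alpha> \<le> n}"
proof (induction n rule: less_induct)
  case (less n)
  define F where "F = {\<alpha>. \<alpha> < \<epsilon>\<^sub>0 \<and> cnf_norm \<alpha> < n}"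
  have "finite F"
  proof (cases n)
    case (Suc m)
    have "F = {\<alpha>. \<alpha> < \<epsilon>\<^sub>0 \<and> cnf_norm \<alpha> \<le> m}" unfolding F_def Suc by auto
    then show ?thesis using less.IH[of m] Suc by simp
  qed (simp add: F_def)
  have "mcnf ` {\<alpha>. \<alpha> < \<epsilon>\<^sub>0 \<and> cnf_norm \<alpha> \<le> n} \<subseteq> mset ` {xs. set xs \<subseteq> F \<and> length xs \<le> n}"
  proof (rule image_subsetI)
    fix \<alpha> assume \<alpha>: "\<alpha> \<in> {\<alpha>. \<alpha> < \<epsilon>\<^sub>0 \<and> cnf_norm \<alpha> \<le> n}"
    have "size (mcnf \<alpha>) \<le> wt cw (mcnf \<alpha>)" by (rule size_le_wt) (simp add: cw_def)
    then have "length (cnf \<alpha>) \<le> n" using \<alpha> cnf_norm_eq_wt[of \<alpha>] by (simp add: mcnf_def)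
    moreover have "set (cnf \<alpha>) \<subseteq> F"
    proof
      fix a assume a: "a \<in> set (cnf \<alpha>)"
      have "cw a \<le> wt cw (mcnf \<alpha>)" by (rule le_wt) (use a in simp)
      then have "cnf_norm a < n" using \<alpha> cnf_norm_eq_wt[of \<alpha>] by (simp add: cw_def)
      moreover have "a < \<epsilon>\<^sub>0" using \<alpha> cnf_exponent_less[OF _ a] by auto
      ultimately show "a \<in> F" by (simp add: F_def)
    qed
    ultimately show "mcnf \<alpha> \<in> mset ` {xs. set xs \<subseteq> F \<and> length xs \<le> n}"
      unfolding mcnf_def by blast
  qed
  moreover have "finite (mset ` {xs. set xs \<subseteq> F \<and> length xs \<le> n})"
    using finite_lists_length_le[OF \<open>finite F\<close>] by simp
  ultimately have "finite (mcnf ` {\<alpha>. \<alpha> < \<epsilon>\<^sub>0 \<and> cnf_norm \<alpha> \<le> n})"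
    by (rule finite_subset)
  then show ?case by (rule finite_imageD) (rule inj_on_subset[OF inj_mcnf], simp)
qed

lemma finite_norm_eq: "\<beta> \<le> \<epsilon>\<^sub>0 \<Longrightarrow> finite {\<alpha>. \<alpha> < \<beta> \<and> R \<alpha> \<and> cnf_norm \<alpha> = n}"
  by (rule finite_subset[OF _ finite_norm_le[of n]]) auto

lemma graded_cw: "\<gamma> \<le> \<epsilon>\<^sub>0 \<Longrightarrow> graded {..<\<gamma>} cw"
  unfolding graded_def
proof (intro conjI ballI allI)
  fix n assume "\<gamma> \<le> \<epsilon>\<^sub>0"
  then show "finite {x \<in> {..<\<gamma>}. cw x \<le> n}"
    by (intro finite_subset[OF _ finite_norm_le[of n]]) (auto simp: cw_def)
qed (simp add: cw_def)

lemma omega_pow_le_epsilon_0: "\<gamma> \<le> \<epsilon>\<^sub>0 \<Longrightarrow> omega_pow \<gamma> \<le> \<epsilon>\<^sub>0"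
  using omega_pow_le_iff[of \<gamma> "\<epsilon>\<^sub>0"] by (simp add: epsilon_0_fixpoint)

lemma omega_pow_less_epsilon_0: "\<gamma> < \<epsilon>\<^sub>0 \<Longrightarrow> omega_pow \<gamma> < \<epsilon>\<^sub>0"
  using omega_pow_less_iff[of \<gamma> "\<epsilon>\<^sub>0"] by (simp add: epsilon_0_fixpoint)

section \<open>Counting ordinals by their norm\<close>

definition ocount :: "ordinal \<Rightarrow> (ordinal \<Rightarrow> bool) \<Rightarrow> nat \<Rightarrow> nat" where
  "ocount \<beta> R n = card {\<alpha>. \<alpha> < \<beta> \<and> R \<alpha> \<and> cnf_norm \<alpha> = n}"

lemma mcnf_image:
  assumes "\<gamma> \<le> \<epsilon>\<^sub>0"
  shows "mcnf ` {\<alpha>. \<alpha> < omega_pow \<gamma> \<and> Q (mcnf \<alpha>) \<and> cnf_norm \<alpha> = n} = {M \<in> wmsets {..<\<gamma>} cw n. Q M}"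
proof -
  have iff: "\<alpha> < omega_pow \<gamma> \<and> cnf_norm \<alpha> = n \<longleftrightarrow> mcnf \<alpha> \<in> wmsets {..<\<gamma>} cw n" for \<alpha>
  proof (cases "\<alpha> < omega_pow \<gamma>")
    case True
    then have "\<alpha> < \<epsilon>\<^sub>0" using omega_pow_le_epsilon_0[OF assms] by (rule order_less_le_trans)
    then show ?thesis using True
      by (auto simp: wmsets_def cnf_norm_eq_wt less_omega_pow_iff_cnf)
  next
    case False
    then show ?thesis by (auto simp: wmsets_def less_omega_pow_iff_cnf)
  qed
  show ?thesis
  proof (rule subset_antisym[OF image_subsetI subsetI])
    fix \<alpha> assume "\<alpha> \<in> {\<alpha>. \<alpha> < omega_pow \<gamma> \<and> Q (mcnf \<alpha>) \<and> cnf_norm \<alpha> = n}"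
    then show "mcnf \<alpha> \<in> {M \<in> wmsets {..<\<gamma>} cw n. Q M}" using iff[of \<alpha>] by simp
  next
    fix M assume M: "M \<in> {M \<in> wmsets {..<\<gamma>} cw n. Q M}"
    obtain \<alpha> where \<alpha>: "mcnf \<alpha> = M" using mcnf_surj by blast
    then have "\<alpha> \<in> {\<alpha>. \<alpha> < omega_pow \<gamma> \<and> Q (mcnf \<alpha>) \<and> cnf_norm \<alpha> = n}"
      using M iff[of \<alpha>] by simp
    then show "M \<in> mcnf ` {\<alpha>. \<alpha> < omega_pow \<gamma> \<and> Q (mcnf \<alpha>) \<and> cnf_norm \<alpha> = n}"
      using \<alpha> by (intro image_eqI[of _ _ \<alpha>]) auto
  qed
qed

lemma ocount_omega_pow:
  assumes "\<gamma> \<le> \<epsilon>\<^sub>0"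
  shows "ocount (omega_pow \<gamma>) (\<lambda>\<alpha>. Q (mcnf \<alpha>)) n = card {M \<in> wmsets {..<\<gamma>} cw n. Q M}"
  unfolding ocount_def mcnf_image[OF assms, symmetric]
  by (rule card_image[symmetric]) (rule inj_on_subset[OF inj_mcnf], simp)

lemma ocount_omega_pow_True: "\<gamma> \<le> \<epsilon>\<^sub>0 \<Longrightarrow> ocount (omega_pow \<gamma>) (\<lambda>_. True) n = wcount {..<\<gamma>} cw n"
  using ocount_omega_pow[of \<gamma> "\<lambda>_. True" n] by (simp add: wcount_def)

text \<open>The link that drives the induction: the weight distribution of the parts for
  \<omega>^\<gamma> is the norm distribution below \<gamma>, shifted by one.\<close>

lemma pcount_cw: "pcount {..<\<gamma>} cw (Suc k) = ocount \<gamma> (\<lambda>_. True) k"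
  unfolding pcount_def ocount_def by (rule arg_cong[of _ _ card]) (auto simp: cw_def)

lemma add_1_ordinal: "\<alpha> + 1 = osuc \<alpha>"
  by (simp add: one_ordinal_def add_osuc)

lemma cnf_osuc: "cnf (osuc \<alpha>) = cnf \<alpha> @ [0]"
proof -
  have "sorted_wrt (\<ge>) (cnf \<alpha> @ [0])" using sorted_cnf[of \<alpha>] by (simp add: sorted_wrt_append)
  from cnf_cnf_sum[OF this] show ?thesis by (simp add: cnf_sum_append add_1_ordinal)
qed

lemma cnf_0: "cnf 0 = []"
  using cnf_cnf_sum[of "[]"] by simp

lemma epsilon_0_pos: "0 < \<epsilon>\<^sub>0"
  using omega_pow_pos[of "\<epsilon>\<^sub>0"] by (simp add: epsilon_0_fixpoint)

lemma osuc_less_epsilon_0: "\<alpha> < \<epsilon>\<^sub>0 \<Longrightarrow> osuc \<alpha> < \<epsilon>\<^sub>0"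
  using add_less_omega_pow[of \<alpha> "\<epsilon>\<^sub>0" 1] omega_pow_less_iff[of 0 "\<epsilon>\<^sub>0"] epsilon_0_pos
  by (simp add: epsilon_0_fixpoint add_1_ordinal)

lemma cnf_norm_0: "cnf_norm 0 = 0"
  using cnf_norm_eq_wt[OF epsilon_0_pos] by (simp add: mcnf_def cnf_0)

lemma cw_0: "cw 0 = 1"
  by (simp add: cw_def cnf_norm_0)

lemma cnf_norm_osuc: "\<alpha> < \<epsilon>\<^sub>0 \<Longrightarrow> cnf_norm (osuc \<alpha>) = Suc (cnf_norm \<alpha>)"
  using cnf_norm_eq_wt[of "osuc \<alpha>"] cnf_norm_eq_wt[of \<alpha>] osuc_less_epsilon_0[of \<alpha>]
  by (simp add: mcnf_def cnf_osuc cw_0)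

lemma ofin_less_epsilon_0: "ofin i < \<epsilon>\<^sub>0"
  by (induction i) (simp_all add: epsilon_0_pos osuc_less_epsilon_0)

lemma cw_ofin: "cw (ofin i) = Suc i"
proof -
  have "cnf_norm (ofin i) = i"
    by (induction i) (simp_all add: cnf_norm_0 cnf_norm_osuc ofin_less_epsilon_0)
  then show ?thesis by (simp add: cw_def)
qed

lemma cnf_add_omega_pow:
  assumes "\<alpha> < omega_pow (osuc \<gamma>)"
  shows "cnf (omega_pow \<gamma> + \<alpha>) = \<gamma> # cnf \<alpha>"
proof -
  have "sorted_wrt (\<ge>) (\<gamma> # cnf \<alpha>)"
    using sorted_cnf[of \<alpha>] assms by (auto simp: less_omega_pow_iff_cnf less_osuc_iff)
  from cnf_cnf_sum[OF this] show ?thesis by simp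
qed

text \<open>Below a limit the successor map is injective and raises the norm by one. Passing from
  \<gamma> to its successor only adds \<gamma>, which affects the single norm N(\<gamma>).\<close>

lemma ocount_eventually_mono:
  assumes "\<omega> \<le> \<gamma>" "\<gamma> \<le> \<epsilon>\<^sub>0"
  shows "\<exists>K. \<forall>n\<ge>K. ocount \<gamma> (\<lambda>_. True) n \<le> ocount \<gamma> (\<lambda>_. True) (Suc n)"
  using assms
proof (induction \<gamma> rule: ordinal_induct)
  case zero
  then show ?case using olimit_omega by (simp add: olimit_def)
next
  case (suc \<gamma>)
  have lt: "\<gamma> < \<epsilon>\<^sub>0" using suc.prems(2) by (simp add: osuc_le_iff)
  have "\<omega> \<noteq> osuc \<gamma>" using olimit_omega by (auto simp: olimit_iff)
  then have "\<omega> < osuc \<gamma>" using suc.prems(1) by (rule le_neq_trans[rotated])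
  then have "\<omega> \<le> \<gamma>" by (simp only: less_osuc_iff)
  from suc.IH[OF this less_imp_le[OF lt]]
  obtain K where K: "\<forall>n\<ge>K. ocount \<gamma> (\<lambda>_. True) n \<le> ocount \<gamma> (\<lambda>_. True) (Suc n)" ..
  have "ocount (osuc \<gamma>) (\<lambda>_. True) n = ocount \<gamma> (\<lambda>_. True) n" if "cnf_norm \<gamma> < n" for n
    unfolding ocount_def using that
    by (intro arg_cong[of _ _ card]) (auto simp: less_osuc_iff le_less)
  then show ?case using K by (intro exI[of _ "max K (Suc (cnf_norm \<gamma>))"]) auto
next
  case (limit \<gamma>)
  have "ocount \<gamma> (\<lambda>_. True) n \<le> ocount \<gamma> (\<lambda>_. True) (Suc n)" for n
    unfolding ocount_def
  proof (rule card_inj_on_le[of osuc])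
    show "osuc ` {\<alpha>. \<alpha> < \<gamma> \<and> True \<and> cnf_norm \<alpha> = n} \<subseteq> {\<alpha>. \<alpha> < \<gamma> \<and> True \<and> cnf_norm \<alpha> = Suc n}"
    proof (rule image_subsetI)
      fix \<alpha> assume \<alpha>: "\<alpha> \<in> {\<alpha>. \<alpha> < \<gamma> \<and> True \<and> cnf_norm \<alpha> = n}"
      then have "\<alpha> < \<epsilon>\<^sub>0" using limit.prems(2) by auto
      then show "osuc \<alpha> \<in> {\<alpha>. \<alpha> < \<gamma> \<and> True \<and> cnf_norm \<alpha> = Suc n}"
        using \<alpha> limit.hyps by (simp add: cnf_norm_osuc olimit_def)
    qed
    show "finite {\<alpha>. \<alpha> < \<gamma> \<and> True \<and> cnf_norm \<alpha> = Suc n}"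
      by (rule finite_norm_eq[OF limit.prems(2)])
  qed (simp add: inj_on_def)
  then show ?case by blast
qed

lemma less_mult_ofin:
  assumes "\<beta> < omega_pow (osuc \<delta>)"
  obtains k where "\<beta> < omega_pow \<delta> * ofin k"
  using assms by (auto simp: omega_pow_osuc mult_limit[OF olimit_omega] elim!: less_osupE less_omegaE)

lemma cnf_sum_filter_le: "cnf_sum (filter P as) \<le> cnf_sum as"
  by (induction as) (auto intro: order_trans[OF _ le_add2_ordinal])

text \<open>Deleting terms from a normal form can only lower its value.\<close>

lemma mult_count_le: "omega_pow \<delta> * ofin (count (mcnf \<alpha>) \<delta>) \<le> \<alpha>"
proof -
  have "filter (\<lambda>a. a = \<delta>) as = replicate (count (mset as) \<delta>) \<delta>" for as
    by (induction as) auto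
  then have "omega_pow \<delta> * ofin (count (mcnf \<alpha>) \<delta>) = cnf_sum (filter (\<lambda>a. a = \<delta>) (cnf \<alpha>))"
    by (simp add: cnf_sum_replicate mcnf_def)
  also have "\<dots> \<le> \<alpha>" using cnf_sum_filter_le[of _ "cnf \<alpha>"] by simp
  finally show ?thesis .
qed

lemma mult_ofin_mono: "i \<le> j \<Longrightarrow> \<alpha> * ofin i \<le> \<alpha> * ofin j"
  by (induction j) (auto simp: le_Suc_eq mult_osuc intro: order_trans[OF _ le_add1_ordinal])

lemma ocount_mono: "\<beta> \<le> \<beta>' \<Longrightarrow> \<beta>' \<le> \<epsilon>\<^sub>0 \<Longrightarrow> (\<And>\<alpha>. \<alpha> < \<beta> \<Longrightarrow> R \<alpha> \<Longrightarrow> R' \<alpha>) \<Longrightarrow> ocount \<beta> R n \<le> ocount \<beta>' R' n"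
  unfolding ocount_def by (intro card_mono finite_norm_eq) auto

text \<open>If \<omega>^\<delta> is the leading power of \<beta>, then \<delta> < \<gamma>, and all
  ordinals below \<beta> have a bounded coefficient at \<omega>^\<delta>. Bounded coefficients are
  negligible.\<close>

lemma ocount_below_negligible:
  assumes "\<gamma> < \<epsilon>\<^sub>0" "\<beta> < omega_pow \<gamma>"
    and ratio: "(\<lambda>n. real (wcount {..<\<gamma>} cw n) / real (wcount {..<\<gamma>} cw (Suc n))) \<longlonglongrightarrow> 1"
  shows "(\<lambda>n. real (ocount \<beta> R n) / real (wcount {..<\<gamma>} cw n)) \<longlonglongrightarrow> 0"
proof (cases "\<beta> = 0")
  case True
  then show ?thesis by (simp add: ocount_def)
next
  case False
  then obtain \<delta> where \<delta>: "omega_pow \<delta> \<le> \<beta>" "\<beta> < omega_pow (osuc \<delta>)" by (rule omega_pow_division)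
  have "omega_pow \<delta> < omega_pow \<gamma>" using \<delta>(1) assms(2) by (rule order_le_less_trans)
  then have \<delta>\<gamma>: "\<delta> \<in> {..<\<gamma>}" by (simp add: omega_pow_less_iff)
  obtain k where k: "\<beta> < omega_pow \<delta> * ofin k" using less_mult_ofin[OF \<delta>(2)] by blast
  have cnt: "count (mcnf \<alpha>) \<delta> < k" if "\<alpha> < \<beta>" for \<alpha>
  proof (rule ccontr)
    assume "\<not> count (mcnf \<alpha>) \<delta> < k"
    then have "omega_pow \<delta> * ofin k \<le> omega_pow \<delta> * ofin (count (mcnf \<alpha>) \<delta>)"
      by (intro mult_ofin_mono) simp
    also have "\<dots> \<le> \<alpha>" by (rule mult_count_le)
    also have "\<dots> < omega_pow \<delta> * ofin k" using that k by (rule order_less_trans)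
    finally show False by simp
  qed
  have le: "ocount \<beta> R n \<le> card {M \<in> wmsets {..<\<gamma>} cw n. count M \<delta> < k}" for n
    unfolding ocount_omega_pow[OF less_imp_le[OF assms(1)], of "\<lambda>M. count M \<delta> < k", symmetric]
    using assms cnt by (intro ocount_mono omega_pow_le_epsilon_0) auto
  show ?thesis
  proof (rule tendsto_sandwich[OF _ _ tendsto_const card_count_less_negligible[OF graded_cw \<delta>\<gamma> ratio, of k]])
    show "eventually (\<lambda>n. real (ocount \<beta> R n) / real (wcount {..<\<gamma>} cw n) \<le>
        real (card {M \<in> wmsets {..<\<gamma>} cw n. count M \<delta> < k}) / real (wcount {..<\<gamma>} cw n)) sequentially"
      using le by (intro always_eventually allI divide_right_mono) auto
  qed (use assms in \<open>auto intro: less_imp_le\<close>)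
qed

text \<open>An ordinal from \<omega>^\<gamma> on is \<omega>^\<gamma> + \<alpha>. As \<alpha> stays
  below \<omega>^(\<gamma>+1), its normal form just receives \<gamma> as a new first exponent, which
  shifts the norm by \<open>cw \<gamma>\<close>.\<close>

lemma ocount_add_omega_pow:
  assumes \<gamma>: "\<gamma> < \<epsilon>\<^sub>0" and \<beta>: "\<beta> < omega_pow (osuc \<gamma>)"
  shows "ocount (omega_pow \<gamma> + \<beta>) R n = ocount (omega_pow \<gamma>) R n +
    (if cw \<gamma> \<le> n then ocount \<beta> (\<lambda>\<alpha>. R (omega_pow \<gamma> + \<alpha>)) (n - cw \<gamma>) else 0)"
proof -
  define T where "T = {\<alpha>. \<alpha> < \<beta> \<and> R (omega_pow \<gamma> + \<alpha>) \<and> cw \<gamma> + cnf_norm \<alpha> = n}"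
  have e: "omega_pow (osuc \<gamma>) < \<epsilon>\<^sub>0"
    using \<gamma> by (intro omega_pow_less_epsilon_0 osuc_less_epsilon_0)
  have norm: "cnf_norm (omega_pow \<gamma> + \<alpha>) = cw \<gamma> + cnf_norm \<alpha>" if "\<alpha> < omega_pow (osuc \<gamma>)" for \<alpha>
  proof -
    have "omega_pow \<gamma> + \<alpha> < omega_pow (osuc \<gamma>)"
      using that by (intro add_less_omega_pow) (simp_all add: omega_pow_less_iff)
    then have "omega_pow \<gamma> + \<alpha> < \<epsilon>\<^sub>0" "\<alpha> < \<epsilon>\<^sub>0" using that e by auto
    then show ?thesis by (simp add: cnf_norm_eq_wt mcnf_def cnf_add_omega_pow[OF that])
  qed
  have eq: "{\<alpha>. \<alpha> < omega_pow \<gamma> + \<beta> \<and> R \<alpha> \<and> cnf_norm \<alpha> = n} =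
      {\<alpha>. \<alpha> < omega_pow \<gamma> \<and> R \<alpha> \<and> cnf_norm \<alpha> = n} \<union> (+) (omega_pow \<gamma>) ` T" (is "?L = ?A \<union> ?B")
  proof (rule subset_antisym[OF subsetI subsetI])
    fix \<alpha> assume \<alpha>: "\<alpha> \<in> ?L"
    show "\<alpha> \<in> ?A \<union> ?B"
    proof (cases "\<alpha> < omega_pow \<gamma>")
      case False
      then have "omega_pow \<gamma> \<le> \<alpha>" by simp
      then obtain \<delta> where \<delta>: "\<alpha> = omega_pow \<gamma> + \<delta>" by (rule le_imp_add_ordinal)
      then have "\<delta> < \<beta>" using \<alpha> by simp
      then have "\<delta> \<in> T" using \<alpha> norm[of \<delta>] \<beta> by (auto simp: T_def \<delta>)
      then show ?thesis using \<delta> by blast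
    qed (use \<alpha> in simp)
  next
    fix \<alpha> assume "\<alpha> \<in> ?A \<union> ?B"
    then show "\<alpha> \<in> ?L"
    proof
      assume "\<alpha> \<in> ?A"
      then show ?thesis using le_add1_ordinal[of "omega_pow \<gamma>" \<beta>] by auto
    next
      assume "\<alpha> \<in> ?B"
      then show ?thesis using norm \<beta> by (auto simp: T_def)
    qed
  qed
  have "?A \<inter> ?B = {}" using le_add1_ordinal[of "omega_pow \<gamma>"] by (auto simp: not_less[symmetric])
  moreover have finT: "finite T"
    by (rule finite_subset[OF _ finite_norm_le[of n]]) (use \<beta> e in \<open>auto simp: T_def\<close>)
  moreover have "finite ?A" using \<gamma> by (intro finite_norm_eq omega_pow_le_epsilon_0) simp
  ultimately have "card ?L = card ?A + card ?B"
    unfolding eq by (intro card_Un_disjoint) auto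
  also have "card ?B = card T" by (rule card_image) (auto simp: inj_on_def)
  also have "card T = (if cw \<gamma> \<le> n then ocount \<beta> (\<lambda>\<alpha>. R (omega_pow \<gamma> + \<alpha>)) (n - cw \<gamma>) else 0)"
    unfolding T_def ocount_def by (auto intro!: arg_cong[of _ _ card])
  finally show ?thesis by (simp add: ocount_def)
qed

text \<open>An ordinal \<open>\<beta>\<close> with leading term \<open>\<omega>\<^bsup>\<gamma>\<^esup> \<cdot> \<kappa>\<close> behaves like \<open>\<kappa>\<close> copies of \<open>\<omega>\<^bsup>\<gamma>\<^esup>\<close>.\<close>

lemma ocount_leading_coefficient:
  assumes \<gamma>: "0 < \<gamma>" "\<gamma> < \<epsilon>\<^sub>0"
    and ratio: "(\<lambda>n. real (wcount {..<\<gamma>} cw n) / real (wcount {..<\<gamma>} cw (Suc n))) \<longlonglongrightarrow> 1"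
    and \<beta>: "\<beta> < omega_pow (osuc \<gamma>)"
  shows "\<exists>\<kappa>::nat. (omega_pow \<gamma> \<le> \<beta> \<longrightarrow> 1 \<le> \<kappa>) \<and> (\<forall>R L.
    (\<forall>\<alpha><omega_pow (osuc \<gamma>). R (omega_pow \<gamma> + \<alpha>) = R \<alpha>) \<longrightarrow>
    (\<lambda>n. real (ocount (omega_pow \<gamma>) R n) / real (wcount {..<\<gamma>} cw n)) \<longlonglongrightarrow> L \<longrightarrow>
    (\<lambda>n. real (ocount \<beta> R n) / real (wcount {..<\<gamma>} cw n)) \<longlonglongrightarrow> real \<kappa> * L)"
proof -
  define A where "A n = real (wcount {..<\<gamma>} cw n)" for n
  have Apos: "A n > 0" for n
    using wcount_pos[OF graded_cw, of \<gamma> 0 n] \<gamma> by (simp add: A_def cw_0 less_imp_le)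
  have ratioA: "(\<lambda>n. A n / A (Suc n)) \<longlonglongrightarrow> 1" using ratio by (simp add: A_def)
  obtain k where k: "\<beta> < omega_pow \<gamma> * ofin k" using less_mult_ofin[OF \<beta>] by blast
  have "\<exists>\<kappa>::nat. (omega_pow \<gamma> \<le> \<beta> \<longrightarrow> 1 \<le> \<kappa>) \<and> (\<forall>R L.
    (\<forall>\<alpha><omega_pow (osuc \<gamma>). R (omega_pow \<gamma> + \<alpha>) = R \<alpha>) \<longrightarrow>
    (\<lambda>n. real (ocount (omega_pow \<gamma>) R n) / A n) \<longlonglongrightarrow> L \<longrightarrow>
    (\<lambda>n. real (ocount \<beta> R n) / A n) \<longlonglongrightarrow> real \<kappa> * L)"
    using k \<beta>
  \<comment> \<open>Each step strips one leading \<omega>^\<gamma>; by the ratio limit the shift of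
    the norm does not matter, and a remainder below \<omega>^\<gamma> counts for nothing. One
    \<kappa> for all \<open>R\<close> lets it cancel in quotients.\<close>
  proof (induction k arbitrary: \<beta>)
    case 0
    then show ?case by simp
  next
    case (Suc k)
    show ?case
    proof (cases "\<beta> < omega_pow \<gamma>")
      case True
      then show ?thesis
        using ocount_below_negligible[OF \<gamma>(2) True ratio] by (intro exI[of _ 0]) (auto simp: A_def)
    next
      case False
      then have le: "omega_pow \<gamma> \<le> \<beta>" by simp
      obtain \<beta>' where \<beta>': "\<beta> = omega_pow \<gamma> + \<beta>'" by (rule le_imp_add_ordinal[OF le])
      have "omega_pow \<gamma> * ofin (Suc k) = omega_pow \<gamma> + omega_pow \<gamma> * ofin k"
        using mult_ofin_add[of "omega_pow \<gamma>" 1 k] by (simp add: mult_osuc)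
      then have "\<beta>' < omega_pow \<gamma> * ofin k"
        using Suc.prems(1) unfolding \<beta>' by (simp del: funpow.simps)
      moreover have \<beta>'lt: "\<beta>' < omega_pow (osuc \<gamma>)"
        using Suc.prems(2) le_add2_ordinal[of \<beta>' "omega_pow \<gamma>"] unfolding \<beta>' by (rule order_le_less_trans[rotated])
      ultimately obtain \<kappa> :: nat where \<kappa>: "\<And>R L. (\<forall>\<alpha><omega_pow (osuc \<gamma>). R (omega_pow \<gamma> + \<alpha>) = R \<alpha>) \<Longrightarrow>
        (\<lambda>n. real (ocount (omega_pow \<gamma>) R n) / A n) \<longlonglongrightarrow> L \<Longrightarrow>
        (\<lambda>n. real (ocount \<beta>' R n) / A n) \<longlonglongrightarrow> real \<kappa> * L"
        using Suc.IH[of \<beta>'] by auto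
      have "(\<lambda>n. real (ocount \<beta> R n) / A n) \<longlonglongrightarrow> real (Suc \<kappa>) * L"
        if R: "\<forall>\<alpha><omega_pow (osuc \<gamma>). R (omega_pow \<gamma> + \<alpha>) = R \<alpha>"
          and L: "(\<lambda>n. real (ocount (omega_pow \<gamma>) R n) / A n) \<longlonglongrightarrow> L" for R L
      proof (rule LIMSEQ_offset[of _ "cw \<gamma>"])
        let ?w = "cw \<gamma>"
        have R': "ocount \<beta>' (\<lambda>\<alpha>. R (omega_pow \<gamma> + \<alpha>)) n = ocount \<beta>' R n" for n
          unfolding ocount_def using R \<beta>'lt by (intro arg_cong[of _ _ card]) auto
        have "(\<lambda>n. real (ocount (omega_pow \<gamma>) R (n + ?w)) / A (n + ?w) +
            real (ocount \<beta>' R n) / A n * (A n / A (n + ?w))) \<longlonglongrightarrow> L + real \<kappa> * L * 1 ^ ?w"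
          by (intro tendsto_add tendsto_mult \<kappa>[OF R L] ratio_tendsto_plus[OF ratioA]
              LIMSEQ_ignore_initial_segment[OF L]) simp
        moreover have "real (ocount (omega_pow \<gamma>) R (n + ?w)) / A (n + ?w) +
            real (ocount \<beta>' R n) / A n * (A n / A (n + ?w)) = real (ocount \<beta> R (n + ?w)) / A (n + ?w)" for n
          using Apos[of n] unfolding \<beta>' ocount_add_omega_pow[OF \<gamma>(2) \<beta>'lt] R'
          by (simp add: add_divide_distrib)
        ultimately show "(\<lambda>n. real (ocount \<beta> R (n + ?w)) / A (n + ?w)) \<longlonglongrightarrow> real (Suc \<kappa>) * L"
          by (simp add: algebra_simps)
      qed
      then show ?thesis by (intro exI[of _ "Suc \<kappa>"]) auto
    qed
  qed
  then show ?thesis by (simp add: A_def)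
qed

lemma one_mult_ofin: "1 * ofin k = ofin k"
  by (induction k) (simp_all add: mult_osuc add_1_ordinal)

lemma finite_lessThan_ofin: "finite {..<ofin m}"
proof (induction m)
  case (Suc m)
  have "{..<ofin (Suc m)} = insert (ofin m) {..<ofin m}" by (auto simp: less_osuc_iff)
  then show ?case using Suc by simp
qed (simp add: lessThan_def)

lemma wcount_cw_ratio_regular:
  assumes "\<omega> \<le> \<gamma>" "\<gamma> < \<epsilon>\<^sub>0"
    and "(\<lambda>n. real (ocount \<gamma> (\<lambda>_. True) n) / real (ocount \<gamma> (\<lambda>_. True) (Suc n))) \<longlonglongrightarrow> 1"
  shows "(\<lambda>k. real (pcount {..<\<gamma>} cw k) / real (pcount {..<\<gamma>} cw (Suc k))) \<longlonglongrightarrow> 1"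
    "\<exists>K. \<forall>k\<ge>K. pcount {..<\<gamma>} cw k \<le> pcount {..<\<gamma>} cw (Suc k) \<and> 1 \<le> pcount {..<\<gamma>} cw k"
proof -
  show lim: "(\<lambda>k. real (pcount {..<\<gamma>} cw k) / real (pcount {..<\<gamma>} cw (Suc k))) \<longlonglongrightarrow> 1"
    by (rule LIMSEQ_imp_Suc) (use assms(3) in \<open>simp add: pcount_cw\<close>)
  have "eventually (\<lambda>k. real (pcount {..<\<gamma>} cw k) / real (pcount {..<\<gamma>} cw (Suc k)) > 0) sequentially"
    using lim by (rule order_tendstoD) simp
  then obtain K1 where K1: "\<And>k. K1 \<le> k \<Longrightarrow> 1 \<le> pcount {..<\<gamma>} cw k"
    unfolding eventually_sequentially by (auto simp: zero_less_divide_iff Suc_le_eq)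
  obtain K2 where K2: "\<And>n. K2 \<le> n \<Longrightarrow> ocount \<gamma> (\<lambda>_. True) n \<le> ocount \<gamma> (\<lambda>_. True) (Suc n)"
    using ocount_eventually_mono[OF assms(1) less_imp_le[OF assms(2)]] by blast
  have "pcount {..<\<gamma>} cw k \<le> pcount {..<\<gamma>} cw (Suc k)" if "Suc K2 \<le> k" for k
    using K2[of "k - 1"] that by (cases k) (simp_all add: pcount_cw)
  then show "\<exists>K. \<forall>k\<ge>K. pcount {..<\<gamma>} cw k \<le> pcount {..<\<gamma>} cw (Suc k) \<and> 1 \<le> pcount {..<\<gamma>} cw k"
    using K1 by (intro exI[of _ "max K1 (Suc K2)"]) simp
qed

lemma less_omega_pow_osuc_0: "\<gamma> < omega_pow (osuc 0) \<Longrightarrow> \<gamma> < \<omega>"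
proof -
  assume "\<gamma> < omega_pow (osuc 0)"
  then obtain k where "\<gamma> < omega_pow 0 * ofin k" by (rule less_mult_ofin)
  then have "\<gamma> < ofin k" by (simp add: one_mult_ofin)
  then show "\<gamma> < \<omega>" using funpow_osuc_less_omega[of k] by (rule order_less_trans)
qed

text \<open>For infinite \<gamma> with leading power \<omega>^\<delta> one has \<delta> < \<gamma>,
  because \<delta> < \<omega>^\<delta> below \<open>\<epsilon>\<^sub>0\<close>. The hypothesis for
  \<delta> gives the ratio limit below \<omega>^\<delta>, the leading coefficient carries it over to
  \<gamma>, and this is the regularity of the parts required for \<omega>^\<gamma>.\<close>

lemma wcount_cw_ratio:
  assumes "0 < \<gamma>" "\<gamma> < \<epsilon>\<^sub>0"
  shows "(\<lambda>n. real (wcount {..<\<gamma>} cw n) / real (wcount {..<\<gamma>} cw (Suc n))) \<longlonglongrightarrow> 1 \<and>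
    (\<omega> \<le> \<gamma> \<longrightarrow> (\<lambda>n. real (ocount \<gamma> (\<lambda>_. True) n) / real (ocount \<gamma> (\<lambda>_. True) (Suc n))) \<longlonglongrightarrow> 1)"
  using assms
proof (induction \<gamma> rule: less_induct)
  case (less \<gamma>)
  have g: "graded {..<\<gamma>} cw" using less.prems by (intro graded_cw) simp
  have z: "0 \<in> {..<\<gamma>}" using less.prems by simp
  show ?case
  proof (cases "\<gamma> < \<omega>")
    case True
    then obtain m where "\<gamma> = ofin m" by (rule less_omegaE)
    then have "finite {..<\<gamma>}" using finite_lessThan_ofin by simp
    then have "dsum_small {..<\<gamma>} cw 1" by (rule dsum_small_finite[where x = 0]) (use z cw_0 in auto)
    then show ?thesis using wcount_ratio[OF g z cw_0] True by auto
  next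
    case False
    then have \<omega>: "\<omega> \<le> \<gamma>" by simp
    obtain \<delta> where \<delta>: "omega_pow \<delta> \<le> \<gamma>" "\<gamma> < omega_pow (osuc \<delta>)"
      using omega_pow_division[of \<gamma>] less.prems(1) by auto
    have \<delta>e: "\<delta> < \<epsilon>\<^sub>0"
      using le_omega_pow[of \<delta>] \<delta>(1) less.prems(2) by auto
    have \<delta>\<gamma>: "\<delta> < \<gamma>" using less_omega_pow[OF \<delta>e] \<delta>(1) by auto
    have \<delta>0: "0 < \<delta>"
    proof (rule ccontr)
      assume "\<not> 0 < \<delta>"
      then have "\<delta> = 0" by (simp add: ordinal_zero_less_iff)
      then show False using less_omega_pow_osuc_0[of \<gamma>] \<delta>(2) \<omega> by simp
    qed
    define A where "A n = real (wcount {..<\<delta>} cw n)" for n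
    have Apos: "A n > 0" for n
      using wcount_pos[OF graded_cw, of \<delta> 0 n] \<delta>0 \<delta>e by (simp add: A_def cw_0 less_imp_le)
    have rA: "(\<lambda>n. real (wcount {..<\<delta>} cw n) / real (wcount {..<\<delta>} cw (Suc n))) \<longlonglongrightarrow> 1"
      using less.IH[OF \<delta>\<gamma> \<delta>0 \<delta>e] by blast
    obtain \<kappa> :: nat where \<kappa>: "omega_pow \<delta> \<le> \<gamma> \<longrightarrow> 1 \<le> \<kappa>" and
      lim\<kappa>: "\<forall>R L. (\<forall>\<alpha><omega_pow (osuc \<delta>). R (omega_pow \<delta> + \<alpha>) = R \<alpha>) \<longrightarrow>
        (\<lambda>n. real (ocount (omega_pow \<delta>) R n) / real (wcount {..<\<delta>} cw n)) \<longlonglongrightarrow> L \<longrightarrow>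
        (\<lambda>n. real (ocount \<gamma> R n) / real (wcount {..<\<delta>} cw n)) \<longlonglongrightarrow> real \<kappa> * L"
      using ocount_leading_coefficient[OF \<delta>0 \<delta>e rA \<delta>(2)] by (elim exE conjE) (rule that)
    have "(\<lambda>n. real (ocount (omega_pow \<delta>) (\<lambda>_. True) n) / real (wcount {..<\<delta>} cw n)) \<longlonglongrightarrow> 1"
    proof -
      have "real (ocount (omega_pow \<delta>) (\<lambda>_. True) n) / real (wcount {..<\<delta>} cw n) = 1" for n
        using Apos[of n] \<delta>e by (simp add: ocount_omega_pow_True A_def)
      then show ?thesis by (simp only: tendsto_const)
    qed
    then have lim: "(\<lambda>n. real (ocount \<gamma> (\<lambda>_. True) n) / A n) \<longlonglongrightarrow> real \<kappa>"
      using lim\<kappa>[rule_format, of "\<lambda>_. True" 1] by (simp add: A_def)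
    have \<kappa>1: "real \<kappa> \<noteq> 0" using \<kappa> \<delta>(1) by simp
    have rlim: "(\<lambda>n. real (ocount \<gamma> (\<lambda>_. True) n) / A n * (A n / A (Suc n)) / (real (ocount \<gamma> (\<lambda>_. True) (Suc n)) / A (Suc n)))
        \<longlonglongrightarrow> real \<kappa> * 1 / real \<kappa>"
      using rA by (intro tendsto_mult tendsto_divide lim LIMSEQ_Suc[OF lim] \<kappa>1) (simp add: A_def)
    have req: "real (ocount \<gamma> (\<lambda>_. True) n) / A n * (A n / A (Suc n)) / (real (ocount \<gamma> (\<lambda>_. True) (Suc n)) / A (Suc n)) =
        real (ocount \<gamma> (\<lambda>_. True) n) / real (ocount \<gamma> (\<lambda>_. True) (Suc n))" for n
      using Apos[of n] Apos[of "Suc n"] by simp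
    have r: "(\<lambda>n. real (ocount \<gamma> (\<lambda>_. True) n) / real (ocount \<gamma> (\<lambda>_. True) (Suc n))) \<longlonglongrightarrow> 1"
      using rlim[unfolded req] \<kappa>1 by simp
    note reg = wcount_cw_ratio_regular[OF \<omega> less.prems(2) r]
    from reg(2) obtain K where
      K: "\<forall>k\<ge>K. pcount {..<\<gamma>} cw k \<le> pcount {..<\<gamma>} cw (Suc k) \<and> 1 \<le> pcount {..<\<gamma>} cw k" ..
    have "dsum_small {..<\<gamma>} cw 1"
      by (rule dsum_small_regular[OF g _ _ _ reg(1), of 1 K]) (use K in simp_all)
    then show ?thesis using wcount_ratio[OF g z cw_0] r by simp
  qed
qed

text \<open>Rescaling finitely many parts alters \<open>pcount\<close> at finitely many weights
  only, and all hypotheses of \<open>dsum_small_regular\<close> are asymptotic.\<close>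

lemma dsum_small_rescale:
  assumes g: "graded X s" and "finite Y" "0 < P" "0 < q"
    and K: "\<And>k. K \<le> k \<Longrightarrow> pcount X s k \<le> pcount X s (Suc k)" "\<And>k. K \<le> k \<Longrightarrow> 1 \<le> pcount X s k"
    and ratio: "(\<lambda>k. real (pcount X s k) / real (pcount X s (Suc k))) \<longlonglongrightarrow> 1"
  shows "dsum_small X (rescale P Y s) q"
proof -
  define B where "B = (\<Sum>x\<in>Y. P * s x)"
  have le: "P * s x \<le> B" if "x \<in> Y" for x
    unfolding B_def by (rule member_le_sum) (use that assms in auto)
  have eq: "pcount X (rescale P Y s) k = pcount X s k" if "B < k" for k
  proof -
    have "rescale P Y s x = k \<longleftrightarrow> s x = k" for x
    proof (cases "x \<in> Y")
      case True
      have "s x \<le> P * s x" using assms(3) by simp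
      then have "s x < k" "P * s x < k" using le[OF True] that by linarith+
      then show ?thesis using True by (simp add: rescale_def)
    qed (simp add: rescale_def)
    then show ?thesis by (simp add: pcount_def)
  qed
  have lim: "(\<lambda>k. real (pcount X (rescale P Y s) k) / real (pcount X (rescale P Y s) (Suc k))) \<longlonglongrightarrow> 1"
    using ratio
  proof (rule Lim_transform_eventually)
    show "eventually (\<lambda>k. real (pcount X s k) / real (pcount X s (Suc k)) =
        real (pcount X (rescale P Y s) k) / real (pcount X (rescale P Y s) (Suc k))) sequentially"
      using eventually_gt_at_top[of B] by eventually_elim (simp add: eq)
  qed
  show ?thesis
    by (rule dsum_small_regular[OF graded_rescale[OF g assms(3)] assms(4) _ _ lim, of "max K (Suc B)"])
      (use K in \<open>simp_all add: eq\<close>)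
qed

section \<open>The limit law below \<open>\<epsilon>\<^sub>0\<close>\<close>

text \<open>Outside a negligible set the coefficients of \<omega>^i for i < m have passed the
  threshold and \<omega>^m occurs, so truth depends on the residue vector alone. \<open>G\<close>
  collects the favourable vectors, and the limit is their share among all of them.\<close>

lemma limit_law_below_epsilon_0:
  assumes \<phi>: "sentence \<phi>" and \<beta>: "omega_pow \<omega> \<le> \<beta>" "\<beta> < \<epsilon>\<^sub>0"
  shows "\<exists>L. mso_fraction \<beta> \<phi> \<longlonglongrightarrow> L \<and> L \<in> \<rat>"
proof -
  from models_digits[OF \<phi>] obtain m t P where P: "P \<ge> 1" and dig:
    "\<forall>\<alpha> \<beta>. (\<exists>a\<in>set (cnf \<alpha>). ofin m \<le> a) \<longrightarrow> (\<exists>a\<in>set (cnf \<beta>). ofin m \<le> a) \<longrightarrow>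
      (\<forall>i<m. count (mset (cnf \<alpha>)) (ofin i) = count (mset (cnf \<beta>)) (ofin i) \<or>
        t \<le> count (mset (cnf \<alpha>)) (ofin i) \<and> t \<le> count (mset (cnf \<beta>)) (ofin i) \<and>
        count (mset (cnf \<alpha>)) (ofin i) mod P = count (mset (cnf \<beta>)) (ofin i) mod P) \<longrightarrow>
      (\<alpha> \<Turnstile> \<phi> \<longleftrightarrow> \<beta> \<Turnstile> \<phi>)"
    by (elim exE conjE) (rule that)
  have "\<beta> \<noteq> 0" using \<beta>(1) omega_pow_pos[of \<omega>] by auto
  then obtain \<gamma> where \<gamma>: "omega_pow \<gamma> \<le> \<beta>" "\<beta> < omega_pow (osuc \<gamma>)" by (rule omega_pow_division)
  have "omega_pow \<omega> < omega_pow (osuc \<gamma>)" using \<beta>(1) \<gamma>(2) by (rule order_le_less_trans)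
  then have \<omega>: "\<omega> \<le> \<gamma>" by (simp add: omega_pow_less_iff less_osuc_iff)
  have \<gamma>e: "\<gamma> < \<epsilon>\<^sub>0" using le_omega_pow[of \<gamma>] \<gamma>(1) \<beta>(2) by auto
  have ofin_lt: "ofin i < \<gamma>" for i using funpow_osuc_less_omega \<omega> by (rule order_less_le_trans)
  have \<gamma>0: "0 < \<gamma>" using ofin_lt[of 0] by simp
  define X where "X = {..<\<gamma>}"
  define A where "A n = real (wcount X cw n)" for n
  have g: "graded X cw" unfolding X_def using \<gamma>e by (intro graded_cw) simp
  have z: "0 \<in> X" using \<gamma>0 by (simp add: X_def)
  have Apos: "A n > 0" for n using wcount_pos[OF g z cw_0] by (simp add: A_def)
  have ratio: "(\<lambda>n. real (wcount X cw n) / real (wcount X cw (Suc n))) \<longlonglongrightarrow> 1"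
    and ratio': "(\<lambda>n. real (ocount \<gamma> (\<lambda>_. True) n) / real (ocount \<gamma> (\<lambda>_. True) (Suc n))) \<longlonglongrightarrow> 1"
    using wcount_cw_ratio[OF \<gamma>0 \<gamma>e] \<omega> by (simp_all add: X_def)
  note reg = wcount_cw_ratio_regular[OF \<omega> \<gamma>e ratio', folded X_def]
  from reg(2) obtain K where
    K: "\<forall>k\<ge>K. pcount X cw k \<le> pcount X cw (Suc k) \<and> 1 \<le> pcount X cw k" ..
  define Y where "Y = ofin ` {..<m}"
  have Y: "finite Y" "Y \<subseteq> X" using ofin_lt by (auto simp: Y_def X_def)
  have small: "dsum_small X (rescale P Y cw) q" if "0 < q" for q
    by (rule dsum_small_rescale[OF g Y(1) _ that _ _ reg(1), of P K]) (use P K in simp_all)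
  have inj: "ofin i = ofin j \<longleftrightarrow> i = j" for i j
    using ofin_less_iff[of i j] ofin_less_iff[of j i] by (metis less_irrefl linorder_neqE_nat)
  have notY: "ofin i \<in> X - Y" if "m \<le> i" for i
    using that ofin_lt[of i] by (auto simp: X_def Y_def inj)
  define res where "res M = restrict (\<lambda>x. count M x mod P) Y" for M :: "ordinal multiset"
  define good where "good M \<longleftrightarrow> 1 \<le> count M (ofin m) \<and> (\<forall>i<m. t \<le> count M (ofin i))" for M
  define G where "G = {res (mcnf \<alpha>) | \<alpha>. good (mcnf \<alpha>) \<and> \<alpha> \<Turnstile> \<phi>}"
  have resP: "res M \<in> (\<Pi>\<^sub>E x\<in>Y. {..<P})" for M using P by (auto simp: res_def)
  then have G: "G \<subseteq> (\<Pi>\<^sub>E x\<in>Y. {..<P})" by (auto simp: G_def)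
  have good_iff: "\<alpha> \<Turnstile> \<phi> \<longleftrightarrow> res (mcnf \<alpha>) \<in> G" if "good (mcnf \<alpha>)" for \<alpha>
  proof
    assume "\<alpha> \<Turnstile> \<phi>"
    then show "res (mcnf \<alpha>) \<in> G" using that by (auto simp: G_def)
  next
    assume "res (mcnf \<alpha>) \<in> G"
    then obtain \<alpha>' where \<alpha>': "res (mcnf \<alpha>) = res (mcnf \<alpha>')" "good (mcnf \<alpha>')" "\<alpha>' \<Turnstile> \<phi>"
      by (auto simp: G_def)
    have hi: "\<exists>a\<in>set (cnf \<delta>). ofin m \<le> a" if "good (mcnf \<delta>)" for \<delta>
    proof -
      have "0 < count (mcnf \<delta>) (ofin m)" using that by (simp add: good_def)
      then have "ofin m \<in> set (cnf \<delta>)" by (simp add: count_greater_zero_iff[symmetric] mcnf_def)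
      then show ?thesis by (intro bexI[of _ "ofin m"]) auto
    qed
    have mods: "count (mcnf \<alpha>) (ofin i) mod P = count (mcnf \<alpha>') (ofin i) mod P" if "i < m" for i
    proof -
      have "ofin i \<in> Y" using that by (simp add: Y_def)
      then show ?thesis using fun_cong[OF \<alpha>'(1), of "ofin i"] by (simp add: res_def)
    qed
    have "\<alpha> \<Turnstile> \<phi> \<longleftrightarrow> \<alpha>' \<Turnstile> \<phi>"
      using mods that \<alpha>'(2) by (intro dig[rule_format] hi) (simp_all add: good_def mcnf_def)
    then show "\<alpha> \<Turnstile> \<phi>" using \<alpha>'(3) by simp
  qed
  \<comment> \<open>\<gamma> is infinite, so a further leading \<omega>^\<gamma> touches none of the
    coefficients at finite exponents. This invariance is what transfers the limits from
    \<omega>^\<gamma> to \<beta>.\<close>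
  have inv: "res (mcnf (omega_pow \<gamma> + \<alpha>)) = res (mcnf \<alpha>)" "good (mcnf (omega_pow \<gamma> + \<alpha>)) = good (mcnf \<alpha>)"
    if "\<alpha> < omega_pow (osuc \<gamma>)" for \<alpha>
  proof -
    have "\<gamma> \<noteq> ofin i" for i using ofin_lt[of i] by auto
    then have "count (mcnf (omega_pow \<gamma> + \<alpha>)) (ofin i) = count (mcnf \<alpha>) (ofin i)" for i
      by (simp add: mcnf_def cnf_add_omega_pow[OF that])
    then show "res (mcnf (omega_pow \<gamma> + \<alpha>)) = res (mcnf \<alpha>)" "good (mcnf (omega_pow \<gamma> + \<alpha>)) = good (mcnf \<alpha>)"
      by (auto simp: res_def good_def Y_def fun_eq_iff restrict_def)
  qed
  define L where "L = real (card G) / real (card (\<Pi>\<^sub>E x\<in>Y. {..<P}))"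
  have limG: "(\<lambda>n. real (ocount (omega_pow \<gamma>) (\<lambda>\<alpha>. res (mcnf \<alpha>) \<in> G) n) / A n) \<longlonglongrightarrow> L"
  proof -
    \<comment> \<open>The exponents m and m + 1 lie outside \<open>Y\<close> and have the
      consecutive weights m + 1 and m + 2.\<close>
    have cws: "cw (ofin (Suc m)) = Suc (cw (ofin m))" "0 < cw (ofin m)" "0 < cw (ofin (Suc m))"
      by (simp_all only: cw_ofin zero_less_Suc)
    have "(\<lambda>n. real (card {M \<in> wmsets X cw n. restrict (\<lambda>x. count M x mod P) Y \<in> G}) / real (wcount X cw n)) \<longlonglongrightarrow> L"
      unfolding L_def
      by (rule residues_equidistributed[OF g z cw_0 ratio Y _ notY[of m] notY[of "Suc m"] cws(1) small small G])
        (use P cws in simp_all)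
    then show ?thesis
      using ocount_omega_pow[OF less_imp_le[OF \<gamma>e], of "\<lambda>M. res M \<in> G"] by (simp add: A_def X_def res_def)
  qed
  have limbad: "(\<lambda>n. real (ocount (omega_pow \<gamma>) (\<lambda>\<alpha>. \<not> good (mcnf \<alpha>)) n) / A n) \<longlonglongrightarrow> 0"
  proof -
    define S where "S n i k = {M \<in> wmsets X cw n. count M (ofin i) < k}" for n i k
    have finS: "finite (S n i k)" for n i k using finite_wmsets[OF g] by (simp add: S_def)
    have ofinX: "ofin i \<in> X" for i using ofin_lt by (simp add: X_def)
    have limS: "(\<lambda>n. real (card (S n i k)) / A n) \<longlonglongrightarrow> 0" for i k
      unfolding S_def A_def by (rule card_count_less_negligible[OF g ofinX ratio])
    have le: "ocount (omega_pow \<gamma>) (\<lambda>\<alpha>. \<not> good (mcnf \<alpha>)) n \<le> card (S n m 1) + (\<Sum>i<m. card (S n i t))" for n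
    proof -
      have "{M \<in> wmsets X cw n. \<not> good M} \<subseteq> S n m 1 \<union> (\<Union>i<m. S n i t)"
        by (auto simp: good_def S_def not_le)
      then have "card {M \<in> wmsets X cw n. \<not> good M} \<le> card (S n m 1 \<union> (\<Union>i<m. S n i t))"
        using finS by (intro card_mono) auto
      also have "\<dots> \<le> card (S n m 1) + card (\<Union>i<m. S n i t)" by (rule card_Un_le)
      also have "card (\<Union>i<m. S n i t) \<le> (\<Sum>i<m. card (S n i t))" by (rule card_UN_le) simp
      finally show ?thesis
        using ocount_omega_pow[OF less_imp_le[OF \<gamma>e], of "\<lambda>M. \<not> good M" n] by (simp add: X_def)
    qed
    have lim0: "(\<lambda>n. real (card (S n m 1)) / A n + (\<Sum>i<m. real (card (S n i t)) / A n)) \<longlonglongrightarrow> 0 + (\<Sum>i<m. 0)"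
      by (intro tendsto_add tendsto_sum limS)
    show ?thesis
    proof (rule tendsto_sandwich[OF _ _ tendsto_const])
      show "(\<lambda>n. real (card (S n m 1)) / A n + (\<Sum>i<m. real (card (S n i t)) / A n)) \<longlonglongrightarrow> 0"
        using lim0 by simp
      show "eventually (\<lambda>n. real (ocount (omega_pow \<gamma>) (\<lambda>\<alpha>. \<not> good (mcnf \<alpha>)) n) / A n \<le>
          real (card (S n m 1)) / A n + (\<Sum>i<m. real (card (S n i t)) / A n)) sequentially"
      proof (intro always_eventually allI)
        fix n
        have "real (ocount (omega_pow \<gamma>) (\<lambda>\<alpha>. \<not> good (mcnf \<alpha>)) n) \<le> real (card (S n m 1)) + (\<Sum>i<m. real (card (S n i t)))"
          using le[of n] by (metis of_nat_add of_nat_le_iff of_nat_sum)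
        from divide_right_mono[OF this, of "A n"]
        show "real (ocount (omega_pow \<gamma>) (\<lambda>\<alpha>. \<not> good (mcnf \<alpha>)) n) / A n \<le>
            real (card (S n m 1)) / A n + (\<Sum>i<m. real (card (S n i t)) / A n)"
          using Apos[of n] by (simp add: add_divide_distrib sum_divide_distrib)
      qed
    qed (simp add: A_def)
  qed
  have limT: "(\<lambda>n. real (ocount (omega_pow \<gamma>) (\<lambda>_. True) n) / A n) \<longlonglongrightarrow> 1"
  proof -
    have "real (ocount (omega_pow \<gamma>) (\<lambda>_. True) n) / A n = 1" for n
      using Apos[of n] \<gamma>e by (simp add: ocount_omega_pow_True A_def X_def)
    then show ?thesis by (simp only: tendsto_const)
  qed
  have rX: "(\<lambda>n. real (wcount {..<\<gamma>} cw n) / real (wcount {..<\<gamma>} cw (Suc n))) \<longlonglongrightarrow> 1"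
    using ratio by (simp add: X_def)
  obtain \<kappa> :: nat where \<kappa>: "omega_pow \<gamma> \<le> \<beta> \<longrightarrow> 1 \<le> \<kappa>" and
    lim\<kappa>: "\<forall>R L. (\<forall>\<alpha><omega_pow (osuc \<gamma>). R (omega_pow \<gamma> + \<alpha>) = R \<alpha>) \<longrightarrow>
      (\<lambda>n. real (ocount (omega_pow \<gamma>) R n) / real (wcount {..<\<gamma>} cw n)) \<longlonglongrightarrow> L \<longrightarrow>
      (\<lambda>n. real (ocount \<beta> R n) / real (wcount {..<\<gamma>} cw n)) \<longlonglongrightarrow> real \<kappa> * L"
    using ocount_leading_coefficient[OF \<gamma>0 \<gamma>e rX \<gamma>(2)] by (elim exE conjE) (rule that)
  have \<kappa>0: "real \<kappa> \<noteq> 0" using \<kappa> \<gamma>(1) by simp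
  have lim1: "(\<lambda>n. real (ocount \<beta> (\<lambda>_. True) n) / A n) \<longlonglongrightarrow> real \<kappa> * 1"
    using lim\<kappa>[rule_format, of "\<lambda>_. True" 1] limT by (simp add: A_def X_def)
  have lim2: "(\<lambda>n. real (ocount \<beta> (\<lambda>\<alpha>. res (mcnf \<alpha>) \<in> G) n) / A n) \<longlonglongrightarrow> real \<kappa> * L"
    using lim\<kappa>[rule_format, of "\<lambda>\<alpha>. res (mcnf \<alpha>) \<in> G" L] limG inv(1) by (simp add: A_def X_def)
  have lim3: "(\<lambda>n. real (ocount \<beta> (\<lambda>\<alpha>. \<not> good (mcnf \<alpha>)) n) / A n) \<longlonglongrightarrow> real \<kappa> * 0"
    using lim\<kappa>[rule_format, of "\<lambda>\<alpha>. \<not> good (mcnf \<alpha>)" 0] limbad inv(2) by (simp add: A_def X_def)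
  have diff: "\<bar>real (ocount \<beta> (\<lambda>\<alpha>. \<alpha> \<Turnstile> \<phi>) n) - real (ocount \<beta> (\<lambda>\<alpha>. res (mcnf \<alpha>) \<in> G) n)\<bar>
      \<le> real (ocount \<beta> (\<lambda>\<alpha>. \<not> good (mcnf \<alpha>)) n)" for n
  proof -
    have le: "ocount \<beta> R n \<le> ocount \<beta> R' n + ocount \<beta> (\<lambda>\<alpha>. \<not> good (mcnf \<alpha>)) n"
      if "\<And>\<alpha>. good (mcnf \<alpha>) \<Longrightarrow> R \<alpha> \<Longrightarrow> R' \<alpha>" for R R'
    proof -
      have "ocount \<beta> R n \<le> card ({\<alpha>. \<alpha> < \<beta> \<and> R' \<alpha> \<and> cnf_norm \<alpha> = n} \<union> {\<alpha>. \<alpha> < \<beta> \<and> \<not> good (mcnf \<alpha>) \<and> cnf_norm \<alpha> = n})"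
        unfolding ocount_def using that \<beta>(2)
        by (intro card_mono finite_UnI finite_norm_eq) (auto intro: less_imp_le)
      also have "\<dots> \<le> ocount \<beta> R' n + ocount \<beta> (\<lambda>\<alpha>. \<not> good (mcnf \<alpha>)) n"
        unfolding ocount_def by (rule card_Un_le)
      finally show ?thesis .
    qed
    show ?thesis
      using le[of "\<lambda>\<alpha>. \<alpha> \<Turnstile> \<phi>" "\<lambda>\<alpha>. res (mcnf \<alpha>) \<in> G"] le[of "\<lambda>\<alpha>. res (mcnf \<alpha>) \<in> G" "\<lambda>\<alpha>. \<alpha> \<Turnstile> \<phi>"] good_iff
      by auto
  qed
  have lim4: "(\<lambda>n. real (ocount \<beta> (\<lambda>\<alpha>. \<alpha> \<Turnstile> \<phi>) n) / A n - real (ocount \<beta> (\<lambda>\<alpha>. res (mcnf \<alpha>) \<in> G) n) / A n) \<longlonglongrightarrow> 0"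
  proof (rule Lim_null_comparison[OF _ lim3[simplified]])
    show "eventually (\<lambda>n. norm (real (ocount \<beta> (\<lambda>\<alpha>. \<alpha> \<Turnstile> \<phi>) n) / A n - real (ocount \<beta> (\<lambda>\<alpha>. res (mcnf \<alpha>) \<in> G) n) / A n)
        \<le> real (ocount \<beta> (\<lambda>\<alpha>. \<not> good (mcnf \<alpha>)) n) / A n) sequentially"
    proof (intro always_eventually allI)
      fix n
      show "norm (real (ocount \<beta> (\<lambda>\<alpha>. \<alpha> \<Turnstile> \<phi>) n) / A n - real (ocount \<beta> (\<lambda>\<alpha>. res (mcnf \<alpha>) \<in> G) n) / A n)
          \<le> real (ocount \<beta> (\<lambda>\<alpha>. \<not> good (mcnf \<alpha>)) n) / A n"
        using divide_right_mono[OF diff[of n] less_imp_le[OF Apos[of n]]] Apos[of n]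
        by (simp add: diff_divide_distrib[symmetric] abs_divide)
    qed
  qed
  have "(\<lambda>n. real (ocount \<beta> (\<lambda>\<alpha>. \<alpha> \<Turnstile> \<phi>) n) / A n) \<longlonglongrightarrow> real \<kappa> * L"
    using tendsto_add[OF lim4 lim2] by simp
  then have flim: "(\<lambda>n. (real (ocount \<beta> (\<lambda>\<alpha>. \<alpha> \<Turnstile> \<phi>) n) / A n) / (real (ocount \<beta> (\<lambda>_. True) n) / A n)) \<longlonglongrightarrow> (real \<kappa> * L) / (real \<kappa> * 1)"
    using lim1 by (rule tendsto_divide) (use \<kappa>0 in simp)
  have feq: "(real (ocount \<beta> (\<lambda>\<alpha>. \<alpha> \<Turnstile> \<phi>) n) / A n) / (real (ocount \<beta> (\<lambda>_. True) n) / A n) = mso_fraction \<beta> \<phi> n" for n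
    using Apos[of n] by (simp add: mso_fraction_def ocount_def)
  have "mso_fraction \<beta> \<phi> \<longlonglongrightarrow> L" using flim[unfolded feq] \<kappa>0 by simp
  moreover have "L \<in> \<rat>" unfolding L_def by (intro Rats_divide Rats_of_nat)
  ultimately show ?thesis by blast
qed

section \<open>The limit law at \<open>\<epsilon>\<^sub>0\<close>\<close>

lemma summable_poly_geometric:
  fixes r :: real
  assumes "0 < r" "r < 1"
  shows "summable (\<lambda>k. (real k + 1) ^ d * r ^ k)"
  using assms
proof (induction d arbitrary: r)
  case 0
  then show ?case by (simp add: summable_geometric)
next
  case (Suc d)
  define s where "s = sqrt r"
  have s: "0 < s" "s < 1" "s * s = r" using Suc.prems by (auto simp: s_def)
  have "(\<lambda>n. real n * s ^ n) \<longlonglongrightarrow> 0"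
    using powser_times_n_limit_0[of s] s by simp
  then have "Bseq (\<lambda>n. real n * s ^ n)" by (intro convergent_imp_Bseq convergentI)
  then obtain B where B: "0 < B" "\<And>n. norm (real n * s ^ n) \<le> B" by (auto simp: Bseq_def)
  have le: "(real k + 1) * s ^ k \<le> B + 1" for k
  proof -
    have "s ^ k \<le> 1" using s by (intro power_le_one) auto
    then show ?thesis using B(2)[of k] s by (simp add: distrib_right)
  qed
  show ?case
  proof (rule summable_comparison_test')
    show "summable (\<lambda>k. (B + 1) * ((real k + 1) ^ d * s ^ k))"
      by (intro summable_mult Suc.IH s)
    fix k :: nat
    have "(real k + 1) ^ Suc d * r ^ k = (real k + 1) * s ^ k * ((real k + 1) ^ d * s ^ k)"
      by (simp add: s(3)[symmetric] power_mult_distrib)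
    also have "\<dots> \<le> (B + 1) * ((real k + 1) ^ d * s ^ k)"
      using s by (intro mult_right_mono le) auto
    finally show "norm ((real k + 1) ^ Suc d * r ^ k) \<le> (B + 1) * ((real k + 1) ^ d * s ^ k)"
      using Suc.prems by simp
  qed
qed

text \<open>From \<open>n0\<close> on each step gains the factor \<open>r\<close>. The at most
  \<open>n0\<close> earlier steps rely on monotonicity and are paid for by
  \<open>K = 1 / r ^ n0\<close>, which makes the estimate uniform in \<open>j\<close> and
  \<open>n\<close>.\<close>

lemma geometric_decay:
  fixes c :: "nat \<Rightarrow> real"
  assumes pos: "\<And>n. c n > 0" and mono: "\<And>m n. m \<le> n \<Longrightarrow> c m \<le> c n"
    and ratio: "(\<lambda>n. c n / c (Suc n)) \<longlonglongrightarrow> \<rho>" and r: "\<rho> < r" "0 < r" "r < 1"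
  obtains K where "K > 0" "\<And>j n. j \<le> n \<Longrightarrow> c j \<le> K * r ^ (n - j) * c n"
proof -
  have "eventually (\<lambda>n. c n / c (Suc n) < r) sequentially"
    using ratio r(1) by (rule order_tendstoD)
  then obtain n0 where n0: "\<And>n. n0 \<le> n \<Longrightarrow> c n / c (Suc n) < r"
    unfolding eventually_sequentially by auto
  have *: "r ^ n0 * c j \<le> r ^ (n - j) * c n" if "j \<le> n" for j n
    using that
  proof (induction n rule: dec_induct)
    case base
    have "r ^ n0 \<le> 1" using r by (intro power_le_one) auto
    then show ?case using pos[of j] by simp
  next
    case (step n)
    show ?case
    proof (cases "n0 \<le> n")
      case True
      have "c n \<le> r * c (Suc n)"
        using n0[OF True] pos[of "Suc n"] by (simp add: pos_divide_less_eq)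
      then have "r ^ (n - j) * c n \<le> r ^ (n - j) * (r * c (Suc n))"
        using r by (intro mult_left_mono) auto
      also have "\<dots> = r ^ (Suc n - j) * c (Suc n)" using step.hyps by (simp add: Suc_diff_le)
      finally show ?thesis using step.IH by simp
    next
      case False
      then have "r ^ n0 \<le> r ^ (Suc n - j)" using r by (intro power_decreasing) auto
      then show ?thesis using mono[of j "Suc n"] step.hyps pos[of j] r by (intro mult_mono) auto
    qed
  qed
  have "c j \<le> 1 / r ^ n0 * r ^ (n - j) * c n" if "j \<le> n" for j n
    using *[OF that] r by (simp add: field_simps)
  moreover have "1 / r ^ n0 > 0" using r by simp
  ultimately show thesis using that by blast
qed

text \<open>Because \<omega>^\<epsilon> = \<epsilon> for \<epsilon> =
  \<open>\<epsilon>\<^sub>0\<close>, the numbers of parts are the numbers of multisets shifted by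
  one. This turns the general recursion and \<open>wcount_first_part\<close> into the hypotheses of
  \<open>otter\<close>.\<close>

lemma wcount_epsilon_0_ratio:
  obtains \<rho> where "0 < \<rho>" "\<rho> < 1"
    "(\<lambda>n. real (wcount {..<\<epsilon>\<^sub>0} cw n) / real (wcount {..<\<epsilon>\<^sub>0} cw (Suc n))) \<longlonglongrightarrow> \<rho>"
proof -
  have g: "graded {..<\<epsilon>\<^sub>0} cw" by (rule graded_cw) simp
  have z: "0 \<in> {..<\<epsilon>\<^sub>0}" using epsilon_0_pos by simp
  have p: "pcount {..<\<epsilon>\<^sub>0} cw (Suc k) = wcount {..<\<epsilon>\<^sub>0} cw k" for k
    using ocount_omega_pow_True[of "\<epsilon>\<^sub>0" k] by (simp add: pcount_cw epsilon_0_fixpoint)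
  have "otter (\<lambda>n. real (wcount {..<\<epsilon>\<^sub>0} cw n))"
  proof
    show "real (wcount {..<\<epsilon>\<^sub>0} cw 0) = 1" by (simp add: wcount_0[OF g])
    show "0 < real (wcount {..<\<epsilon>\<^sub>0} cw n)" for n using wcount_pos[OF g z cw_0, of n] by simp
    show "real (wcount {..<\<epsilon>\<^sub>0} cw (Suc n)) \<le>
        (\<Sum>k\<le>n. real (wcount {..<\<epsilon>\<^sub>0} cw k) * real (wcount {..<\<epsilon>\<^sub>0} cw (n - k)))" for n
    proof -
      have "real (wcount {..<\<epsilon>\<^sub>0} cw (Suc n)) \<le> real (\<Sum>k\<le>n. wcount {..<\<epsilon>\<^sub>0} cw k * wcount {..<\<epsilon>\<^sub>0} cw (n - k))"
        using wcount_first_part[OF g, of n] unfolding p by (simp only: of_nat_le_iff)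
      then show ?thesis by simp
    qed
    fix n
    have "dsum {..<\<epsilon>\<^sub>0} cw k = (\<Sum>d | d dvd k. d * wcount {..<\<epsilon>\<^sub>0} cw (d - 1))" if "k \<in> {1..n}" for k
    proof -
      have k: "0 < k" using that by simp
      have "pcount {..<\<epsilon>\<^sub>0} cw d = wcount {..<\<epsilon>\<^sub>0} cw (d - 1)" if "d dvd k" for d
        using p[of "d - 1"] dvd_pos_nat[OF k that] by simp
      then show ?thesis unfolding dsum_eq_pcount[OF g k] by (intro sum.cong) auto
    qed
    then have "n * wcount {..<\<epsilon>\<^sub>0} cw n =
        (\<Sum>k=1..n. (\<Sum>d | d dvd k. d * wcount {..<\<epsilon>\<^sub>0} cw (d - 1)) * wcount {..<\<epsilon>\<^sub>0} cw (n - k))"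
      unfolding wcount_identity[OF g, of n] by (intro sum.cong) auto
    from arg_cong[OF this, of real]
    show "real n * real (wcount {..<\<epsilon>\<^sub>0} cw n) =
        (\<Sum>k=1..n. (\<Sum>d | d dvd k. real d * real (wcount {..<\<epsilon>\<^sub>0} cw (d - 1))) * real (wcount {..<\<epsilon>\<^sub>0} cw (n - k)))"
      by simp
  qed
  then interpret otter "\<lambda>n. real (wcount {..<\<epsilon>\<^sub>0} cw n)" .
  show thesis
    using that[of "1 / \<mu>"] c_ratio \<mu>_gt_1 by simp
qed

text \<open>As soon as an exponent from \<open>m\<close> on occurs, truth depends only on the part
  of the normal form with exponents below \<open>m\<close>; \<open>V\<close> collects the favourable
  low parts. With \<open>h k\<close> of them in weight k, the share of ordinals with such a low part
  tends to \<open>h k * (b * \<rho> ^ k)\<close>, and the limit is the sum of these shares.\<close>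

lemma limit_law_epsilon_0:
  assumes \<phi>: "sentence \<phi>"
  shows "\<exists>L. mso_fraction \<epsilon>\<^sub>0 \<phi> \<longlonglongrightarrow> L"
proof -
  from models_digits[OF \<phi>] obtain m t P where dig:
    "\<forall>\<alpha> \<beta>. (\<exists>a\<in>set (cnf \<alpha>). ofin m \<le> a) \<longrightarrow> (\<exists>a\<in>set (cnf \<beta>). ofin m \<le> a) \<longrightarrow>
      (\<forall>i<m. count (mset (cnf \<alpha>)) (ofin i) = count (mset (cnf \<beta>)) (ofin i) \<or>
        t \<le> count (mset (cnf \<alpha>)) (ofin i) \<and> t \<le> count (mset (cnf \<beta>)) (ofin i) \<and>
        count (mset (cnf \<alpha>)) (ofin i) mod P = count (mset (cnf \<beta>)) (ofin i) mod P) \<longrightarrow>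
      (\<alpha> \<Turnstile> \<phi> \<longleftrightarrow> \<beta> \<Turnstile> \<phi>)"
    by (elim exE conjE) (rule that)
  define X where "X = {..<\<epsilon>\<^sub>0}"
  define c where "c n = real (wcount X cw n)" for n
  have g: "graded X cw" unfolding X_def by (rule graded_cw) simp
  have z: "0 \<in> X" using epsilon_0_pos by (simp add: X_def)
  have cpos: "c n > 0" for n using wcount_pos[OF g z cw_0] by (simp add: c_def)
  have cmono: "c i \<le> c j" if "i \<le> j" for i j using wcount_mono[OF g z cw_0 that] by (simp add: c_def)
  obtain \<rho> where \<rho>: "0 < \<rho>" "\<rho> < 1" and
    "(\<lambda>n. real (wcount {..<\<epsilon>\<^sub>0} cw n) / real (wcount {..<\<epsilon>\<^sub>0} cw (Suc n))) \<longlonglongrightarrow> \<rho>"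
    by (rule wcount_epsilon_0_ratio)
  then have ratio: "(\<lambda>n. real (wcount X cw n) / real (wcount X cw (Suc n))) \<longlonglongrightarrow> \<rho>"
    by (simp add: X_def)
  have ratioc: "(\<lambda>n. c n / c (Suc n)) \<longlonglongrightarrow> \<rho>" using ratio by (simp add: c_def)
  obtain r where r: "\<rho> < r" "r < 1" using dense[OF \<rho>(2)] by blast
  have r0: "0 < r" using \<rho>(1) r(1) by simp
  obtain K where K: "K > 0" and decay: "\<And>j n. j \<le> n \<Longrightarrow> c j \<le> K * r ^ (n - j) * c n"
    using geometric_decay[OF cpos cmono ratioc r(1) r0 r(2)] by metis
  define Y where "Y = ofin ` {..<m}"
  have Y: "finite Y" "Y \<subseteq> X" using ofin_less_epsilon_0 by (auto simp: Y_def X_def)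
  have gY: "graded Y cw" by (rule graded_subset[OF g Y(2)])
  define low where "low M = filter_mset (\<lambda>x. x \<in> Y) M" for M
  have Y_eq: "Y = {..<ofin m}"
  proof -
    have "a \<in> Y" if "a < ofin m" for a
    proof -
      have "a < \<omega>" using that funpow_osuc_less_omega[of m] by (rule order_less_trans)
      then obtain i where "a = ofin i" by (rule less_omegaE)
      then show ?thesis using that by (auto simp: Y_def ofin_less_iff)
    qed
    then show ?thesis by (auto simp: Y_def ofin_less_iff)
  qed
  have hi: "(\<exists>a\<in>set (cnf \<alpha>). ofin m \<le> a) \<longleftrightarrow> low (mcnf \<alpha>) \<noteq> mcnf \<alpha>" for \<alpha>
  proof -
    have "low (mcnf \<alpha>) = mcnf \<alpha> \<longleftrightarrow> (\<forall>a\<in>set (cnf \<alpha>). a \<in> Y)"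
      by (simp add: low_def filter_mset_eq_conv)
    moreover have "(\<exists>a\<in>set (cnf \<alpha>). ofin m \<le> a) \<longleftrightarrow> \<not> (\<forall>a\<in>set (cnf \<alpha>). a \<in> Y)"
      by (simp add: Y_eq not_less)
    ultimately show ?thesis by simp
  qed
  define V where "V = {low (mcnf \<alpha>) | \<alpha>. low (mcnf \<alpha>) \<noteq> mcnf \<alpha> \<and> \<alpha> \<Turnstile> \<phi>}"
  have V_iff: "\<alpha> \<Turnstile> \<phi> \<longleftrightarrow> low (mcnf \<alpha>) \<in> V" if h: "low (mcnf \<alpha>) \<noteq> mcnf \<alpha>" for \<alpha>
  proof
    assume "\<alpha> \<Turnstile> \<phi>"
    then show "low (mcnf \<alpha>) \<in> V" using h by (auto simp: V_def)
  next
    assume "low (mcnf \<alpha>) \<in> V"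
    then obtain \<alpha>' where \<alpha>': "low (mcnf \<alpha>) = low (mcnf \<alpha>')" "low (mcnf \<alpha>') \<noteq> mcnf \<alpha>'" "\<alpha>' \<Turnstile> \<phi>"
      by (auto simp: V_def)
    have "count (mcnf \<alpha>) (ofin i) = count (mcnf \<alpha>') (ofin i)" if "i < m" for i
    proof -
      have "ofin i \<in> Y" using that by (simp add: Y_def)
      then have "count (mcnf \<delta>) (ofin i) = count (low (mcnf \<delta>)) (ofin i)" for \<delta> by (simp add: low_def)
      then show ?thesis using \<alpha>'(1) by metis
    qed
    then have eq: "\<forall>i<m. count (mset (cnf \<alpha>)) (ofin i) = count (mset (cnf \<alpha>')) (ofin i)"
      by (simp add: mcnf_def)
    have "\<exists>a\<in>set (cnf \<alpha>). ofin m \<le> a" "\<exists>a\<in>set (cnf \<alpha>'). ofin m \<le> a"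
      using hi[of \<alpha>] hi[of \<alpha>'] h \<alpha>'(2) by blast+
    then have "\<alpha> \<Turnstile> \<phi> \<longleftrightarrow> \<alpha>' \<Turnstile> \<phi>" using dig eq by blast
    then show "\<alpha> \<Turnstile> \<phi>" using \<alpha>'(3) by simp
  qed
  define h where "h k = real (card (wmsets Y cw k \<inter> V))" for k
  define B where "B n = real (wcount (X - Y) cw n)" for n
  have h_le: "h k \<le> (real k + 1) ^ card Y" for k
  proof -
    have "card (wmsets Y cw k \<inter> V) \<le> wcount Y cw k"
      unfolding wcount_def by (intro card_mono finite_wmsets gY) auto
    also have "\<dots> \<le> (k + 1) ^ card Y" by (rule wcount_finite_le[OF Y(1) gY])
    finally have "h k \<le> real ((k + 1) ^ card Y)" unfolding h_def by (simp only: of_nat_le_iff)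
    then show ?thesis by (simp add: add.commute)
  qed
  have B_le: "B n \<le> c n" for n
  proof -
    have "wmsets (X - Y) cw n \<subseteq> wmsets X cw n" by (auto simp: wmsets_def)
    then show ?thesis
      unfolding B_def c_def wcount_def of_nat_le_iff by (intro card_mono finite_wmsets g)
  qed
  obtain b where b: "(\<lambda>n. B n / c n) \<longlonglongrightarrow> b"
    using wcount_remove_ratio[OF g Y ratio \<rho>(1)] unfolding B_def c_def by blast
  define a where "a k n = (if k \<le> n then h k * B (n - k) / c n else 0)" for k n
  have alim: "(\<lambda>n. a k n) \<longlonglongrightarrow> h k * (b * \<rho> ^ k)" for k
  proof (rule LIMSEQ_offset[of _ k])
    have lim: "(\<lambda>n. h k * (B n / c n * (c n / c (n + k)))) \<longlonglongrightarrow> h k * (b * \<rho> ^ k)"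
      by (intro tendsto_mult tendsto_const b ratio_tendsto_plus[OF ratioc \<rho>(1)])
    have eq: "h k * (B n / c n * (c n / c (n + k))) = a k (n + k)" for n
      using cpos[of n] by (simp add: a_def)
    show "(\<lambda>n. a k (n + k)) \<longlonglongrightarrow> h k * (b * \<rho> ^ k)" by (rule lim[unfolded eq])
  qed
  \<comment> \<open>\<open>h\<close> grows polynomially, and removing weight k from n costs a factor
    of at most \<open>K * r ^ k\<close>.\<close>
  have abound: "norm (a k n) \<le> K * ((real k + 1) ^ card Y * r ^ k)" for k n
  proof (cases "k \<le> n")
    case True
    have "B (n - k) / c n \<le> K * r ^ k"
      using B_le[of "n - k"] decay[of "n - k" n] True cpos[of n] by (simp add: pos_divide_le_eq)
    then have "h k * (B (n - k) / c n) \<le> (real k + 1) ^ card Y * (K * r ^ k)"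
      using cpos[of n] by (intro mult_mono h_le) (auto simp: B_def intro!: divide_nonneg_pos)
    moreover have "0 \<le> h k * (B (n - k) / c n)"
      using cpos[of n] by (intro mult_nonneg_nonneg divide_nonneg_pos) (auto simp: h_def B_def)
    ultimately show ?thesis using True by (simp add: a_def ac_simps)
  qed (use K r0 in \<open>simp add: a_def\<close>)
  have smM: "summable (\<lambda>k. K * ((real k + 1) ^ card Y * r ^ k))"
    by (intro summable_mult summable_poly_geometric r0 r(2))
  have lima: "((\<lambda>n. \<Sum>k. a k n) \<longlongrightarrow> (\<Sum>k. h k * (b * \<rho> ^ k))) sequentially"
  proof -
    have "eventually (\<lambda>(k, n). norm (a k n) \<le> K * ((real k + 1) ^ card Y * r ^ k)) (at_top \<times>\<^sub>F sequentially)"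
      by (intro always_eventually allI) (auto simp only: split_def intro!: abound)
    from tannerys_theorem[OF alim this smM] show ?thesis by simp
  qed
  have suma: "(\<Sum>k. a k n) = real (card {M \<in> wmsets X cw n. low M \<in> V}) / c n" for n
  proof -
    have "(\<Sum>k. a k n) = (\<Sum>k\<le>n. a k n)" by (rule suminf_finite) (auto simp: a_def)
    also have "\<dots> = (\<Sum>k\<le>n. h k * B (n - k)) / c n" by (simp add: a_def sum_divide_distrib)
    also have "(\<Sum>k\<le>n. h k * B (n - k)) = real (card {M \<in> wmsets X cw n. low M \<in> V})"
      unfolding low_def card_split[OF g Y(2)] by (simp add: h_def B_def)
    finally show ?thesis .
  qed
  have lim1: "(\<lambda>n. real (card {M \<in> wmsets X cw n. low M \<in> V}) / c n) \<longlonglongrightarrow> (\<Sum>k. h k * (b * \<rho> ^ k))"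
    by (rule lima[unfolded suma])
  have oc: "ocount \<epsilon>\<^sub>0 (\<lambda>\<alpha>. low (mcnf \<alpha>) \<in> V) n = card {M \<in> wmsets X cw n. low M \<in> V}" for n
    using ocount_omega_pow[of "\<epsilon>\<^sub>0" "\<lambda>M. low M \<in> V" n] by (simp add: epsilon_0_fixpoint X_def)
  have bad: "real (ocount \<epsilon>\<^sub>0 (\<lambda>\<alpha>. low (mcnf \<alpha>) = mcnf \<alpha>) n) \<le> (real n + 1) ^ card Y" for n
  proof -
    have "ocount \<epsilon>\<^sub>0 (\<lambda>\<alpha>. low (mcnf \<alpha>) = mcnf \<alpha>) n = card {M \<in> wmsets X cw n. low M = M}"
      using ocount_omega_pow[of "\<epsilon>\<^sub>0" "\<lambda>M. low M = M" n] by (simp add: epsilon_0_fixpoint X_def)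
    also have "\<dots> \<le> wcount Y cw n"
      unfolding wcount_def by (intro card_mono finite_wmsets gY) (auto simp: wmsets_def low_def filter_mset_eq_conv)
    also have "\<dots> \<le> (n + 1) ^ card Y" by (rule wcount_finite_le[OF Y(1) gY])
    finally have "real (ocount \<epsilon>\<^sub>0 (\<lambda>\<alpha>. low (mcnf \<alpha>) = mcnf \<alpha>) n) \<le> real ((n + 1) ^ card Y)"
      by (simp only: of_nat_le_iff)
    then show ?thesis by (simp add: add.commute)
  qed
  \<comment> \<open>Ordinals below \<omega>^m are at most polynomially many in each norm, and
    \<open>1 / c n\<close> is at most \<open>K * r ^ n\<close>. So the terms of the majorant series
    also bound the share of these exceptions.\<close>
  have limbad: "(\<lambda>n. K * ((real n + 1) ^ card Y * r ^ n)) \<longlonglongrightarrow> 0"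
    by (rule summable_LIMSEQ_zero[OF smM])
  have diff: "\<bar>real (ocount \<epsilon>\<^sub>0 (\<lambda>\<alpha>. \<alpha> \<Turnstile> \<phi>) n) - real (ocount \<epsilon>\<^sub>0 (\<lambda>\<alpha>. low (mcnf \<alpha>) \<in> V) n)\<bar>
      \<le> real (ocount \<epsilon>\<^sub>0 (\<lambda>\<alpha>. low (mcnf \<alpha>) = mcnf \<alpha>) n)" for n
  proof -
    have le: "ocount \<epsilon>\<^sub>0 R n \<le> ocount \<epsilon>\<^sub>0 R' n + ocount \<epsilon>\<^sub>0 (\<lambda>\<alpha>. low (mcnf \<alpha>) = mcnf \<alpha>) n"
      if "\<And>\<alpha>. low (mcnf \<alpha>) \<noteq> mcnf \<alpha> \<Longrightarrow> R \<alpha> \<Longrightarrow> R' \<alpha>" for R R'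
    proof -
      have "ocount \<epsilon>\<^sub>0 R n \<le> card ({\<alpha>. \<alpha> < \<epsilon>\<^sub>0 \<and> R' \<alpha> \<and> cnf_norm \<alpha> = n} \<union>
          {\<alpha>. \<alpha> < \<epsilon>\<^sub>0 \<and> low (mcnf \<alpha>) = mcnf \<alpha> \<and> cnf_norm \<alpha> = n})"
        unfolding ocount_def using that by (intro card_mono finite_UnI finite_norm_eq) auto
      also have "\<dots> \<le> ocount \<epsilon>\<^sub>0 R' n + ocount \<epsilon>\<^sub>0 (\<lambda>\<alpha>. low (mcnf \<alpha>) = mcnf \<alpha>) n"
        unfolding ocount_def by (rule card_Un_le)
      finally show ?thesis .
    qed
    show ?thesis
      using le[of "\<lambda>\<alpha>. \<alpha> \<Turnstile> \<phi>" "\<lambda>\<alpha>. low (mcnf \<alpha>) \<in> V"] le[of "\<lambda>\<alpha>. low (mcnf \<alpha>) \<in> V" "\<lambda>\<alpha>. \<alpha> \<Turnstile> \<phi>"] V_iff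
      by auto
  qed
  have lim2: "(\<lambda>n. real (ocount \<epsilon>\<^sub>0 (\<lambda>\<alpha>. \<alpha> \<Turnstile> \<phi>) n) / c n - real (ocount \<epsilon>\<^sub>0 (\<lambda>\<alpha>. low (mcnf \<alpha>) \<in> V) n) / c n) \<longlonglongrightarrow> 0"
  proof (rule Lim_null_comparison[OF always_eventually limbad], intro allI)
    fix n
    have c0: "c 0 = 1" by (simp add: c_def wcount_0[OF g])
    have "1 / c n \<le> K * r ^ n"
      using decay[of 0 n] cpos[of n] c0 by (simp add: pos_divide_le_eq)
    then have "(real n + 1) ^ card Y * (1 / c n) \<le> (real n + 1) ^ card Y * (K * r ^ n)"
      by (rule mult_left_mono) simp
    moreover have "real (ocount \<epsilon>\<^sub>0 (\<lambda>\<alpha>. low (mcnf \<alpha>) = mcnf \<alpha>) n) / c n \<le> (real n + 1) ^ card Y / c n"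
      by (rule divide_right_mono[OF bad less_imp_le[OF cpos]])
    moreover have "norm (real (ocount \<epsilon>\<^sub>0 (\<lambda>\<alpha>. \<alpha> \<Turnstile> \<phi>) n) / c n - real (ocount \<epsilon>\<^sub>0 (\<lambda>\<alpha>. low (mcnf \<alpha>) \<in> V) n) / c n)
        \<le> real (ocount \<epsilon>\<^sub>0 (\<lambda>\<alpha>. low (mcnf \<alpha>) = mcnf \<alpha>) n) / c n"
      using divide_right_mono[OF diff[of n] less_imp_le[OF cpos[of n]]] cpos[of n]
      by (simp add: diff_divide_distrib[symmetric] abs_divide)
    ultimately show "norm (real (ocount \<epsilon>\<^sub>0 (\<lambda>\<alpha>. \<alpha> \<Turnstile> \<phi>) n) / c n - real (ocount \<epsilon>\<^sub>0 (\<lambda>\<alpha>. low (mcnf \<alpha>) \<in> V) n) / c n)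
        \<le> K * ((real n + 1) ^ card Y * r ^ n)"
      by (simp add: ac_simps)
  qed
  have lim3: "(\<lambda>n. real (ocount \<epsilon>\<^sub>0 (\<lambda>\<alpha>. \<alpha> \<Turnstile> \<phi>) n) / c n) \<longlonglongrightarrow> (\<Sum>k. h k * (b * \<rho> ^ k))"
    using tendsto_add[OF lim2 lim1[folded oc]] by simp
  have feq: "real (ocount \<epsilon>\<^sub>0 (\<lambda>\<alpha>. \<alpha> \<Turnstile> \<phi>) n) / c n = mso_fraction \<epsilon>\<^sub>0 \<phi> n" for n
    using ocount_omega_pow_True[of "\<epsilon>\<^sub>0" n]
    by (simp add: mso_fraction_def ocount_def c_def X_def epsilon_0_fixpoint)
  have "mso_fraction \<epsilon>\<^sub>0 \<phi> \<longlonglongrightarrow> (\<Sum>k. h k * (b * \<rho> ^ k))"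
    by (rule lim3[unfolded feq])
  then show ?thesis by blast
qed

theorem mainTheorem2:
  fixes \<beta> :: ordinal
  assumes "omega_pow \<omega> \<le> \<beta>" and "\<beta> \<le> \<epsilon>\<^sub>0"
  shows "\<forall>\<phi>. sentence \<phi> \<longrightarrow>
    (\<exists>L. mso_fraction \<beta> \<phi> \<longlonglongrightarrow> L \<and> (\<beta> < \<epsilon>\<^sub>0 \<longrightarrow> L \<in> \<rat>))"
proof (intro allI impI)
  fix \<phi> assume \<phi>: "sentence \<phi>"
  show "\<exists>L. mso_fraction \<beta> \<phi> \<longlonglongrightarrow> L \<and> (\<beta> < \<epsilon>\<^sub>0 \<longrightarrow> L \<in> \<rat>)"
  proof (cases "\<beta> < \<epsilon>\<^sub>0")
    case True
    then show ?thesis using limit_law_below_epsilon_0[OF \<phi> assms(1) True] by blast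
  next
    case False
    then have "\<beta> = \<epsilon>\<^sub>0" using assms(2) by simp
    then show ?thesis using limit_law_epsilon_0[OF \<phi>] by blast
  qed
qed

end
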